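(* Let $n\ge 9$ be an odd integer that is not square-free, and assume that every prime factor of $n$ is greater than $5$. Assume that $(x_0,\dots,x_4)\in G^5$ satisfies $(\tan x_0)^2=(\tan x_1)(\tan x_2)(\tan x_3)(\tan x_4)$ with $0<x_i<\frac{\pi}{2}$ and $\operatorname{den}(x_i)=4n$ for each $0\le i\le 4$. Then there exist a permutation $\sigma$ of $\{1,2,3,4\}$ and rationals $s,t$ with $0<s<\frac12$, $0<t\le\frac14$ such that $x_0=x_{\sigma(1)}=x_{\sigma(2)}=s\pi$, $x_{\sigma(3)}=t\pi$ and $x_{\sigma(4)}=(\frac12-t)\pi$.
   Context: $G:=\mathbb{Q}\pi$; for nonzero $g\in G$, $\operatorname{den}(g)$ is the denominator of $g/\pi$ in lowest terms. *)

theory Defs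
  imports
    "HOL-Analysis.Analysis"
    "HOL-Computational_Algebra.Squarefree"
    "HOL-Combinatorics.Permutations"
begin

definition G :: "real set" where
  "G = {of_rat q * pi | q :: rat. True}"

text \<open>\<open>quotient_of\<close> returns numerator and denominator in lowest terms, with positive
  denominator. The value \<open>den g\<close> is meaningful only for \<open>g \<in> G\<close>, where the rational below is
  unique.\<close>

definition den :: "real \<Rightarrow> nat" where
  "den g = nat (snd (quotient_of (THE q :: rat. g / pi = of_rat q)))"

lemma den_of_rat_pi: "den (of_rat q * pi) = nat (snd (quotient_of q))"
  by (simp add: den_def)

end

theory Submission
  imports Defs
    "HOL-Computational_Algebra.Computational_Algebra"
    "HOL-Number_Theory.Cong"
    "HOL-Real_Asymp.Real_Asymp"
begin

text \<open>
  Write \<open>N = 4 n\<close>, \<open>\<zeta>\<close> for the primitive \<open>N\<close>-th root of unity and \<open>x\<^sub>i = a\<^sub>i \<pi> / N\<close>. Since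
  \<open>\<i> tan x\<^sub>i = (\<zeta>^a\<^sub>i - 1) / (\<zeta>^a\<^sub>i + 1)\<close>, Galois conjugation turns the equation into the relations
  \<open>2 f(k a\<^sub>0) = f(k a\<^sub>1) + \<dots> + f(k a\<^sub>4)\<close> for all \<open>k\<close> prime to \<open>N\<close>, where \<open>f(a) = ln |tan (a \<pi> / N)|\<close>.
  The functions on the unit group annihilated by \<open>f\<close> in this sense, with the symmetries
  \<open>D(-a) = D(a)\<close> and \<open>D(a + 2n) = - D(a)\<close>, form a translation-invariant space. If its member \<open>D\<close>
  coming from the given relation is nonzero, then differences \<open>D(a) - D(a h)\<close> with suitable
  \<open>h\<close>, one for every prime \<open>q\<close> dividing \<open>n\<close>, produce a nonzero member whose sums over the cosets of
  the \<open>q\<close>-parts of the unit group vanish; this uses that \<open>D\<close> is supported on few points while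
  every \<open>q\<close> exceeds \<open>5\<close>. Such a member yields a Dirichlet character \<open>\<phi>\<close> whose conductor is
  divisible by every prime factor of \<open>N\<close>, and evaluating Gauss sums gives
  \<open>L(1, \<phi>\<^sup>-\<^sup>1) = 0\<close>. For a prime \<open>p\<close> with \<open>p\<^sup>2\<close> dividing \<open>n\<close> one can choose \<open>h\<close> congruent to \<open>1\<close>
  modulo \<open>N / p\<close>, which makes \<open>\<phi>\<close> nontrivial on a group of order \<open>p\<close>; so \<open>\<phi>\<^sup>2\<close> is nontrivial and
  the classical \<open>3 + 4 cos t + cos 2t\<close> argument excludes \<open>L(1, \<phi>\<^sup>-\<^sup>1) = 0\<close>. Hence \<open>D = 0\<close>, so the
  relation is a formal consequence of \<open>f(2n - a) = - f(a)\<close>.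
\<close>

section \<open>Galois conjugation in cyclotomic fields\<close>

definition ipoly :: "int poly \<Rightarrow> complex \<Rightarrow> complex" where
  "ipoly P z = poly (map_poly of_int P) z"

lemma ipoly_0 [simp]: "ipoly 0 z = 0"
  and ipoly_pCons [simp]: "ipoly (pCons a P) z = of_int a + z * ipoly P z"
  and ipoly_1 [simp]: "ipoly 1 z = 1"
  by (simp_all add: ipoly_def map_poly_pCons one_pCons)

lemma ipoly_add [simp]: "ipoly (P + Q) z = ipoly P z + ipoly Q z"
proof -
  have "map_poly of_int (P + Q) = map_poly of_int P + (map_poly of_int Q :: complex poly)"
    by (rule poly_eqI) (simp add: coeff_map_poly)
  then show ?thesis by (simp add: ipoly_def)
qed

lemma ipoly_smult [simp]: "ipoly (smult c P) z = of_int c * ipoly P z"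
  by (induction P) (simp_all add: algebra_simps)

lemma ipoly_mult [simp]: "ipoly (P * Q) z = ipoly P z * ipoly Q z"
  by (induction P) (simp_all add: algebra_simps)

lemma ipoly_minus [simp]: "ipoly (- P) z = - ipoly P z"
  using ipoly_smult[of "-1" P z] by simp

lemma ipoly_diff [simp]: "ipoly (P - Q) z = ipoly P z - ipoly Q z"
  using ipoly_add[of P "-Q" z] by simp

lemma ipoly_power [simp]: "ipoly (P ^ k) z = ipoly P z ^ k"
  by (induction k) simp_all

lemma ipoly_monom [simp]: "ipoly (monom c k) z = of_int c * z ^ k"
  by (induction k) (simp_all add: monom_Suc monom_0)

lemma ipoly_pcompose [simp]: "ipoly (pcompose P Q) z = ipoly P (ipoly Q z)"
  by (induction P) (simp_all add: pcompose_pCons)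

lemma ipoly_prod: "ipoly (\<Prod>i\<in>A. P i) z = (\<Prod>i\<in>A. ipoly (P i) z)"
  by (induction A rule: infinite_finite_induct) simp_all

section \<open>Congruences modulo a prime\<close>

text \<open>The binomial coefficients strictly between the two ends are divisible by
  \<open>p\<close>. Stated in any commutative ring, it serves both integers and integer
  polynomials.\<close>

lemma prime_dvd_add_power:
  fixes x y :: "'a :: comm_ring_1"
  assumes "prime p"
  shows "of_nat p dvd (x + y) ^ p - x ^ p - y ^ p"
proof -
  have "(x + y) ^ p = (\<Sum>k\<le>p. of_nat (p choose k) * x ^ k * y ^ (p - k))"
    by (rule binomial_ring)
  also have "{..p} = insert 0 (insert p {0<..<p})" by auto
  also have "(\<Sum>k\<in>\<dots>. of_nat (p choose k) * x ^ k * y ^ (p - k))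
      = y ^ p + (x ^ p + (\<Sum>k\<in>{0<..<p}. of_nat (p choose k) * x ^ k * y ^ (p - k)))"
    using prime_gt_0_nat[OF assms] by simp
  finally have "(x + y) ^ p - x ^ p - y ^ p = (\<Sum>k\<in>{0<..<p}. of_nat (p choose k) * x ^ k * y ^ (p - k))"
    by simp
  moreover have "of_nat p dvd (\<Sum>k\<in>{0<..<p}. of_nat (p choose k) * x ^ k * y ^ (p - k))"
  proof (intro dvd_sum dvd_mult2)
    fix k assume "k \<in> {0<..<p}"
    then have "p dvd p choose k" using assms by (intro dvd_choose_prime) auto
    then show "of_nat p dvd (of_nat (p choose k) :: 'a)" by (auto elim!: dvdE)
  qed
  ultimately show ?thesis by simp
qed

lemma int_fermat:
  fixes a :: int
  assumes "prime p"
  shows "int p dvd a ^ p - a"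
proof -
  have nat: "int p dvd int b ^ p - int b" for b :: nat
  proof (induction b)
    case 0
    then show ?case using prime_gt_0_nat[OF assms] by (simp add: power_0_left)
  next
    case (Suc b)
    have "int (Suc b) ^ p - int (Suc b) = ((int b + 1) ^ p - int b ^ p - 1 ^ p) + (int b ^ p - int b)"
      by (simp add: add.commute)
    moreover have "int p dvd (int b + 1) ^ p - int b ^ p - 1 ^ p"
      using prime_dvd_add_power[OF assms, of "int b" 1] by simp
    ultimately show ?case using Suc by (metis dvd_add)
  qed
  define b where "b = nat (a mod int p)"
  have b: "[int b = a] (mod int p)"
    using prime_gt_0_nat[OF assms] by (simp add: b_def)
  have "[int b ^ p = int b] (mod int p)" using nat[of b] by (simp add: cong_iff_dvd_diff)
  then have "[a ^ p = a] (mod int p)" using b by (meson cong_pow cong_sym cong_trans)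
  then show ?thesis by (simp add: cong_iff_dvd_diff)
qed

text \<open>The Frobenius map fixes constants modulo \<open>p\<close>. For \<open>a + X * P\<close>,
  the sum is handled by \<open>prime_dvd_add_power\<close>, the constant by Fermat's little theorem
  and the rest by induction.\<close>

lemma int_poly_frobenius:
  assumes "prime p"
  shows "[:int p:] dvd P ^ p - pcompose P (monom 1 p)"
proof (induction P)
  case 0
  show ?case using assms by (simp add: prime_gt_0_nat power_0_left)
next
  case (pCons a P)
  note fermat = int_fermat[OF assms, of a] and binom = prime_dvd_add_power[OF assms]
  let ?m = "monom 1 p :: int poly"
  have pC: "[:int p:] = of_nat p" by (simp add: of_nat_poly)
  have e: "pCons a P = [:a:] + monom 1 1 * P" by (simp add: monom_Suc monom_0)
  have eq: "(pCons a P) ^ p - pcompose (pCons a P) ?m =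
     (([:a:] + monom 1 1 * P) ^ p - [:a:] ^ p - (monom 1 1 * P) ^ p) + ([:a:] ^ p - [:a:])
       + ?m * (P ^ p - pcompose P ?m)"
    unfolding e[symmetric] by (simp add: pcompose_pCons power_mult_distrib monom_power algebra_simps)
  have "[:int p:] dvd [:a:] ^ p - [:a:]"
  proof -
    have "[:a:] ^ p - [:a:] = [:a ^ p - a:]" by (simp add: poly_const_pow)
    then show ?thesis using fermat by (simp add: const_poly_dvd_iff coeff_pCons split: nat.split)
  qed
  moreover have "[:int p:] dvd ([:a:] + monom 1 1 * P) ^ p - [:a:] ^ p - (monom 1 1 * P) ^ p"
    unfolding pC by (rule binom)
  ultimately show ?case using pCons.IH unfolding eq by (intro dvd_add dvd_mult)
qed

section \<open>Minimal polynomials of roots of unity and the conjugations z -> z^k\<close>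

text \<open>Gauss's lemma: the factor \<open>c\<close> becomes invertible over the fraction field,
  and divisibility by a primitive polynomial descends to the integers.\<close>

lemma primitive_dvd_of_dvd_smult:
  assumes "g dvd smult c P" "c \<noteq> 0" "content g = (1::int)"
  shows "g dvd P"
proof -
  have "fract_poly g dvd fract_poly (smult c P)"
    using assms(1) by (rule fract_poly_dvd)
  then have "fract_poly g dvd smult (to_fract c) (fract_poly P)"
    by simp
  then have "fract_poly g dvd fract_poly P"
    using assms(2) by (simp add: dvd_smult_iff)
  then show ?thesis using assms(3) by (rule fract_poly_dvdD)
qed

text \<open>Take the primitive part of an annihilating polynomial of least degree. It divides
  \<open>X^N - 1\<close>, so its leading coefficient is a unit and can be made 1.\<close>

lemma exists_monic_min_int_poly:
  fixes z :: complex
  assumes "N > 0" "z ^ N = 1"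
  obtains f where "lead_coeff f = 1" "degree f > 0" "\<And>P. ipoly P z = 0 \<longleftrightarrow> f dvd P"
proof -
  define Q :: "int poly" where "Q = monom 1 N - 1"
  have Q: "ipoly Q z = 0" using assms by (simp add: Q_def)
  have lQ: "lead_coeff Q = 1" "Q \<noteq> 0"
  proof -
    have "degree Q = N" using assms degree_add_eq_left[of "-1" "monom (1::int) N"]
      by (simp add: Q_def degree_monom_eq)
    then show "lead_coeff Q = 1" using assms by (simp add: Q_def)
    then show "Q \<noteq> 0" by auto
  qed
  define S where "S = {P :: int poly. P \<noteq> 0 \<and> ipoly P z = 0}"
  have "Q \<in> S" using Q lQ by (simp add: S_def)
  then obtain h where h: "h \<in> S" "\<And>P. P \<in> S \<Longrightarrow> degree h \<le> degree P"
    using ex_has_least_nat[of "\<lambda>P. P \<in> S" Q degree] by blast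
  define g where "g = primitive_part h"
  have hg: "h = smult (content h) g" by (simp add: g_def)
  have g0: "ipoly g z = 0" "g \<noteq> 0" "content g = 1" "degree g = degree h"
  proof -
    have "h \<noteq> 0" using h(1) by (simp add: S_def)
    then show "g \<noteq> 0" "content g = 1" "degree g = degree h" by (simp_all add: g_def)
    have "ipoly h z = of_int (content h) * ipoly g z" by (subst hg) simp
    then show "ipoly g z = 0" using h(1) by (auto simp: S_def)
  qed
  have dv: "g dvd P" if P: "ipoly P z = 0" for P
  proof -
    obtain q r where qr: "pseudo_divmod P g = (q, r)" by fastforce
    \<comment> \<open>Pseudo-division stays in the integers at the price of a power of the leading
      coefficient, which Gauss's lemma removes again.\<close>
    have *: "smult (lead_coeff g ^ (Suc (degree P) - degree g)) P = g * q + r" "r = 0 \<or> degree r < degree g"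
      using pseudo_divmod[OF g0(2) qr] by auto
    have "ipoly r z = 0"
      using arg_cong[OF *(1), of "\<lambda>P. ipoly P z"] P g0 by simp
    then have "r \<noteq> 0 \<Longrightarrow> r \<in> S" by (simp add: S_def)
    then have "r = 0" using *(2) h(2)[of r] g0(4) by linarith
    then have "g dvd smult (lead_coeff g ^ (Suc (degree P) - degree g)) P" using *(1) by simp
    moreover have "lead_coeff g ^ (Suc (degree P) - degree g) \<noteq> 0" using g0(2) by simp
    ultimately show ?thesis using g0(3) by (rule primitive_dvd_of_dvd_smult)
  qed
  have "g dvd Q" by (rule dv[OF Q])
  then obtain k where "Q = g * k" by blast
  then have "lead_coeff g * lead_coeff k = 1" using lQ by (simp add: lead_coeff_mult)
  then have l: "lead_coeff g = 1 \<or> lead_coeff g = -1" 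
    by (auto simp: zmult_eq_1_iff)
  define f where "f = smult (lead_coeff g) g"
  show ?thesis
  proof
    show "lead_coeff f = 1" using l by (auto simp: f_def)
    have eq: "f dvd P \<longleftrightarrow> g dvd P" for P
      using l by (auto simp: f_def)
    show "ipoly P z = 0 \<longleftrightarrow> f dvd P" for P
      unfolding eq using dv g0(1) by auto
    show "degree f > 0"
    proof (rule ccontr)
      assume "\<not> degree f > 0"
      with \<open>lead_coeff f = 1\<close> have "f = 1"
        by (auto elim!: degree_eq_zeroE simp: one_pCons)
      then have "f dvd 1" by simp
      then show False using \<open>ipoly 1 z = 0 \<longleftrightarrow> f dvd 1\<close> by simp
    qed
  qed
qed

text \<open>Dedekind's argument for cyclotomic polynomials. Write \<open>X^N - 1 = f * h\<close>
  with \<open>f\<close> minimal. If \<open>f(z^p)\<close> were nonzero, \<open>h(z^p) = 0\<close>,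
  so \<open>h(z)^p\<close> would lie in \<open>p Z[z]\<close>. Differentiating at \<open>z\<close>
  gives \<open>N = h(z) f'(z) z\<close>, whence \<open>N^p\<close> would lie in
  \<open>p Z[z]\<close>, which is impossible for \<open>p\<close> not dividing
  \<open>N\<close>.\<close>

lemma ipoly_root_power_prime:
  fixes z :: complex
  assumes N: "N > 0" "z ^ N = 1" and p: "prime p" "\<not> p dvd N" and P: "ipoly P z = 0"
  shows "ipoly P (z ^ p) = 0"
proof -
  obtain f where f: "lead_coeff f = 1" "degree f > 0" "\<And>P. ipoly P z = 0 \<longleftrightarrow> f dvd P"
    using exists_monic_min_int_poly[OF N] by blast
  have "ipoly f (z ^ p) = 0"
  proof (rule ccontr)
    assume nz: "ipoly f (z ^ p) \<noteq> 0"
    have "ipoly (monom 1 N - 1) z = 0" using N by simp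
    then obtain h where h: "monom 1 N - 1 = f * h" using f(3) by blast
    have "ipoly (monom 1 N - 1) (z ^ p) = 0" using N by (metis diff_self ipoly_diff ipoly_monom ipoly_1 mult.commute mult_1 of_int_1 power_mult power_one)
    then have "ipoly h (z ^ p) = 0" using nz h by simp
    then have "ipoly (pcompose h (monom 1 p)) z = 0" by simp
    moreover obtain r where "h ^ p - pcompose h (monom 1 p) = [:int p:] * r"
      using int_poly_frobenius[OF p(1), of h] by blast
    then have "ipoly (h ^ p - pcompose h (monom 1 p)) z = ipoly ([:int p:] * r) z" by simp
    ultimately have hp: "ipoly h z ^ p = of_nat p * ipoly r z" by simp
    have "pderiv (monom 1 N - 1) = pderiv (f * h)" using h by simp
    then have "monom (int N) (N - 1) = f * pderiv h + h * pderiv f"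
      by (simp add: pderiv_diff pderiv_monom pderiv_mult pderiv_1)
    then have "ipoly (monom (int N) (N - 1)) z = ipoly (f * pderiv h + h * pderiv f) z" by simp
    then have "of_nat N * z ^ (N - 1) = ipoly h z * ipoly (pderiv f) z"
      using f(3)[of f] by simp
    \<comment> \<open>The extra factor \<open>z\<close> turns \<open>z^(N-1)\<close> into 1.\<close>
    then have "(of_nat N * z ^ (N - 1)) * z = ipoly h z * ipoly (pderiv f) z * z" by simp
    then have "of_nat N = ipoly h z * ipoly (pderiv f) z * z"
      using N by (simp add: mult.assoc flip: power_Suc2)
    then have "of_nat N ^ p = of_nat p * ipoly r z * (ipoly (pderiv f) z * z) ^ p"
      using hp by (simp add: power_mult_distrib mult.assoc)
    then have "ipoly ([:int N ^ p:] - [:int p:] * (r * (pderiv f * monom 1 1) ^ p)) z = 0"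
      by (simp add: algebra_simps)
    then obtain b where b: "[:int N ^ p:] - [:int p:] * (r * (pderiv f * monom 1 1) ^ p) = f * b"
      using f(3) by blast
    define s where "s = r * (pderiv f * monom 1 1) ^ p"
    have notdvd: "\<not> int p dvd int N ^ p"
      using p prime_dvd_power_int[of "int p"] by (metis int_dvd_int_iff prime_nat_int_transfer)
    have "\<exists>j. \<not> int p dvd coeff b j"
    proof (rule ccontr)
      assume "\<nexists>j. \<not> int p dvd coeff b j"
      then have "[:int p:] dvd b" by (simp add: const_poly_dvd_iff)
      then have "[:int p:] dvd f * b" by simp
      then have "[:int p:] dvd [:int N ^ p:]" using b[symmetric]
        by (metis diff_add_cancel dvd_add dvd_triv_left)
      then have "int p dvd coeff [:int N ^ p:] 0" unfolding const_poly_dvd_iff by blast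
      then show False using notdvd by simp
    qed
    moreover have "{j. \<not> int p dvd coeff b j} \<subseteq> {..degree b}"
    proof
      fix j assume "j \<in> {j. \<not> int p dvd coeff b j}"
      then have "coeff b j \<noteq> 0" by auto
      then show "j \<in> {..degree b}" by (simp add: le_degree)
    qed
    then have fin: "finite {j. \<not> int p dvd coeff b j}" by (rule finite_subset) simp
    \<comment> \<open>At degree \<open>degree f + j\<close> the monic \<open>f\<close> contributes
      \<open>coeff b j\<close>, the last coefficient of \<open>b\<close> not divisible by
      \<open>p\<close>; all other contributions are multiples of \<open>p\<close>. The degree is
      positive, so the constant \<open>N^p\<close> does not reach it and the coefficient must be a
      multiple of \<open>p\<close>.\<close>
    define j where "j = Max {j. \<not> int p dvd coeff b j}"
    ultimately have j: "\<not> int p dvd coeff b j"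
      using Max_in[OF fin] unfolding j_def by blast
    have j': "i \<le> j" if "\<not> int p dvd coeff b i" for i
      unfolding j_def using that by (intro Max_ge[OF fin]) simp
    have "coeff (f * b) (degree f + j) = (\<Sum>i\<le>degree f + j. coeff f i * coeff b (degree f + j - i))"
      by (rule coeff_mult)
    also have "\<dots> = coeff f (degree f) * coeff b j + (\<Sum>i\<in>{..degree f + j} - {degree f}. coeff f i * coeff b (degree f + j - i))"
      by (subst sum.remove[of _ "degree f"]) auto
    finally have c: "coeff (f * b) (degree f + j) = coeff b j + (\<Sum>i\<in>{..degree f + j} - {degree f}. coeff f i * coeff b (degree f + j - i))"
      using f(1) by simp
    have "int p dvd (\<Sum>i\<in>{..degree f + j} - {degree f}. coeff f i * coeff b (degree f + j - i))"
    proof (rule dvd_sum)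
      fix i assume i: "i \<in> {..degree f + j} - {degree f}"
      show "int p dvd coeff f i * coeff b (degree f + j - i)"
      proof (cases "i < degree f")
        case True
        then have "int p dvd coeff b (degree f + j - i)" using j'[of "degree f + j - i"] by force
        then show ?thesis by simp
      qed (use i coeff_eq_0[of f i] in auto)
    qed
    moreover have "int p dvd coeff (f * b) (degree f + j)"
      using f(2) unfolding b[symmetric] by (cases "degree f + j") auto
    ultimately show False using j unfolding c by (simp add: dvd_add_left_iff)
  qed
  moreover obtain g where "P = f * g" using P f(3) by blast
  ultimately show ?thesis by simp
qed

text \<open>Induction over the prime factors of \<open>k\<close>. The root must vary, because each
  step replaces \<open>z\<close> by the root of unity \<open>z ^ p\<close>.\<close>

theorem ipoly_root_power_coprime:
  fixes z :: complex
  assumes N: "N > 0" "z ^ N = 1" and "coprime k N" and "ipoly P z = 0"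
  shows "ipoly P (z ^ k) = 0"
  using assms
proof (induction k arbitrary: z rule: prime_divisors_induct)
  case zero
  then have "N = 1" by simp
  then show ?case using zero by simp
next
  case (unit k)
  then show ?case by simp
next
  case (factor p k)
  have "ipoly P (z ^ p) = 0"
  proof (rule ipoly_root_power_prime[OF factor.prems(1,2) \<open>prime p\<close>])
    have "coprime p N" using factor.prems(3) by simp
    then show "\<not> p dvd N" using \<open>prime p\<close>
      by (meson coprime_common_divisor dvd_refl not_prime_unit)
  qed (use factor.prems in simp)
  moreover have "(z ^ p) ^ N = 1" using factor.prems by (metis mult.commute power_mult power_one)
  ultimately show ?case using factor.IH[of "z ^ p"] factor.prems by (simp add: power_mult)
qed

section \<open>Non-vanishing of \<open>L(1, \<psi>)\<close>\<close>

text \<open>Real part of the Taylor series of \<open>- Ln (1 - w)\<close>. The term at index 0 is 0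
  because division by 0 yields 0.\<close>

lemma sums_ln_norm_one_minus:
  assumes "norm w < 1"
  shows "(\<lambda>n. Re (w ^ n) / of_nat n) sums - ln (norm (1 - w))"
proof -
  have "(\<lambda>n. (-1) ^ Suc n / of_nat n * (- w) ^ n) sums Ln (1 + - w)"
    using assms by (intro Ln_series) simp
  moreover have "(-1) ^ Suc n / of_nat n * (- w) ^ n = - (w ^ n / of_nat n)" for n
  proof -
    have "(-1) ^ Suc n * (- w) ^ n = - ((-1 * - w) ^ n)" unfolding power_mult_distrib by simp
    also have "\<dots> = - (w ^ n)" by simp
    finally show ?thesis by (simp only: times_divide_eq_left minus_divide_left)
  qed
  ultimately have "(\<lambda>n. - (w ^ n / of_nat n)) sums Ln (1 - w)" by (simp only: add_uminus_conv_diff)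
  then have "(\<lambda>n. w ^ n / of_nat n) sums - Ln (1 - w)" using sums_minus by fastforce
  then have "(\<lambda>n. Re (w ^ n / of_nat n)) sums Re (- Ln (1 - w))" by (rule sums_Re)
  moreover have "1 - w \<noteq> 0" using assms by auto
  ultimately show ?thesis by (simp add: Re_Ln)
qed

text \<open>Minus the logarithm of the product is a power series in \<open>t\<close> whose
  coefficients are nonnegative: with \<open>c = Re (z ^ n)\<close> one has
  \<open>3 + 4 c + (2 c^2 - 1) = 2 (1 + c)^2\<close>.\<close>

lemma mertens_3_4_1:
  fixes t :: real and z :: complex
  assumes t: "0 \<le> t" "t < 1" and z: "norm z = 1"
  shows "norm (1 - of_real t :: complex) ^ 3 * norm (1 - of_real t * z) ^ 4 * norm (1 - of_real t * z\<^sup>2) \<le> 1"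
proof -
  define w where "w = (of_real t :: complex)"
  have nw: "norm w < 1" "norm (w * z) < 1" "norm (w * z\<^sup>2) < 1"
    using t z by (simp_all add: w_def norm_mult norm_power)
  have pos: "norm (1 - w) > 0" "norm (1 - w * z) > 0" "norm (1 - w * z\<^sup>2) > 0"
    using nw by auto
  have "(\<lambda>n. 3 * (Re (w ^ n) / of_nat n) + 4 * (Re ((w * z) ^ n) / of_nat n) + Re ((w * z\<^sup>2) ^ n) / of_nat n)
     sums (3 * (- ln (norm (1 - w))) + 4 * (- ln (norm (1 - w * z))) + (- ln (norm (1 - w * z\<^sup>2))))"
    by (intro sums_add sums_mult sums_ln_norm_one_minus nw)
  moreover have "0 \<le> 3 * (Re (w ^ n) / of_nat n) + 4 * (Re ((w * z) ^ n) / of_nat n) + Re ((w * z\<^sup>2) ^ n) / of_nat n" for n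
  proof -
    define c where "c = Re (z ^ n)"
    have wn: "w ^ n = of_real (t ^ n)" by (simp add: w_def)
    have "(Re (z ^ n))\<^sup>2 + (Im (z ^ n))\<^sup>2 = 1"
      using z by (simp add: norm_power flip: cmod_power2)
    then have "Re ((z ^ n)\<^sup>2) = 2 * c\<^sup>2 - 1"
      by (simp add: c_def power2_eq_square)
    then have r: "Re ((w * z\<^sup>2) ^ n) = t ^ n * (2 * c\<^sup>2 - 1)"
      by (simp add: power_mult_distrib wn power_mult[symmetric] mult.commute[of 2])
    have "3 * Re (w ^ n) + 4 * Re ((w * z) ^ n) + Re ((w * z\<^sup>2) ^ n) = 2 * (t ^ n * (1 + c)\<^sup>2)"
      unfolding r by (simp add: power_mult_distrib wn c_def power2_eq_square algebra_simps)
    then have "0 \<le> (3 * Re (w ^ n) + 4 * Re ((w * z) ^ n) + Re ((w * z\<^sup>2) ^ n)) / of_nat n"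
      using t by simp
    then show ?thesis by (simp add: add_divide_distrib)
  qed
  ultimately have "0 \<le> 3 * (- ln (norm (1 - w))) + 4 * (- ln (norm (1 - w * z))) + (- ln (norm (1 - w * z\<^sup>2)))"
    by (rule sums_le[OF _ sums_zero, rotated])
  moreover have "ln (norm (1 - w) ^ 3 * norm (1 - w * z) ^ 4 * norm (1 - w * z\<^sup>2))
     = 3 * ln (norm (1 - w)) + 4 * ln (norm (1 - w * z)) + ln (norm (1 - w * z\<^sup>2))"
    using pos by (simp add: ln_mult ln_realpow)
  ultimately have "ln (norm (1 - w) ^ 3 * norm (1 - w * z) ^ 4 * norm (1 - w * z\<^sup>2)) \<le> 0" by simp
  then show ?thesis using pos by (simp add: w_def)
qed

section \<open>Euler products by sieving\<close>

lemma infsum_sieve: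
  fixes a :: "nat \<Rightarrow> complex"
  assumes mult: "\<And>m n. a (m * n) = a m * a n"
    and sm: "a summable_on UNIV" and S: "finite S" "\<And>p. p \<in> S \<Longrightarrow> prime p"
  shows "infsum a {n. \<forall>p\<in>S. \<not> p dvd n} = (\<Prod>p\<in>S. 1 - a p) * infsum a UNIV"
  using S
proof (induction S rule: finite_induct)
  case (insert p S)
  define A where "A S = {n :: nat. \<forall>p\<in>S. \<not> p dvd n}" for S
  have sm': "a summable_on B" for B using sm by (rule summable_on_subset_banach) simp
  have p: "prime p" using insert.prems by simp
  \<comment> \<open>The second set collects the multiples of \<open>p\<close> that survive
    \<open>S\<close>; their cofactors survive \<open>S\<close> too, so their sum is
    \<open>a p\<close> times the sum being sieved.\<close>
  have eq: "A S = A (insert p S) \<union> (\<lambda>m. p * m) ` A S"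
  proof (intro equalityI subsetI)
    fix n assume "n \<in> A S"
    then show "n \<in> A (insert p S) \<union> (\<lambda>m. p * m) ` A S" by (cases "p dvd n") (auto simp: A_def elim!: dvdE intro!: imageI)
  next
    fix n assume n: "n \<in> A (insert p S) \<union> (\<lambda>m. p * m) ` A S"
    show "n \<in> A S"
    proof (cases "n \<in> A (insert p S)")
      case False
      then obtain m where m: "m \<in> A S" "n = p * m" using n by auto
      have "\<not> q dvd n" if q: "q \<in> S" for q
      proof
        assume "q dvd n"
        moreover have "prime q" using q insert.prems by simp
        ultimately have "q dvd p \<or> q dvd m" unfolding m(2) by (simp add: prime_dvd_mult_iff)
        moreover have "\<not> q dvd p" using p \<open>prime q\<close> q insert.hyps by (metis primes_dvd_imp_eq)
        ultimately show False using m(1) q by (simp add: A_def)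
      qed
      then show ?thesis by (simp add: A_def)
    qed (simp add: A_def)
  qed
  have "infsum a (A S) = infsum a (A (insert p S)) + infsum a ((\<lambda>m. p * m) ` A S)"
    by (subst eq, rule infsum_Un_disjoint) (auto intro: sm' simp: A_def)
  also have "infsum a ((\<lambda>m. p * m) ` A S) = infsum (\<lambda>m. a p * a m) (A S)"
    using p by (subst infsum_reindex) (auto simp: inj_on_def o_def mult)
  also have "\<dots> = a p * infsum a (A S)"
    by (rule infsum_cmult_right) (rule sm')
  finally have "infsum a (A (insert p S)) = infsum a (A S) - a p * infsum a (A S)" by (metis add_diff_cancel_right')
  then have "infsum a (A (insert p S)) = (1 - a p) * infsum a (A S)" by (simp add: left_diff_distrib)
  then show ?case using insert by (simp add: A_def mult.assoc)
qed simp

text \<open>After sieving by the primes up to \<open>y\<close>, only 1 and numbers exceeding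
  \<open>y\<close> contribute. This product form of Euler's identity involves neither an infinite
  product nor division by the series.\<close>

lemma sieve_tendsto_1:
  fixes a :: "nat \<Rightarrow> complex"
  assumes mult: "\<And>m n. a (m * n) = a m * a n" and a0: "a 0 = 0" and a1: "a 1 = 1"
    and sm: "summable (\<lambda>n. norm (a n))"
  shows "(\<lambda>y. (\<Prod>p | prime p \<and> p \<le> y. 1 - a p) * suminf a) \<longlonglongrightarrow> 1"
proof -
  have smn: "(\<lambda>n. norm (a n)) summable_on UNIV" using sm by (simp add: summable_on_UNIV_nonneg_real_iff)
  have smU: "a summable_on UNIV" using smn by (rule abs_summable_summable)
  have si: "suminf a = infsum a UNIV"
    using has_sum_imp_sums[OF has_sum_infsum[OF smU]] by (simp add: sums_iff)
  have sn: "infsum (\<lambda>n. norm (a n)) UNIV = (\<Sum>n. norm (a n))"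
    using has_sum_imp_sums[OF has_sum_infsum[OF smn]] by (simp add: sums_iff)
  define T where "T y = (\<Sum>n. norm (a n)) - (\<Sum>n<Suc y. norm (a n))" for y
  have "(\<lambda>y. \<Sum>n<Suc y. norm (a n)) \<longlonglongrightarrow> (\<Sum>n. norm (a n))"
    using summable_LIMSEQ[OF sm] by (rule LIMSEQ_Suc)
  from tendsto_diff[OF tendsto_const[of "\<Sum>n. norm (a n)"] this] have T0: "T \<longlonglongrightarrow> 0" unfolding T_def by (simp del: sum.lessThan_Suc)
  have "norm ((\<Prod>p | prime p \<and> p \<le> y. 1 - a p) * suminf a - 1) \<le> T y" for y
  proof -
    define S where "S = {p. prime p \<and> p \<le> y}"
    define B where "B = {n :: nat. \<forall>p\<in>S. \<not> p dvd n}"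
    have "(\<Prod>p\<in>S. 1 - a p) * suminf a = infsum a B"
      unfolding B_def si by (rule infsum_sieve[symmetric, OF mult smU]) (auto simp: S_def)
    also have "\<dots> = infsum a (B - {1} \<union> {1})"
      by (rule arg_cong[of _ _ "infsum a"]) (auto simp: B_def S_def)
    also have "\<dots> = infsum a (B - {1}) + infsum a {1}"
      by (rule infsum_Un_disjoint) (auto intro: summable_on_subset_banach[OF smU])
    finally have "(\<Prod>p\<in>S. 1 - a p) * suminf a - 1 = infsum a (B - {1})" using a1 by simp
    \<comment> \<open>For \<open>y < 2\<close> nothing is sieved and 0 is still in
      \<open>B\<close>.\<close>
    also have "\<dots> = infsum a (B - {0, 1})"
      by (rule infsum_cong_neutral) (use a0 in auto)
    also have "norm \<dots> \<le> infsum (\<lambda>n. norm (a n)) (B - {0, 1})"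
      by (rule norm_infsum_bound) (rule summable_on_subset_banach[OF smn], simp)
    also have "\<dots> \<le> infsum (\<lambda>n. norm (a n)) (- {..<Suc y})"
    proof (rule infsum_mono_neutral)
      fix n assume n: "n \<in> B - {0, 1} - - {..<Suc y}"
      then have "n \<noteq> 1" "n \<noteq> 0" "n \<le> y" by auto
      then obtain p where "prime p" "p dvd n" using prime_factor_nat by blast
      then have "p \<in> S" using \<open>n \<le> y\<close> \<open>n \<noteq> 0\<close> dvd_imp_le[of p n] by (simp add: S_def)
      then have "n \<notin> B" using \<open>p dvd n\<close> by (auto simp: B_def)
      then show "norm (a n) \<le> 0" using n by simp
    qed (auto intro: summable_on_subset_banach[OF smn])
    also have "\<dots> = infsum (\<lambda>n. norm (a n)) UNIV - infsum (\<lambda>n. norm (a n)) {..<Suc y}"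
      unfolding Compl_eq_Diff_UNIV by (rule infsum_Diff) (auto intro: summable_on_subset_banach[OF smn])
    also have "\<dots> = T y" by (simp add: T_def sn)
    finally show ?thesis by (simp add: S_def)
  qed
  then have "(\<lambda>y. (\<Prod>p | prime p \<and> p \<le> y. 1 - a p) * suminf a - 1) \<longlonglongrightarrow> 0"
    by (intro Lim_null_comparison[OF _ T0]) auto
  then show ?thesis by (simp add: LIM_zero_iff)
qed

section \<open>Bounds by partial summation\<close>

text \<open>Full periods sum to 0, which leaves fewer than \<open>N\<close> terms of norm at most
  1.\<close>

lemma norm_sum_periodic_le:
  fixes \<psi> :: "nat \<Rightarrow> complex"
  assumes N: "N > 0" and per: "\<And>n. \<psi> (n + N) = \<psi> n" and zero: "(\<Sum>n<N. \<psi> n) = 0" and le: "\<And>n. norm (\<psi> n) \<le> 1"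
  shows "norm (\<Sum>k<n. \<psi> k) \<le> N"
proof (induction n rule: less_induct)
  case (less n)
  show ?case
  proof (cases "n < N")
    case True
    have "norm (\<Sum>k<n. \<psi> k) \<le> (\<Sum>k<n. 1)" by (rule sum_norm_le) (rule le)
    then show ?thesis using True by simp
  next
    case False
    then obtain m where m: "n = m + N" "m < n" using N by (metis add.commute le_Suc_ex less_add_same_cancel1 not_less)
    have "(\<Sum>k<m + N. \<psi> k) = (\<Sum>k<N. \<psi> k) + (\<Sum>k<m. \<psi> (k + N))"
      by (induction m) (simp_all add: add.assoc)
    then show ?thesis using less[OF m(2)] zero per m(1) by simp
  qed
qed

text \<open>Abel summation: \<open>K\<close> bounds the partial sums, \<open>V\<close> the total
  variation of the weights, and the boundary term tends to 0.\<close>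

lemma norm_sums_by_parts_le:
  fixes \<psi> :: "nat \<Rightarrow> complex" and b :: "nat \<Rightarrow> real"
  assumes S: "\<And>n. norm (\<Sum>k<n. \<psi> k) \<le> K" and b: "b \<longlonglongrightarrow> 0"
    and V: "\<And>n. (\<Sum>k<n. \<bar>b k - b (Suc k)\<bar>) \<le> V"
    and T: "(\<lambda>n. \<psi> n * of_real (b n)) sums T"
  shows "norm T \<le> K * V"
proof -
  define s where "s n = (\<Sum>k<n. \<psi> k)" for n
  have K: "K \<ge> 0" using S[of 0] by simp
  have parts: "(\<Sum>k<n. \<psi> k * of_real (b k)) = s n * of_real (b n) + (\<Sum>k<n. s (Suc k) * of_real (b k - b (Suc k)))" for n
    by (induction n) (simp_all add: s_def algebra_simps)
  have "norm (\<Sum>k<n. \<psi> k * of_real (b k)) \<le> K * \<bar>b n\<bar> + K * V" for n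
  proof -
    have "norm (\<Sum>k<n. s (Suc k) * of_real (b k - b (Suc k))) \<le> (\<Sum>k<n. K * \<bar>b k - b (Suc k)\<bar>)"
      by (rule sum_norm_le) (use S in \<open>auto simp: norm_mult s_def simp del: of_real_diff sum.lessThan_Suc intro!: mult_right_mono\<close>)
    also have "\<dots> \<le> K * V" using V K by (simp add: mult_left_mono flip: sum_distrib_left)
    finally have "norm (\<Sum>k<n. s (Suc k) * of_real (b k - b (Suc k))) \<le> K * V" .
    moreover have "norm (s n * of_real (b n)) \<le> K * \<bar>b n\<bar>"
      using S[of n] by (simp add: norm_mult s_def mult_right_mono)
    ultimately show ?thesis unfolding parts using norm_triangle_mono by blast
  qed
  moreover have "(\<lambda>n. norm (\<Sum>k<n. \<psi> k * of_real (b k))) \<longlonglongrightarrow> norm T"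
    using T unfolding sums_def by (rule tendsto_norm)
  moreover have "(\<lambda>n. K * \<bar>b n\<bar> + K * V) \<longlonglongrightarrow> K * \<bar>0\<bar> + K * V"
    by (intro tendsto_intros b)
  ultimately show ?thesis by (intro LIMSEQ_le[where X = "\<lambda>n. norm (\<Sum>k<n. \<psi> k * of_real (b k))"]) auto
qed

text \<open>The mean value theorem applied to \<open>x powr (- \<delta>)\<close>; it makes the sum
  for zeta(1 + \<delta>) comparable to a telescoping one.\<close>

lemma powr_one_minus_diff_le:
  fixes \<delta> :: real
  assumes "\<delta> > 0" "x > 0"
  shows "\<delta> * (x + 1) powr (- (1 + \<delta>)) \<le> x powr (- \<delta>) - (x + 1) powr (- \<delta>)"
proof -
  have "\<exists>z>x. z < x + 1 \<and> (x + 1) powr (- \<delta>) - x powr (- \<delta>) = (x + 1 - x) * (- \<delta> * z powr (- \<delta> - 1))"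
    using assms by (intro MVT2) (auto intro!: derivative_eq_intros simp: powr_diff)
  then obtain z where z: "z > x" "z < x + 1" "x powr (- \<delta>) - (x + 1) powr (- \<delta>) = \<delta> * z powr (- \<delta> - 1)"
    by auto
  have "(x + 1) powr (- (1 + \<delta>)) \<le> z powr (- (1 + \<delta>))"
    using z assms by (intro powr_mono2') auto
  then have "\<delta> * (x + 1) powr (- (1 + \<delta>)) \<le> \<delta> * z powr (- (1 + \<delta>))"
    using assms by (intro mult_left_mono) auto
  also have "z powr (- (1 + \<delta>)) = z powr (- \<delta> - 1)" by (rule arg_cong[where f = "(powr) z"]) simp
  finally show ?thesis using z by simp
qed

lemma powr_zeta_bound:
  fixes \<delta> :: real
  assumes "\<delta> > 0"
  shows "summable (\<lambda>n. real n powr (- (1 + \<delta>)))" "(\<Sum>n. real n powr (- (1 + \<delta>))) \<le> 1 + 1 / \<delta>"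
proof -
  show sm: "summable (\<lambda>n. real n powr (- (1 + \<delta>)))"
    using assms by (simp add: summable_real_powr_iff)
  have "(\<Sum>n<m. real n powr (- (1 + \<delta>))) \<le> 1 + 1 / \<delta>" for m
  proof -
    \<comment> \<open>The terms at 0 and 1 are 0 and 1, so telescoping begins at 2.\<close>
    have "(\<Sum>k<Suc (Suc m). real k powr (- (1 + \<delta>))) \<le> 1 + (1 - real (Suc m) powr (- \<delta>)) / \<delta>" for m
    proof (induction m)
      case (Suc m)
      have "\<delta> * real (Suc (Suc m)) powr (- (1 + \<delta>)) \<le> real (Suc m) powr (- \<delta>) - real (Suc (Suc m)) powr (- \<delta>)"
        using powr_one_minus_diff_le[OF assms, of "real (Suc m)"] by (simp add: add_ac)
      then have "real (Suc (Suc m)) powr (- (1 + \<delta>)) \<le> (real (Suc m) powr (- \<delta>) - real (Suc (Suc m)) powr (- \<delta>)) / \<delta>"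
        using assms by (simp add: field_simps)
      then show ?case using Suc by (simp add: diff_divide_distrib)
    qed simp
    from this[of m] have "(\<Sum>k<Suc (Suc m). real k powr (- (1 + \<delta>))) \<le> 1 + 1 / \<delta>"
      using assms by (smt (verit) divide_right_mono powr_ge_zero)
    moreover have "(\<Sum>n<m. real n powr (- (1 + \<delta>))) \<le> (\<Sum>k<Suc (Suc m). real k powr (- (1 + \<delta>)))"
      by (rule sum_mono2) auto
    ultimately show ?thesis by (rule order_trans[rotated])
  qed
  then show "(\<Sum>n. real n powr (- (1 + \<delta>))) \<le> 1 + 1 / \<delta>"
    using sm by (intro suminf_le_const) auto
qed

text \<open>By the mean value theorem the difference is
  \<open>((1 + \<delta>) z powr (- \<delta>) - 1) / z^2\<close> up to sign, and
  \<open>z powr (- \<delta>)\<close> lies between \<open>1 - \<delta> ln z\<close> and 1. The factor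
  \<open>\<delta>\<close> in the bound is what matters: it makes L(1 + \<delta>, \<psi>) of order
  \<delta> when L(1, \<psi>) = 0.\<close>

lemma inverse_minus_powr_variation:
  fixes \<delta> x :: real
  assumes "\<delta> > 0" "x \<ge> 1"
  shows "\<bar>(1 / x - x powr (- (1 + \<delta>))) - (1 / (x + 1) - (x + 1) powr (- (1 + \<delta>)))\<bar>
     \<le> \<delta> * ((1 + ln (x + 1)) / x\<^sup>2)"
proof -
  define b where "b x = 1 / x - x powr (- (1 + \<delta>))" for x :: real
  have "\<exists>z>x. z < x + 1 \<and> b (x + 1) - b x = (x + 1 - x) * ((1 + \<delta>) * z powr (- (1 + \<delta>) - 1) - 1 / z\<^sup>2)"
    unfolding b_def using assms
    by (intro MVT2) (auto intro!: derivative_eq_intros simp: power2_eq_square field_simps)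
  then obtain z where z: "z > x" "z < x + 1" "b (x + 1) - b x = (1 + \<delta>) * z powr (- (1 + \<delta>) - 1) - 1 / z\<^sup>2"
    by auto
  have z0: "z > 0" using z assms by simp
  have "z powr (- (1 + \<delta>) - 1) = z powr (- \<delta>) * z powr (- 2)"
    unfolding powr_add[symmetric] by (rule arg_cong[where f = "(powr) z"]) simp
  also have "z powr (- 2) = 1 / z\<^sup>2" using z0 by (simp add: powr_minus_divide)
  finally have e: "b (x + 1) - b x = ((1 + \<delta>) * z powr (- \<delta>) - 1) / z\<^sup>2"
    unfolding z(3) by (simp add: diff_divide_distrib)
  have "z powr (- \<delta>) = exp (- (\<delta> * ln z))" using z0 by (simp add: powr_def)
  then have p: "z powr (- \<delta>) \<ge> 1 - \<delta> * ln z" "z powr (- \<delta>) \<le> 1"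
    using exp_ge_add_one_self[of "- (\<delta> * ln z)"] z assms by auto
  have "\<bar>(1 + \<delta>) * z powr (- \<delta>) - 1\<bar> \<le> \<delta> * (1 + ln z)"
  proof -
    define u where "u = z powr (- \<delta>)"
    define l where "l = \<delta> * ln z"
    define v where "v = \<delta> * u"
    have "l \<ge> 0" unfolding l_def using z assms by simp
    moreover have "\<delta> * u \<le> \<delta> * 1" using p(2) assms unfolding u_def by (intro mult_left_mono) auto
    then have "v \<le> \<delta>" by (simp add: v_def)
    moreover have "v \<ge> 0" using assms by (simp add: u_def v_def)
    moreover have "u \<le> 1" "u \<ge> 1 - l" using p by (simp_all add: u_def l_def)
    ultimately have "\<bar>u + v - 1\<bar> \<le> \<delta> + l" using assms(1) by linarith
    moreover have "(1 + \<delta>) * u = u + v" "\<delta> * (1 + ln z) = \<delta> + l"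
      by (simp_all add: l_def v_def algebra_simps)
    ultimately show ?thesis unfolding u_def[symmetric] by simp
  qed
  also have "\<dots> \<le> \<delta> * (1 + ln (x + 1))" using z z0 assms by simp
  finally have "\<bar>b (x + 1) - b x\<bar> \<le> \<delta> * (1 + ln (x + 1)) / z\<^sup>2"
    unfolding e by (simp add: divide_right_mono)
  also have "\<dots> \<le> \<delta> * (1 + ln (x + 1)) / x\<^sup>2"
    using z assms by (intro divide_left_mono) (auto intro: power_mono)
  finally show ?thesis by (simp add: b_def abs_minus_commute)
qed

lemma summable_ln_over_square: "summable (\<lambda>n. (1 + ln (real n + 2)) / (real n + 1)\<^sup>2)"
proof (rule summable_comparison_test_bigo)
  show "summable (\<lambda>n. norm (real n powr (- (3 / 2))))"
    by (simp add: summable_real_powr_iff)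
  show "(\<lambda>n. (1 + ln (real n + 2)) / (real n + 1)\<^sup>2) \<in> O(\<lambda>n. real n powr (- (3 / 2)))"
    by real_asymp
qed

section \<open>Non-vanishing from the 3-4-1 inequality\<close>

text \<open>At 1 + \<delta>, the series for |\<psi>|, \<psi> and \<psi>^2 have product with
  exponents 3, 4, 1 at least 1. The first is O(1 / \<delta>); if L(1, \<psi>) = 0 the second is
  O(\<delta>); the third is bounded by \<open>z2\<close>. The product is then O(\<delta>), a
  contradiction for small \<delta>.\<close>

theorem periodic_multiplicative_L1_nonzero:
  fixes \<psi> :: "nat \<Rightarrow> complex"
  assumes N: "N > 0" and mult: "\<And>m n. \<psi> (m * n) = \<psi> m * \<psi> n" and \<psi>0: "\<psi> 0 = 0" and \<psi>1: "\<psi> 1 = 1"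
    and nrm: "\<And>n. \<psi> n = 0 \<or> norm (\<psi> n) = 1" and per: "\<And>n. \<psi> (n + N) = \<psi> n"
    and z1: "(\<Sum>n<N. \<psi> n) = 0" and z2: "(\<Sum>n<N. (\<psi> n)\<^sup>2) = 0"
  shows "\<not> (\<lambda>n. \<psi> n / of_nat n) sums 0"
proof
  assume S0: "(\<lambda>n. \<psi> n / of_nat n) sums 0"
  have le1: "norm (\<psi> n) \<le> 1" for n using nrm[of n] by auto
  \<comment> \<open>Partial summation will start at index 1, where the weights decrease; their value
    0 at index 0 is only a default.\<close>
  have shift: "(\<Sum>k<n. \<phi> (Suc k)) = (\<Sum>k<Suc n. \<phi> k)" if "\<phi> 0 = 0" for \<phi> :: "nat \<Rightarrow> complex" and n
    using that sum.lessThan_Suc_shift[of \<phi> n] by simp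
  have part1: "norm (\<Sum>k<n. \<psi> (Suc k)) \<le> N" for n
    unfolding shift[of \<psi>, OF \<psi>0] by (rule norm_sum_periodic_le[OF N per z1 le1])
  have part2: "norm (\<Sum>k<n. (\<psi> (Suc k))\<^sup>2) \<le> N" for n
    using shift[of "\<lambda>k. (\<psi> k)\<^sup>2" n] norm_sum_periodic_le[of N "\<lambda>k. (\<psi> k)\<^sup>2" "Suc n"] N per z2 le1 \<psi>0
    by (simp add: norm_power power_le_one)
  define K where "K = (\<Sum>n. (1 + ln (real n + 2)) / (real n + 1)\<^sup>2)"
  have K: "K \<ge> 0" unfolding K_def by (rule suminf_nonneg[OF summable_ln_over_square]) simp
  have main: "1 \<le> 8 * real N ^ 5 * K ^ 4 * \<delta>" if \<delta>: "\<delta> > 0" "\<delta> \<le> 1" for \<delta> :: real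
  proof -
    define w where "w n = real n powr (- (1 + \<delta>))" for n
    have wm: "w (m * n) = w m * w n" for m n by (simp add: w_def powr_mult)
    have w01: "w 0 = 0" "w 1 = 1" "\<And>n. w n \<ge> 0" by (simp_all add: w_def)
    have sw: "summable w" "suminf w \<le> 1 + 1 / \<delta>" unfolding w_def using powr_zeta_bound[OF \<delta>(1)] by auto
    define a0 where "a0 n = complex_of_real (norm (\<psi> n) * w n)" for n
    define a1 where "a1 n = \<psi> n * complex_of_real (w n)" for n
    define a2 where "a2 n = (\<psi> n)\<^sup>2 * complex_of_real (w n)" for n
    have na: "norm (a0 n) \<le> w n" "norm (a1 n) \<le> w n" "norm (a2 n) \<le> w n" for n
      using le1[of n] w01(3)[of n]
      by (simp_all add: a0_def a1_def a2_def norm_mult norm_power power_le_one mult_left_le_one_le)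
    have sma: "summable (\<lambda>n. norm (a0 n))" "summable (\<lambda>n. norm (a1 n))" "summable (\<lambda>n. norm (a2 n))"
      by (auto intro: summable_comparison_test'[OF sw(1)] simp: na)
    \<comment> \<open>\<open>P y * C\<close> tends to 1 by the Euler products while
      \<open>P y \<le> 1\<close> by the 3-4-1 inequality, so \<open>C \<ge> 1\<close>.\<close>
    define P where "P y = (\<Prod>p | prime p \<and> p \<le> y. norm (1 - a0 p) ^ 3 * norm (1 - a1 p) ^ 4 * norm (1 - a2 p))" for y :: nat
    define C where "C = norm (suminf a0) ^ 3 * norm (suminf a1) ^ 4 * norm (suminf a2)"
    have lims: "(\<lambda>y. (\<Prod>p | prime p \<and> p \<le> y. 1 - a p) * suminf a) \<longlonglongrightarrow> 1" if "a \<in> {a0, a1, a2}" for a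
      using that sma \<psi>0 \<psi>1 w01
      by (intro sieve_tendsto_1) (auto simp: a0_def a1_def a2_def mult wm norm_mult power2_eq_square)
    have "(\<lambda>y. norm ((\<Prod>p | prime p \<and> p \<le> y. 1 - a0 p) * suminf a0) ^ 3
             * norm ((\<Prod>p | prime p \<and> p \<le> y. 1 - a1 p) * suminf a1) ^ 4
             * norm ((\<Prod>p | prime p \<and> p \<le> y. 1 - a2 p) * suminf a2)) \<longlonglongrightarrow> norm (1::complex) ^ 3 * norm (1::complex) ^ 4 * norm (1::complex)"
      by (intro tendsto_intros lims) auto
    moreover have "norm ((\<Prod>p | prime p \<and> p \<le> y. 1 - a0 p) * suminf a0) ^ 3
             * norm ((\<Prod>p | prime p \<and> p \<le> y. 1 - a1 p) * suminf a1) ^ 4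
             * norm ((\<Prod>p | prime p \<and> p \<le> y. 1 - a2 p) * suminf a2) = P y * C" for y
      unfolding P_def C_def
      by (simp add: norm_mult power_mult_distrib prod.distrib prod_power_distrib mult_ac flip: prod_norm)
    ultimately have "(\<lambda>y. P y * C) \<longlonglongrightarrow> 1" by simp
    moreover have "P y * C \<le> C" for y
    proof -
      have "P y \<le> 1" unfolding P_def
      proof (rule prod_le_1, safe)
        fix p :: nat assume p: "prime p"
        show "norm (1 - a0 p) ^ 3 * norm (1 - a1 p) ^ 4 * norm (1 - a2 p) \<le> 1"
        proof (cases "\<psi> p = 0")
          case False
          then have 1: "norm (\<psi> p) = 1" using nrm by auto
          have "w p < 1"
            using prime_gt_1_nat[OF p] \<delta> powr_less_mono[of "- (1 + \<delta>)" 0 "real p"] by (simp add: w_def)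
          then show ?thesis using mertens_3_4_1[of "w p" "\<psi> p"] 1 w01
            by (simp add: a0_def a1_def a2_def mult.commute)
        qed (simp add: a0_def a1_def a2_def)
      qed simp
      moreover have "P y \<ge> 0" unfolding P_def by (intro prod_nonneg) simp
      moreover have "C \<ge> 0" unfolding C_def by simp
      ultimately show ?thesis by (simp add: mult_left_le_one_le)
    qed
    ultimately have C1: "1 \<le> C" by (intro LIMSEQ_le_const2[where X = "\<lambda>y. P y * C"]) auto
    have b0: "norm (suminf a0) \<le> 2 / \<delta>"
    proof -
      have "norm (suminf a0) \<le> (\<Sum>n. norm (a0 n))" by (rule summable_norm[OF sma(1)])
      also have "\<dots> \<le> suminf w" by (rule suminf_le[OF na(1) sma(1) sw(1)])
      also have "\<dots> \<le> 2 / \<delta>" using sw(2) \<delta> by (simp add: field_simps)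
      finally show ?thesis .
    qed
    have b2: "norm (suminf a2) \<le> real N * 1"
    proof (rule norm_sums_by_parts_le[where \<psi> = "\<lambda>k. (\<psi> (Suc k))\<^sup>2" and b = "\<lambda>k. w (Suc k)"])
      show "(\<lambda>n. (\<psi> (Suc n))\<^sup>2 * complex_of_real (w (Suc n))) sums suminf a2"
      proof -
        have "a2 0 = 0" using \<psi>0 by (simp add: a2_def)
        then have "(\<lambda>n. a2 (Suc n)) sums suminf a2"
          using summable_sums[OF summable_norm_cancel[OF sma(3)]] unfolding sums_Suc_iff by simp
        then show ?thesis by (simp add: a2_def)
      qed
      show "(\<lambda>k. w (Suc k)) \<longlonglongrightarrow> 0" using summable_LIMSEQ_zero[OF sw(1)] by (rule LIMSEQ_Suc)
      have "w (Suc (Suc k)) \<le> w (Suc k)" for k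
        unfolding w_def using \<delta> by (intro powr_mono2') auto
      then have "(\<Sum>k<n. \<bar>w (Suc k) - w (Suc (Suc k))\<bar>) = (\<Sum>k<n. w (Suc k) - w (Suc (Suc k)))" for n
        by (intro sum.cong) auto
      also have "\<dots> n = w 1 - w (Suc n)" for n by (induction n) auto
      finally show "(\<Sum>k<n. \<bar>w (Suc k) - w (Suc (Suc k))\<bar>) \<le> 1" for n using w01 by simp
    qed (rule part2)
    \<comment> \<open>Subtracting from the series at 1, whose sum is 0 by assumption, replaces the
      weights by \<open>1 / n - n powr (- (1 + \<delta>))\<close>, of total variation at most
      \<open>\<delta> * K\<close>.\<close>
    have b1: "norm (suminf a1) \<le> real N * (\<delta> * K)"
    proof -
      define b where "b n = 1 / real (Suc n) - w (Suc n)" for n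
      define c where "c n = \<psi> n / of_nat n - a1 n" for n
      have "c sums (0 - suminf a1)"
        unfolding c_def by (rule sums_diff[OF S0 summable_sums[OF summable_norm_cancel[OF sma(2)]]])
      moreover have "c 0 = 0" by (simp add: c_def a1_def \<psi>0)
      ultimately have "(\<lambda>n. c (Suc n)) sums (- suminf a1)" unfolding sums_Suc_iff by simp
      moreover have "c (Suc n) = \<psi> (Suc n) * of_real (b n)" for n
        by (simp add: c_def a1_def b_def right_diff_distrib)
      ultimately have s: "(\<lambda>n. \<psi> (Suc n) * of_real (b n)) sums (- suminf a1)" by simp
      have "norm (- suminf a1) \<le> real N * (\<delta> * K)"
      proof (rule norm_sums_by_parts_le[OF part1 _ _ s])
        have "(\<lambda>n. 1 / real (Suc n) - w (Suc n)) \<longlonglongrightarrow> 0 - 0"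
          by (rule tendsto_diff[OF LIMSEQ_Suc[OF lim_1_over_n] LIMSEQ_Suc[OF summable_LIMSEQ_zero[OF sw(1)]]])
        then show "b \<longlonglongrightarrow> 0" unfolding b_def by simp
        fix n
        have "(\<Sum>k<n. \<bar>b k - b (Suc k)\<bar>) \<le> (\<Sum>k<n. \<delta> * ((1 + ln (real k + 2)) / (real k + 1)\<^sup>2))"
          by (rule sum_mono)
             (use inverse_minus_powr_variation[OF \<delta>(1), of "real k + 1" for k] in \<open>simp add: b_def w_def add_ac\<close>)
        also have "\<dots> = \<delta> * (\<Sum>k<n. (1 + ln (real k + 2)) / (real k + 1)\<^sup>2)" by (simp add: sum_distrib_left)
        also have "\<dots> \<le> \<delta> * K" unfolding K_def using \<delta>
          by (intro mult_left_mono sum_le_suminf summable_ln_over_square) auto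
        finally show "(\<Sum>k<n. \<bar>b k - b (Suc k)\<bar>) \<le> \<delta> * K" .
      qed
      then show ?thesis by simp
    qed
    have "C \<le> (2 / \<delta>) ^ 3 * (N * (\<delta> * K)) ^ 4 * (N * 1)"
      unfolding C_def using b0 b1 b2 \<delta> K by (intro mult_mono power_mono) auto
    also have "\<dots> = 8 * real N ^ 5 * K ^ 4 * \<delta>"
      using \<delta> by (simp add: power_mult_distrib power_divide field_simps eval_nat_numeral)
    finally show ?thesis using C1 by simp
  qed
  define M where "M = 8 * real N ^ 5 * K ^ 4"
  have M: "M \<ge> 0" using K by (simp add: M_def)
  \<comment> \<open>The value \<open>1 / (M + 2)\<close> of \<delta> is at most 1 and makes
    \<open>M * \<delta>\<close> smaller than 1.\<close>
  have "1 \<le> M * (1 / (M + 2))" using main[of "1 / (M + 2)"] M unfolding M_def[symmetric] by simp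
  then show False using M by (simp add: field_simps)
qed

section \<open>Characters and Gauss sums\<close>

text \<open>Dirichlet's test: the summed part converges absolutely because the decreasing weights
  telescope.\<close>

lemma summable_by_parts:
  fixes \<psi> :: "nat \<Rightarrow> complex" and b :: "nat \<Rightarrow> real"
  assumes S: "\<And>n. norm (\<Sum>k<n. \<psi> k) \<le> K" and b: "b \<longlonglongrightarrow> 0" "\<And>n. b (Suc n) \<le> b n"
  shows "summable (\<lambda>n. \<psi> n * of_real (b n))"
proof -
  define s where "s n = (\<Sum>k<n. \<psi> k)" for n
  have parts: "(\<Sum>k<n. \<psi> k * of_real (b k)) = s n * of_real (b n) + (\<Sum>k<n. s (Suc k) * of_real (b k - b (Suc k)))" for n
    by (induction n) (simp_all add: s_def algebra_simps)
  have tel: "(\<lambda>k. b k - b (Suc k)) sums (b 0 - 0)" using b(1) by (rule telescope_sums')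
  have "summable (\<lambda>k. s (Suc k) * of_real (b k - b (Suc k)))"
  proof (rule summable_comparison_test')
    show "summable (\<lambda>k. K * (b k - b (Suc k)))" using tel by (intro summable_mult) (simp add: sums_iff)
    fix k
    show "norm (s (Suc k) * of_real (b k - b (Suc k))) \<le> K * (b k - b (Suc k))"
      using S[of "Suc k"] b(2)[of k] S[of 0] unfolding norm_mult s_def norm_of_real by (intro mult_mono) auto
  qed
  then have "convergent (\<lambda>n. \<Sum>k<n. s (Suc k) * of_real (b k - b (Suc k)))"
    by (simp add: summable_iff_convergent)
  moreover have "(\<lambda>n. s n * of_real (b n)) \<longlonglongrightarrow> 0"
  proof (rule Lim_null_comparison)
    show "(\<lambda>n. K * norm (b n)) \<longlonglongrightarrow> 0" using tendsto_mult_right_zero[OF tendsto_norm_zero[OF b(1)]] .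
    show "\<forall>\<^sub>F n in sequentially. norm (s n * of_real (b n)) \<le> K * norm (b n)"
      using S by (auto simp: norm_mult s_def intro!: always_eventually mult_right_mono)
  qed
  then have "convergent (\<lambda>n. s n * of_real (b n))" by (rule convergentI)
  ultimately show ?thesis unfolding summable_iff_convergent parts by (intro convergent_add)
qed

section \<open>Sums over residues and roots of unity\<close>

lemma periodic_int_mod:
  fixes F :: "int \<Rightarrow> 'a"
  assumes "\<And>a. F (a + int N) = F a"
  shows "F (a mod int N) = F a"
proof -
  have nat: "F (a + int k * int N) = F a" for a k
  proof (induction k)
    case (Suc k)
    have "F (a + int (Suc k) * int N) = F (a + int k * int N + int N)" by (simp add: algebra_simps)
    then show ?case using Suc assms by simp
  qed simp
  have "F (b + k * int N) = F b" for b k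
  proof (cases "k \<ge> 0")
    case True
    then show ?thesis using nat[of b "nat k"] by simp
  next
    case False
    then show ?thesis using nat[of "b + k * int N" "nat (- k)"] by simp
  qed
  from this[of "a mod int N" "a div int N"] show ?thesis by simp
qed

lemma periodic_int_cong:
  fixes F :: "int \<Rightarrow> 'a"
  assumes "\<And>a. F (a + int N) = F a" "[a = b] (mod int N)"
  shows "F a = F b"
  using assms(2) periodic_int_mod[of F N, OF assms(1)] unfolding cong_def by metis

text \<open>A map with an inverse modulo \<open>N\<close> permutes the residues; reducing its values
  modulo \<open>N\<close> brings them back to the standard representatives. Shifts and
  multiplications by units are the two instances.\<close>

lemma sum_periodic_reindex:
  fixes F :: "int \<Rightarrow> 'a :: comm_monoid_add"
  assumes N: "N > 0" and per: "\<And>a. F (a + int N) = F a"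
    and gh: "\<And>a. [h (g a) = a] (mod int N)" "\<And>a. [g (h a) = a] (mod int N)"
    and cong: "\<And>a b. [a = b] (mod int N) \<Longrightarrow> [g a = g b] (mod int N)"
      "\<And>a b. [a = b] (mod int N) \<Longrightarrow> [h a = h b] (mod int N)"
  shows "(\<Sum>a\<in>{0..<int N}. F (g a)) = (\<Sum>a\<in>{0..<int N}. F a)"
proof (rule sum.reindex_bij_witness[where j = "\<lambda>a. g a mod int N" and i = "\<lambda>a. h a mod int N"])
  fix a assume a: "a \<in> {0..<int N}"
  have "[h (g a mod int N) = h (g a)] (mod int N)" by (rule cong) simp
  then have "[h (g a mod int N) = a] (mod int N)" using gh(1) cong_trans by blast
  then show "h (g a mod int N) mod int N = a" using a by (simp add: cong_def)
  have "[g (h a mod int N) = g (h a)] (mod int N)" by (rule cong) simp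
  then have "[g (h a mod int N) = a] (mod int N)" using gh(2) cong_trans by blast
  then show "g (h a mod int N) mod int N = a" using a by (simp add: cong_def)
  show "F (g a mod int N) = F (g a)" by (rule periodic_int_mod) (rule per)
qed (use N in auto)

lemma sum_periodic_shift:
  fixes F :: "int \<Rightarrow> 'a :: comm_monoid_add"
  assumes "N > 0" "\<And>a. F (a + int N) = F a"
  shows "(\<Sum>a\<in>{0..<int N}. F (a + c)) = (\<Sum>a\<in>{0..<int N}. F a)"
  by (rule sum_periodic_reindex[where F = F and g = "\<lambda>a. a + c" and h = "\<lambda>a. a - c"])
    (use assms in \<open>auto intro: cong_add cong_diff\<close>)

lemma sum_periodic_scale:
  fixes F :: "int \<Rightarrow> 'a :: comm_monoid_add"
  assumes "N > 0" "\<And>a. F (a + int N) = F a" "coprime u (int N)"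
  shows "(\<Sum>a\<in>{0..<int N}. F (u * a)) = (\<Sum>a\<in>{0..<int N}. F a)"
proof -
  obtain v where v: "[u * v = 1] (mod int N)" using assms(3) cong_solve_coprime_int by blast
  have *: "[u * v * a = a] (mod int N)" for a using cong_scalar_right[OF v, of a] by simp
  show ?thesis
    by (rule sum_periodic_reindex[where F = F and g = "\<lambda>a. u * a" and h = "\<lambda>a. v * a"])
      (use * assms in \<open>auto intro: cong_mult simp: mult_ac\<close>)
qed

definition unity_root :: "nat \<Rightarrow> int \<Rightarrow> complex" where
  "unity_root N k = cis (2 * pi * of_int k / real N)"

lemma unity_root_add: "unity_root N (a + b) = unity_root N a * unity_root N b"
  by (simp add: unity_root_def cis_mult algebra_simps add_divide_distrib)

lemma unity_root_0 [simp]: "unity_root N 0 = 1"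
  by (simp add: unity_root_def)

lemma norm_unity_root [simp]: "norm (unity_root N a) = 1"
  by (simp add: unity_root_def)

lemma unity_root_power: "unity_root N a ^ k = unity_root N (int k * a)"
  by (induction k) (simp_all add: unity_root_add algebra_simps)

lemma unity_root_eq_1_iff:
  assumes "N > 0"
  shows "unity_root N k = 1 \<longleftrightarrow> int N dvd k"
proof
  assume "unity_root N k = 1"
  then have "cos (2 * pi * of_int k / real N) = 1" by (simp add: unity_root_def complex_eq_iff)
  then obtain m :: int where "2 * pi * of_int k / real N = of_int m * 2 * pi" by (auto simp: cos_one_2pi_int)
  then have "real_of_int k = of_int m * real N" using assms by (simp add: field_simps)
  then have "k = m * int N" by (metis of_int_eq_iff of_int_mult of_int_of_nat_eq)
  then show "int N dvd k" by simp
next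
  assume "int N dvd k"
  then obtain m where "k = int N * m" by blast
  then have "unity_root N k = cis (2 * pi * of_int m)"
    using assms unfolding unity_root_def by (intro arg_cong[where f = cis]) simp
  also have "\<dots> = 1" using cos_int_2pin[of m] sin_int_2pin[of m] by (simp add: complex_eq_iff)
  finally show "unity_root N k = 1" .
qed

lemma unity_root_periodic:
  assumes "N > 0"
  shows "unity_root N (a + int N * k) = unity_root N a"
  using unity_root_eq_1_iff[OF assms, of "int N * k"] by (simp add: unity_root_add)

lemma cnj_unity_root: "cnj (unity_root N a) = unity_root N (- a)"
  by (simp add: unity_root_def cis_cnj)

lemma sum_unity_root:
  assumes "N > 0"
  shows "(\<Sum>k<N. unity_root N (a * int k)) = (if int N dvd a then of_nat N else 0)"
proof -
  define w where "w = unity_root N a"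
  have eq: "unity_root N (a * int k) = w ^ k" for k by (simp add: w_def unity_root_power mult.commute)
  show ?thesis
  proof (cases "int N dvd a")
    case True
    then show ?thesis unfolding eq using unity_root_eq_1_iff[OF assms, of a] by (simp add: w_def)
  next
    case False
    then have "w \<noteq> 1" using unity_root_eq_1_iff[OF assms, of a] by (simp add: w_def)
    moreover have "w ^ N = 1" unfolding w_def unity_root_power using unity_root_eq_1_iff[OF assms] by simp
    ultimately have "(\<Sum>k<N. w ^ k) = 0" by (simp add: geometric_sum)
    then show ?thesis unfolding eq using False by simp
  qed
qed

section \<open>Dirichlet characters\<close>

lemma coprime_int_iff_primes:
  fixes a m :: int
  assumes "m \<noteq> 0"
  shows "coprime a m \<longleftrightarrow> (\<forall>q. prime q \<longrightarrow> q dvd m \<longrightarrow> \<not> q dvd a)"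
proof
  assume "coprime a m"
  then show "\<forall>q. prime q \<longrightarrow> q dvd m \<longrightarrow> \<not> q dvd a"
    using coprime_common_divisor not_prime_unit by blast
next
  assume *: "\<forall>q. prime q \<longrightarrow> q dvd m \<longrightarrow> \<not> q dvd a"
  show "coprime a m"
  proof (rule ccontr)
    assume "\<not> coprime a m"
    then have "\<not> is_unit (gcd a m)" by (simp add: coprime_iff_gcd_eq_1)
    then obtain q where "prime q" "q dvd gcd a m" using assms prime_divisorE[of "gcd a m"] by auto
    then show False using * by auto
  qed
qed

text \<open>Two powers of \<open>u\<close> agree modulo \<open>N\<close> by the pigeonhole
  principle, and the smaller one cancels.\<close>

lemma exists_order_cong:
  fixes u :: int
  assumes "N > 0" "coprime u (int N)"
  obtains r where "r > 0" "[u ^ r = 1] (mod int N)"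
proof -
  define f where "f k = u ^ k mod int N" for k :: nat
  have "range f \<subseteq> {0..<int N}" using assms(1) by (auto simp: f_def)
  then have "finite (range f)" by (rule finite_subset) simp
  then have "\<not> inj f" using range_inj_infinite by blast
  then obtain i j where ij: "i < j" "f i = f j" by (metis injI nat_neq_iff)
  then have "[u ^ i * 1 = u ^ i * u ^ (j - i)] (mod int N)"
    unfolding power_add[symmetric] by (simp add: f_def cong_def)
  then have "[1 = u ^ (j - i)] (mod int N)"
    using assms(2) by (subst (asm) cong_mult_lcancel) auto
  then show ?thesis using that[of "j - i"] ij(1) by (simp add: cong_sym)
qed

definition dirichlet_char :: "nat \<Rightarrow> (int \<Rightarrow> complex) \<Rightarrow> bool" where
  "dirichlet_char N \<phi> \<longleftrightarrow> (\<forall>a. \<phi> (a + int N) = \<phi> a) \<and> (\<forall>a b. \<phi> (a * b) = \<phi> a * \<phi> b) \<and> \<phi> 1 = 1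
     \<and> (\<forall>a. \<phi> a \<noteq> 0 \<longleftrightarrow> coprime a (int N))"

lemma dirichlet_charD:
  assumes "dirichlet_char N \<phi>"
  shows "\<phi> (a + int N) = \<phi> a" "\<phi> (a * b) = \<phi> a * \<phi> b" "\<phi> 1 = 1" "\<phi> a \<noteq> 0 \<longleftrightarrow> coprime a (int N)"
  using assms by (auto simp: dirichlet_char_def)

lemma dirichlet_char_power:
  assumes "dirichlet_char N \<phi>"
  shows "\<phi> (a ^ k) = \<phi> a ^ k"
  by (induction k) (simp_all add: dirichlet_charD[OF assms])

lemma norm_dirichlet_char:
  assumes "N > 0" "dirichlet_char N \<phi>" "coprime a (int N)"
  shows "norm (\<phi> a) = 1"
proof -
  obtain r where r: "r > 0" "[a ^ r = 1] (mod int N)" using exists_order_cong assms(1,3) by blast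
  have "\<phi> a ^ r = \<phi> 1"
    using periodic_int_cong[of \<phi> N, OF dirichlet_charD(1)[OF assms(2)] r(2)] dirichlet_char_power[OF assms(2)] by simp
  then have "norm (\<phi> a) ^ r = 1" using dirichlet_charD(3)[OF assms(2)] by (metis norm_one norm_power)
  then show ?thesis using r(1) by (intro power_eq_imp_eq_base[of _ r 1]) auto
qed

text \<open>The idea is to project successively onto eigenspaces of the translations, which have finite order.\<close>

lemma translation_invariant_contains_char:
  fixes E :: "(int \<Rightarrow> complex) set"
  assumes N: "N > 0"
    and per: "\<And>D a. D \<in> E \<Longrightarrow> D (a + int N) = D a"
    and supp: "\<And>D a. D \<in> E \<Longrightarrow> D a \<noteq> 0 \<Longrightarrow> coprime a (int N)"
    and transl: "\<And>D u. D \<in> E \<Longrightarrow> coprime u (int N) \<Longrightarrow> (\<lambda>a. D (u * a)) \<in> E"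
    and add: "\<And>D D'. D \<in> E \<Longrightarrow> D' \<in> E \<Longrightarrow> (\<lambda>a. D a + D' a) \<in> E"
    and scale: "\<And>D c. D \<in> E \<Longrightarrow> (\<lambda>a. c * D a) \<in> E"
    and D: "D \<in> E" "D a0 \<noteq> 0"
  obtains \<phi> where "\<phi> \<in> E" "dirichlet_char N \<phi>"
proof -
  have sums: "(\<lambda>a. \<Sum>j<m. f j a) \<in> E" if "\<And>j. f j \<in> E" for f :: "nat \<Rightarrow> int \<Rightarrow> complex" and m
  proof (induction m)
    case 0
    then show ?case using scale[OF D(1), of 0] by simp
  next
    case (Suc m)
    then show ?case using add[OF Suc that[of m]] by simp
  qed
  have eig: "\<exists>D\<in>E. (\<exists>a. D a \<noteq> 0) \<and> (\<forall>u\<in>S. \<exists>l. \<forall>a. D (u * a) = l * D a)"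
    if "finite S" "\<And>u. u \<in> S \<Longrightarrow> coprime u (int N)" for S
    using that
  proof (induction S rule: finite_induct)
    case empty
    then show ?case using D by blast
  next
    case (insert u S)
    then obtain D where D: "D \<in> E" "\<exists>a. D a \<noteq> 0" "\<And>v. v \<in> S \<Longrightarrow> \<exists>l. \<forall>a. D (v * a) = l * D a"
      by auto
    have u: "coprime u (int N)" using insert.prems by simp
    obtain r where r: "r > 0" "[u ^ r = 1] (mod int N)" using exists_order_cong N u by blast
    \<comment> \<open>Up to the factor \<open>r\<close>, this is the projection of \<open>D\<close>
      to the eigenspace of translation by \<open>u\<close> with eigenvalue
      \<open>unity_root r (int k)\<close>. The projections sum to \<open>r\<close> times
      \<open>D\<close>, so one of them is nonzero.\<close>
    define P where "P k a = (\<Sum>j<r. unity_root r (- int j * int k) * D (u ^ j * a))" for k :: nat and a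
    have PE: "P k \<in> E" for k
      unfolding P_def by (intro sums scale transl D(1)) (use u in simp)
    obtain a where a: "D a \<noteq> 0" using D(2) by blast
    have "(\<Sum>k<r. P k a) = (\<Sum>j<r. (\<Sum>k<r. unity_root r (- int j * int k)) * D (u ^ j * a))"
      unfolding P_def sum_distrib_right by (rule sum.swap)
    also have "\<dots> = (\<Sum>j<r. if j = 0 then of_nat r * D a else 0)"
    proof (rule sum.cong)
      fix j assume "j \<in> {..<r}"
      then have "int r dvd - int j \<longleftrightarrow> j = 0" using zdvd_not_zless[of "int j" "int r"] by auto
      then show "(\<Sum>k<r. unity_root r (- int j * int k)) * D (u ^ j * a) = (if j = 0 then of_nat r * D a else 0)"
        using sum_unity_root[OF r(1), of "- int j"] by simp
    qed simp
    also have "\<dots> = of_nat r * D a" using r(1) by simp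
    finally have "(\<Sum>k<r. P k a) \<noteq> 0" using a r(1) by simp
    then obtain k where k: "P k a \<noteq> 0" by (meson sum.neutral)
    \<comment> \<open>Translations commute, so the eigenvalues already achieved on \<open>S\<close>
      persist.\<close>
    have "\<exists>l. \<forall>a. P k (v * a) = l * P k a" if v: "v \<in> insert u S" for v
    proof (cases "v \<in> S")
      case True
      then obtain l where l: "\<And>a. D (v * a) = l * D a" using D(3) by blast
      have "P k (v * a) = l * P k a" for a
        unfolding P_def sum_distrib_left
        by (intro sum.cong refl) (use l[of "u ^ j * a" for j] in \<open>simp add: mult.left_commute\<close>)
      then show ?thesis by blast
    next
      case False
      then have v: "v = u" using v by simp
      have "P k (u * a) = unity_root r (int k) * P k a" for a
      proof -
        define T where "T j = unity_root r (- int j * int k) * D (u ^ j * a)" for j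
        have 1: "unity_root r (- int j * int k) * D (u ^ j * (u * a)) = unity_root r (int k) * T (Suc j)" for j
        proof -
          have "unity_root r (- int j * int k) = unity_root r (int k) * unity_root r (- int (Suc j) * int k)"
            unfolding unity_root_add[symmetric] by (rule arg_cong[where f = "unity_root r"]) (simp add: algebra_simps)
          then show ?thesis by (simp add: T_def mult_ac)
        qed
        have "D (u ^ r * a) = D (1 * a)"
          using periodic_int_cong[of D N, OF per[OF D(1)] cong_scalar_right[OF r(2)]] .
        then have Tr: "T r = T 0"
          using unity_root_eq_1_iff[OF r(1), of "- int r * int k"] by (simp add: T_def)
        have "P k (u * a) = unity_root r (int k) * (\<Sum>j<r. T (Suc j))"
          unfolding P_def 1 sum_distrib_left ..
        also have "(\<Sum>j<r. T (Suc j)) = (\<Sum>j<r. T j)"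
          using sum.lessThan_Suc_shift[of T r] Tr by simp
        finally show ?thesis by (simp add: P_def T_def)
      qed
      then show ?thesis unfolding v by blast
    qed
    then show ?case using PE k by blast
  qed
  define S where "S = {u \<in> {0..<int N}. coprime u (int N)}"
  obtain D where D: "D \<in> E" "\<exists>a. D a \<noteq> 0" "\<And>u. u \<in> S \<Longrightarrow> \<exists>l. \<forall>a. D (u * a) = l * D a"
  proof -
    have "finite S" by (rule finite_subset[of _ "{0..<int N}"]) (auto simp: S_def)
    moreover have "\<And>u. u \<in> S \<Longrightarrow> coprime u (int N)" by (simp add: S_def)
    ultimately show ?thesis using eig[of S] that by blast
  qed
  have ev: "\<exists>l. \<forall>a. D (u * a) = l * D a" if u: "coprime u (int N)" for u
  proof -
    have "u mod int N \<in> S" using u N by (simp add: S_def)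
    then obtain l where l: "\<And>a. D (u mod int N * a) = l * D a" using D(3) by blast
    have "D (u mod int N * a) = D (u * a)" for a
      by (rule periodic_int_cong[of D N, OF per[OF D(1)]]) (simp add: cong_def mod_mult_left_eq)
    then have "D (u * a) = l * D a" for a using l[of a] by simp
    then show ?thesis by blast
  qed
  have D1: "D 1 \<noteq> 0"
  proof
    assume 0: "D 1 = 0"
    obtain a where a: "D a \<noteq> 0" using D(2) by blast
    then obtain l where "\<And>b. D (a * b) = l * D b" using ev supp[OF D(1)] by blast
    from this[of 1] show False using 0 a by simp
  qed
  \<comment> \<open>Normalised at 1, a joint eigenfunction takes at a unit \<open>a\<close> the
    eigenvalue of translation by \<open>a\<close>, hence is multiplicative.\<close>
  define \<phi> where "\<phi> a = inverse (D 1) * D a" for a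
  have sc: "\<phi> a \<noteq> 0 \<longleftrightarrow> coprime a (int N)" for a
  proof
    show "coprime a (int N)" if "\<phi> a \<noteq> 0" using that supp[OF D(1)] by (auto simp: \<phi>_def)
    assume a: "coprime a (int N)"
    then obtain v where v: "[a * v = 1] (mod int N)" using cong_solve_coprime_int by blast
    obtain l where l: "\<And>b. D (a * b) = l * D b" using ev[OF a] by blast
    have "D (a * v) = D 1" by (rule periodic_int_cong[of D N, OF per[OF D(1)] v])
    then have "l \<noteq> 0" using l[of v] D1 by auto
    then show "\<phi> a \<noteq> 0" using l[of 1] D1 by (simp add: \<phi>_def)
  qed
  have "\<phi> (a * b) = \<phi> a * \<phi> b" for a b
  proof (cases "coprime a (int N)")
    case True
    then obtain l where l: "\<And>b. D (a * b) = l * D b" using ev by blast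
    show ?thesis using l[of b] l[of 1] D1 by (simp add: \<phi>_def)
  next
    case False
    then have "\<not> coprime (a * b) (int N)" by simp
    then show ?thesis using False sc by (metis mult_zero_left)
  qed
  then have "dirichlet_char N \<phi>"
    using sc D1 per[OF D(1)] by (simp add: dirichlet_char_def) (simp add: \<phi>_def)
  moreover have "\<phi> \<in> E" unfolding \<phi>_def by (rule scale[OF D(1)])
  ultimately show ?thesis using that by blast
qed

section \<open>Gauss sums of possibly imprimitive characters\<close>

definition gauss_sum :: "nat \<Rightarrow> (int \<Rightarrow> complex) \<Rightarrow> int \<Rightarrow> complex" where
  "gauss_sum N \<phi> m = (\<Sum>a\<in>{0..<int N}. \<phi> a * unity_root N (m * a))"

lemma gauss_sum_scale:
  assumes N: "N > 0" and \<phi>: "dirichlet_char N \<phi>" and u: "coprime u (int N)"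
  shows "\<phi> u * gauss_sum N \<phi> (m * u) = gauss_sum N \<phi> m"
proof -
  note \<phi>D = dirichlet_charD[OF \<phi>]
  have "\<phi> u * gauss_sum N \<phi> (m * u) = (\<Sum>a\<in>{0..<int N}. \<phi> (u * a) * unity_root N (m * (u * a)))"
    unfolding gauss_sum_def sum_distrib_left by (simp add: \<phi>D mult_ac)
  also have "\<dots> = gauss_sum N \<phi> m"
    unfolding gauss_sum_def
    by (rule sum_periodic_scale[OF N _ u, of "\<lambda>a. \<phi> a * unity_root N (m * a)"])
      (use unity_root_periodic[OF N, of "m * a" m for a] in \<open>simp add: \<phi>D algebra_simps\<close>)
  finally show ?thesis .
qed

text \<open>Hypothesis \<open>rad\<close> says that the conductor of \<open>\<phi>\<close> is
  divisible by every prime factor of \<open>N\<close>. Although \<open>\<phi>\<close> may be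
  imprimitive, its Gauss sum then behaves as a primitive one, stretched by \<open>d\<close>, which
  is \<open>N\<close> divided by the conductor.\<close>

lemma gauss_sum_support:
  assumes N: "N > 0" and \<phi>: "dirichlet_char N \<phi>"
    and rad: "\<And>M q. M dvd int N \<Longrightarrow> (\<And>u. coprime u (int N) \<Longrightarrow> [u = 1] (mod M) \<Longrightarrow> \<phi> u = 1)
       \<Longrightarrow> prime q \<Longrightarrow> q dvd int N \<Longrightarrow> q dvd M"
  obtains d :: nat and c where "d > 0" "c \<noteq> 0"
    "\<And>m. gauss_sum N \<phi> m = (if int d dvd m then c * inverse (\<phi> (m div int d)) else 0)"
proof -
  note \<phi>D = dirichlet_charD[OF \<phi>]
  define G where "G = gauss_sum N \<phi>"
  have "unity_root N ((m + int N) * a) = unity_root N (m * a)" for m a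
    using unity_root_periodic[OF N, of "m * a" a] by (simp add: algebra_simps)
  then have Gper: "G (m + int N) = G m" for m by (simp add: G_def gauss_sum_def)
  \<comment> \<open>Such a \<open>u\<close> fixes \<open>m\<close> modulo \<open>N\<close>, so
    \<open>gauss_sum_scale\<close> forces \<open>\<phi> u = 1\<close>. By \<open>rad\<close>,
    \<open>N / gcd(m, N)\<close> then has all the prime factors of \<open>N\<close>.\<close>
  have triv: "\<phi> u = 1" if m: "G m \<noteq> 0" and u: "coprime u (int N)" "[u = 1] (mod int N div gcd m (int N))" for m u
  proof -
    define g where "g = gcd m (int N)"
    define M where "M = int N div g"
    have gM: "g * M = int N" by (simp add: g_def M_def)
    have "M dvd u - 1" using u(2) by (simp add: M_def g_def cong_iff_dvd_diff)
    then have "g * M dvd m * (u - 1)" by (intro mult_dvd_mono) (simp add: g_def)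
    then have "[m * u = m] (mod int N)" unfolding gM by (simp add: cong_iff_dvd_diff algebra_simps)
    then have "G (m * u) = G m" by (rule periodic_int_cong[of G N, OF Gper])
    then have "\<phi> u * G m = G m" using gauss_sum_scale[OF N \<phi> u(1), of m] by (simp add: G_def)
    then show "\<phi> u = 1" using m by simp
  qed
  have primes: "q dvd int N div gcd m (int N)" if m: "G m \<noteq> 0" and q: "prime q" "q dvd int N" for m q
  proof (rule rad[OF _ _ q])
    show "int N div gcd m (int N) dvd int N" by (metis dvd_div_mult_self dvd_triv_left gcd_dvd2)
  qed (rule triv[OF m])
  \<comment> \<open>With \<open>M = N / g\<close>, the shift by \<open>M\<close> preserves both
    coprimality to \<open>N\<close> and the values of \<open>\<phi>\<close>. It multiplies
    \<open>G m1\<close> by \<open>unity_root N (m1 * M)\<close>, which must be 1.\<close>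
  have gdvd: "gcd m (int N) dvd m1" if m: "G m \<noteq> 0" and m1: "G m1 \<noteq> 0" for m m1
  proof -
    define g where "g = gcd m (int N)"
    define M where "M = int N div g"
    have gM: "g * M = int N" by (simp add: g_def M_def)
    have cop: "coprime (a + M) (int N) \<longleftrightarrow> coprime a (int N)" for a
    proof -
      have "q dvd a + M \<longleftrightarrow> q dvd a" if "prime q" "q dvd int N" for q
        using primes[OF m that] by (simp add: M_def g_def dvd_add_left_iff)
      then show ?thesis using N by (auto simp: coprime_int_iff_primes)
    qed
    have \<phi>M: "\<phi> (a + M) = \<phi> a" for a
    proof (cases "coprime a (int N)")
      case True
      then obtain b where b: "[a * b = 1] (mod int N)" using cong_solve_coprime_int by blast
      define u where "u = (a + M) * b"
      have "coprime b (int N)" using b by (metis coprime_iff_invertible_int mult.commute)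
      then have 1: "coprime u (int N)" using cop True by (simp add: u_def)
      have "[a * b = 1] (mod M)" using b gM by (metis cong_dvd_modulus dvd_triv_right)
      then have "[a * b + M * b = 1 + 0] (mod M)" by (intro cong_add) (simp_all add: cong_def)
      then have "[u = 1] (mod M)" by (simp add: u_def algebra_simps)
      then have "\<phi> u = 1" using triv[OF m 1] by (simp add: M_def g_def)
      moreover have "[u * a = a + M] (mod int N)"
        using cong_scalar_left[OF b, of "a + M"] by (simp add: u_def mult_ac)
      then have "\<phi> (u * a) = \<phi> (a + M)" by (rule periodic_int_cong[of \<phi> N, OF \<phi>D(1)])
      ultimately show ?thesis by (simp add: \<phi>D(2))
    next
      case False
      then show ?thesis using \<phi>D(4) cop by metis
    qed
    have "G m1 = (\<Sum>a\<in>{0..<int N}. \<phi> (a + M) * unity_root N (m1 * (a + M)))"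
      unfolding G_def gauss_sum_def
      by (rule sum_periodic_shift[OF N, of "\<lambda>a. \<phi> a * unity_root N (m1 * a)", symmetric])
        (use unity_root_periodic[OF N, of "m1 * a" m1 for a] in \<open>simp add: \<phi>D algebra_simps\<close>)
    also have "\<dots> = unity_root N (m1 * M) * G m1"
      unfolding G_def gauss_sum_def sum_distrib_left
      by (simp add: \<phi>M distrib_left unity_root_add mult_ac)
    finally have "unity_root N (m1 * M) = 1" using m1 by simp
    then have "g * M dvd m1 * M" using unity_root_eq_1_iff[OF N] gM by simp
    moreover have "M \<noteq> 0" using gM N by auto
    ultimately show ?thesis by (simp add: g_def)
  qed
  \<comment> \<open>Fourier inversion at the residue 1 recovers \<open>N * \<phi> 1\<close>. Writing
    \<open>1 mod int N\<close> covers \<open>N = 1\<close>.\<close>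
  have "\<exists>m. G m \<noteq> 0"
  proof (rule ccontr)
    assume "\<nexists>m. G m \<noteq> 0"
    then have "0 = (\<Sum>k<N. G (int k) * unity_root N (- int k))" by simp
    also have "\<dots> = (\<Sum>a\<in>{0..<int N}. \<phi> a * (\<Sum>k<N. unity_root N ((a - 1) * int k)))"
      unfolding G_def gauss_sum_def sum_distrib_right sum_distrib_left
      by (subst sum.swap) (simp add: mult.assoc algebra_simps flip: unity_root_add)
    also have "\<dots> = (\<Sum>a\<in>{0..<int N}. if int N dvd a - 1 then \<phi> a * of_nat N else 0)"
      by (intro sum.cong refl) (simp add: sum_unity_root[OF N])
    also have "\<dots> = (\<Sum>a\<in>{0..<int N}. if a = 1 mod int N then of_nat N else 0)"
    proof (intro sum.cong refl)
      fix a assume a: "a \<in> {0..<int N}"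
      have "int N dvd a - 1 \<longleftrightarrow> a = 1 mod int N"
        using a by (metis cong_def cong_iff_dvd_diff atLeastLessThan_iff mod_pos_pos_trivial)
      moreover have "\<phi> (1 mod int N) = 1"
        using periodic_int_mod[of \<phi> N 1, OF \<phi>D(1)] \<phi>D(3) by simp
      ultimately show "(if int N dvd a - 1 then \<phi> a * of_nat N else 0) = (if a = 1 mod int N then of_nat N else 0)"
        by simp
    qed
    also have "\<dots> = of_nat N" using N by simp
    finally show False using N by simp
  qed
  then obtain m0 where m0: "G m0 \<noteq> 0" by blast
  define d where "d = gcd m0 (int N)"
  have d: "d > 0" "d dvd int N" using N by (simp_all add: d_def)
  have gd: "gcd m (int N) = d" if "G m \<noteq> 0" for m
  proof (rule zdvd_antisym_nonneg)
    show "gcd m (int N) dvd d" using gdvd[OF that m0] by (simp add: d_def)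
    show "d dvd gcd m (int N)" using gdvd[OF m0 that] by (simp add: d_def)
  qed (use d in auto)
  \<comment> \<open>A prime \<open>q\<close> common to \<open>k\<close> and \<open>N\<close> also
    divides \<open>N / d\<close>, so \<open>d * q\<close> would divide
    \<open>gcd (d * k) N = d\<close>.\<close>
  have notcop: "G (d * k) = 0" if nc: "\<not> coprime k (int N)" for k
  proof (rule ccontr)
    assume "G (d * k) \<noteq> 0"
    then have g: "gcd (d * k) (int N) = d" by (rule gd)
    obtain q where q: "prime q" "q dvd k" "q dvd int N"
      using nc N by (auto simp: coprime_int_iff_primes)
    have "q dvd int N div d" using primes[OF m0 q(1,3)] by (simp add: d_def)
    then have "d * q dvd int N" using d(2) by (metis dvd_div_mult_self dvd_mult_div_cancel mult_dvd_mono dvd_refl)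
    then have "d * q dvd gcd (d * k) (int N)" using q(2) by simp
    then have "d * q dvd d * 1" using g by simp
    then have "q dvd 1" using d(1) by (subst (asm) dvd_mult_cancel_left) simp
    then show False using q(1) by (simp add: not_prime_unit)
  qed
  have cop: "G (d * k) = G d * inverse (\<phi> k)" if "coprime k (int N)" for k
    using gauss_sum_scale[OF N \<phi> that, of d] \<phi>D(4)[of k] that by (simp add: G_def field_simps)
  obtain k0 where k0: "m0 = d * k0" unfolding d_def by (metis dvd_def gcd_dvd1)
  have c0: "G d \<noteq> 0" using m0 notcop[of k0] cop[of k0] unfolding k0 by (cases "coprime k0 (int N)") auto
  show ?thesis
  proof
    show "nat d > 0" using d by simp
    show "G d \<noteq> 0" by (rule c0)
    fix m
    show "gauss_sum N \<phi> m = (if int (nat d) dvd m then G d * inverse (\<phi> (m div int (nat d))) else 0)"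
    proof (cases "d dvd m")
      case True
      then obtain k where k: "m = d * k" by blast
      show ?thesis
      proof (cases "coprime k (int N)")
        case True
        then show ?thesis using cop[OF True] d k by (simp add: G_def)
      next
        case False
        then show ?thesis using notcop[OF False] \<phi>D(4)[of k] d k by (simp add: G_def)
      qed
    next
      case False
      then have "G m = 0" using gd[of m] by (metis gcd_dvd1)
      then show ?thesis using False d by (simp add: G_def)
    qed
  qed
qed

section \<open>From a logarithmic relation to L(1)\<close>

lemma sum_dirichlet_char_zero:
  assumes N: "N > 0" and \<phi>: "dirichlet_char N \<phi>" and u: "coprime u (int N)" "\<phi> u ^ k \<noteq> 1"
  shows "(\<Sum>a\<in>{0..<int N}. \<phi> a ^ k) = 0"
proof -
  have "(\<Sum>a\<in>{0..<int N}. \<phi> a ^ k) = (\<Sum>a\<in>{0..<int N}. \<phi> (u * a) ^ k)"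
    by (rule sum_periodic_scale[OF N _ u(1), of "\<lambda>a. \<phi> a ^ k", symmetric]) (simp add: dirichlet_charD[OF \<phi>])
  also have "\<dots> = \<phi> u ^ k * (\<Sum>a\<in>{0..<int N}. \<phi> a ^ k)"
    by (simp add: dirichlet_charD[OF \<phi>] power_mult_distrib sum_distrib_left)
  finally show ?thesis using u(2) by simp
qed

lemma dirichlet_char_cnj:
  assumes "N > 0" "dirichlet_char N \<phi>"
  shows "inverse (\<phi> a) = cnj (\<phi> a)"
proof (cases "coprime a (int N)")
  case True
  then have "\<phi> a * cnj (\<phi> a) = 1" using norm_dirichlet_char[OF assms True] by (simp add: complex_norm_square[symmetric])
  then show ?thesis by (metis inverse_unique)
next
  case False
  then have "\<phi> a = 0" using dirichlet_charD(4)[OF assms(2)] by blast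
  then show ?thesis by simp
qed

text \<open>Up to the factor \<open>1 - \<rho>\<close>, the quotient is the average of the first
  powers of \<open>\<rho>\<close>, and these decrease. The inequality proved by induction says that
  each of the first \<open>n\<close> powers is at least \<open>\<rho> ^ n\<close>.\<close>

lemma one_minus_power_over_decreasing:
  fixes \<rho> :: real
  assumes "0 \<le> \<rho>" "\<rho> \<le> 1"
  shows "(1 - \<rho> ^ Suc (Suc n)) / real (Suc (Suc n)) \<le> (1 - \<rho> ^ Suc n) / real (Suc n)"
proof -
  have "real n * \<rho> ^ n * (1 - \<rho>) \<le> 1 - \<rho> ^ n" for n
  proof (induction n)
    case (Suc n)
    have "real n * \<rho> ^ n * (1 - \<rho>) * \<rho> \<le> (1 - \<rho> ^ n) * \<rho>"
      using Suc assms(1) by (rule mult_right_mono)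
    moreover have "\<rho> ^ Suc n \<le> 1" using assms by (simp add: power_le_one del: power_Suc)
    then have "\<rho> ^ Suc n * (1 - \<rho>) \<le> 1 * (1 - \<rho>)" using assms by (intro mult_right_mono) auto
    ultimately show ?case by (simp add: algebra_simps)
  qed simp
  from this[of "Suc n"] have "real (Suc n) * (1 - \<rho> ^ Suc (Suc n)) \<le> real (Suc (Suc n)) * (1 - \<rho> ^ Suc n)"
    by (simp add: algebra_simps)
  then show ?thesis by (simp add: divide_le_eq le_divide_eq mult.commute field_simps del: of_nat_Suc power_Suc)
qed

text \<open>For \<open>r < 1\<close> expand \<open>ln |1 - r \<zeta>^a|\<close> into powers of
  \<open>r\<close>: summed against \<open>\<phi>\<close>, the coefficients are Gauss sums, so
  \<open>gauss_sum_support\<close> yields the series of L(1, \<phi>^-1). Abel's limit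
  \<open>r -> 1\<close> turns \<open>rel\<close> into L(1, \<phi>^-1) = 0, and
  \<open>nontriv\<close> supplies both vanishing sums needed to refute this.\<close>

theorem char_log_relation_contradiction:
  assumes N: "N > 1" and \<phi>: "dirichlet_char N \<phi>" and even: "\<And>a. \<phi> (- a) = \<phi> a"
    and rad: "\<And>M q. M dvd int N \<Longrightarrow> (\<And>u. coprime u (int N) \<Longrightarrow> [u = 1] (mod M) \<Longrightarrow> \<phi> u = 1)
       \<Longrightarrow> prime q \<Longrightarrow> q dvd int N \<Longrightarrow> q dvd M"
    and nontriv: "coprime u (int N)" "\<phi> u \<noteq> 1" "(\<phi> u)\<^sup>2 \<noteq> 1"
    and rel: "(\<Sum>a\<in>{0..<int N}. \<phi> a * of_real (ln (norm (1 - unity_root N a)))) = 0"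
  shows False
proof -
  have N0: "N > 0" using N by simp
  note \<phi>D = dirichlet_charD[OF \<phi>]
  obtain d :: nat and c where d: "d > 0" and c: "c \<noteq> 0"
    and G: "\<And>m. gauss_sum N \<phi> m = (if int d dvd m then c * inverse (\<phi> (m div int d)) else 0)"
    using gauss_sum_support[OF N0 \<phi> rad] by blast
  define \<psi> where "\<psi> k = inverse (\<phi> (int k))" for k :: nat
  have \<psi>1: "\<psi> 1 = 1" and \<psi>0: "\<psi> 0 = 0" and \<psi>m: "\<psi> (m * n) = \<psi> m * \<psi> n" and \<psi>p: "\<psi> (n + N) = \<psi> n" for m n
  proof -
    have "\<not> coprime 0 (int N)" using N by simp
    then have "\<phi> 0 = 0" using \<phi>D(4) by blast
    then show "\<psi> 0 = 0" by (simp add: \<psi>_def)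
  qed (simp_all add: \<psi>_def \<phi>D)
  have \<psi>n: "\<psi> n = 0 \<or> norm (\<psi> n) = 1" for n
    using norm_dirichlet_char[OF N0 \<phi>, of "int n"] \<phi>D(4)[of "int n"]
    by (cases "coprime (int n) (int N)") (simp_all add: \<psi>_def norm_inverse)
  have \<psi>le: "norm (\<psi> n) \<le> 1" for n using \<psi>n[of n] by auto
  have sumk: "(\<Sum>n<N. \<psi> n ^ k) = 0" if "\<phi> u ^ k \<noteq> 1" for k
  proof -
    have "(\<Sum>n<N. \<psi> n ^ k) = (\<Sum>a\<in>{0..<int N}. inverse (\<phi> a) ^ k)"
      unfolding \<psi>_def
      by (rule sum.reindex_bij_witness[where i = nat and j = int]) auto
    also have "\<dots> = cnj (\<Sum>a\<in>{0..<int N}. \<phi> a ^ k)"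
      by (simp add: dirichlet_char_cnj[OF N0 \<phi>])
    finally show ?thesis using sum_dirichlet_char_zero[OF N0 \<phi> nontriv(1) that] by simp
  qed
  have z1: "(\<Sum>n<N. \<psi> n) = 0" using sumk[of 1] nontriv(2) by simp
  have z2: "(\<Sum>n<N. (\<psi> n)\<^sup>2) = 0" using sumk[of 2] nontriv(3) by simp
  define \<Phi> where "\<Phi> r = (\<Sum>a\<in>{0..<int N}. \<phi> a * of_real (ln (norm (1 - of_real r * unity_root N a))))" for r :: real
  have ser: "(\<lambda>k. \<psi> k / of_nat k * of_real ((r ^ d) ^ k)) sums (- (of_nat d / c) * \<Phi> r)" if r: "0 < r" "r < 1" for r :: real
  proof -
    have "(\<lambda>m. Re ((of_real r * unity_root N a) ^ m) / of_nat m) sums - ln (norm (1 - of_real r * unity_root N a))" for a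
      using r by (intro sums_ln_norm_one_minus) (simp add: norm_mult)
    then have "(\<lambda>m. \<Sum>a\<in>{0..<int N}. \<phi> a * of_real (Re ((of_real r * unity_root N a) ^ m) / of_nat m))
        sums (\<Sum>a\<in>{0..<int N}. \<phi> a * of_real (- ln (norm (1 - of_real r * unity_root N a))))"
      by (intro sums_sum sums_mult sums_of_real)
    also have "(\<Sum>a\<in>{0..<int N}. \<phi> a * of_real (- ln (norm (1 - of_real r * unity_root N a)))) = - \<Phi> r"
      by (simp add: \<Phi>_def sum_negf)
    also have "(\<lambda>m. \<Sum>a\<in>{0..<int N}. \<phi> a * of_real (Re ((of_real r * unity_root N a) ^ m) / of_nat m))
       = (\<lambda>m. of_real (r ^ m) * gauss_sum N \<phi> (int m) / of_nat m)"
    proof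
      fix m :: nat
      have key: "complex_of_real (Re ((of_real r * unity_root N a) ^ m)) =
          of_real (r ^ m) * (unity_root N (int m * a) + unity_root N (int m * (- a))) / 2" for a
      proof -
        have "of_real (Re w) = (w + cnj w) / 2" for w by (simp add: complex_eq_iff)
        from this[of "unity_root N (int m * a)"]
        have "of_real (Re (unity_root N (int m * a))) = (unity_root N (int m * a) + unity_root N (int m * (- a))) / 2"
          by (simp add: cnj_unity_root)
        moreover have "(of_real r * unity_root N a) ^ m = of_real (r ^ m) * unity_root N (int m * a)"
          by (simp add: power_mult_distrib unity_root_power)
        then have "Re ((of_real r * unity_root N a) ^ m) = r ^ m * Re (unity_root N (int m * a))"
          by (simp del: of_real_power)
        ultimately show ?thesis by simp
      qed
      have "(\<Sum>a\<in>{0..<int N}. \<phi> a * of_real (Re ((of_real r * unity_root N a) ^ m) / of_nat m))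
        = (\<Sum>a\<in>{0..<int N}. of_real (r ^ m) / (2 * of_nat m) * (\<phi> a * unity_root N (int m * a) + \<phi> a * unity_root N (int m * (- a))))"
        by (intro sum.cong refl, simp only: of_real_divide key, simp add: field_simps)
      also have "\<dots> = of_real (r ^ m) / (2 * of_nat m) * (gauss_sum N \<phi> (int m) + (\<Sum>a\<in>{0..<int N}. \<phi> a * unity_root N (int m * (- a))))"
        by (simp only: gauss_sum_def sum.distrib sum_distrib_left[symmetric])
      \<comment> \<open>The real part is half a sum of two exponentials; evenness of
        \<open>\<phi>\<close> makes both give the same Gauss sum.\<close>
      also have "(\<Sum>a\<in>{0..<int N}. \<phi> a * unity_root N (int m * (- a))) = (\<Sum>a\<in>{0..<int N}. \<phi> ((-1) * a) * unity_root N (int m * ((-1) * a)))"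
        by (simp add: even)
      also have "\<dots> = gauss_sum N \<phi> (int m)"
        unfolding gauss_sum_def
        by (rule sum_periodic_scale[OF N0, of "\<lambda>a. \<phi> a * unity_root N (int m * a)"])
          (use unity_root_periodic[OF N0, of "int m * a" "int m" for a] in \<open>simp_all add: \<phi>D algebra_simps\<close>)
      finally show "(\<Sum>a\<in>{0..<int N}. \<phi> a * of_real (Re ((of_real r * unity_root N a) ^ m) / of_nat m))
         = of_real (r ^ m) * gauss_sum N \<phi> (int m) / of_nat m" by simp
    qed
    finally have s: "(\<lambda>m. of_real (r ^ m) * gauss_sum N \<phi> (int m) / of_nat m) sums (- \<Phi> r)" .
    \<comment> \<open>Only multiples of \<open>d\<close> carry a nonzero Gauss sum.\<close>
    have "(\<lambda>k. of_real (r ^ (d * k)) * gauss_sum N \<phi> (int (d * k)) / of_nat (d * k)) sums (- \<Phi> r)"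
    proof (subst sums_mono_reindex[where g = "\<lambda>k. d * k" and f = "\<lambda>m. of_real (r ^ m) * gauss_sum N \<phi> (int m) / of_nat m"])
      show "strict_mono (\<lambda>k. d * k)" using d by (intro strict_monoI) simp
      fix n assume "n \<notin> range (\<lambda>k. d * k)"
      then have "\<not> int d dvd int n" by (auto elim!: dvdE)
      then show "of_real (r ^ n) * gauss_sum N \<phi> (int n) / of_nat n = 0" by (simp add: G)
    qed (rule s)
    then have "(\<lambda>k. of_nat d / c * (of_real (r ^ (d * k)) * gauss_sum N \<phi> (int (d * k)) / of_nat (d * k))) sums (of_nat d / c * (- \<Phi> r))"
      by (rule sums_mult)
    moreover have "of_nat d / c * (of_real (r ^ (d * k)) * gauss_sum N \<phi> (int (d * k)) / of_nat (d * k)) = \<psi> k / of_nat k * of_real ((r ^ d) ^ k)" for k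
      using d c by (simp add: G \<psi>_def power_mult field_simps)
    ultimately show ?thesis by simp
  qed
  have part: "norm (\<Sum>k<n. \<psi> (Suc k)) \<le> real N" for n
    using norm_sum_periodic_le[OF N0 \<psi>p z1 \<psi>le, of "Suc n"] sum.lessThan_Suc_shift[of \<psi> n] \<psi>0 by simp
  have "summable (\<lambda>n. \<psi> (Suc n) * of_real (1 / real (Suc n)))"
  proof (rule summable_by_parts[OF part])
    show "(\<lambda>n. 1 / real (Suc n)) \<longlonglongrightarrow> 0" by (rule LIMSEQ_Suc[OF lim_1_over_n])
  qed (simp add: field_simps)
  then have "summable (\<lambda>n. \<psi> (Suc n) / of_nat (Suc n))" by (simp add: field_simps)
  then have sm: "summable (\<lambda>n. \<psi> n / of_nat n)" by (subst (asm) summable_Suc_iff)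
  define T where "T = (\<Sum>n. \<psi> n / of_nat n)"
  have T: "(\<lambda>n. \<psi> n / of_nat n) sums T" unfolding T_def using sm by (rule summable_sums)
  \<comment> \<open>A quantitative Abel theorem: the weights \<open>(1 - \<rho>^n) / n\<close>
    decrease from \<open>1 - \<rho>\<close> to 0, so their total variation is at most
    \<open>1 - \<rho>\<close>.\<close>
  have close: "norm (T + of_nat d / c * \<Phi> r) \<le> real N * (1 - r ^ d)" if r: "0 < r" "r < 1" for r
  proof -
    define \<rho> where "\<rho> = r ^ d"
    have \<rho>: "0 \<le> \<rho>" "\<rho> < 1" using r d by (simp_all add: \<rho>_def power_Suc_less_one power_less_one_iff)
    define b where "b n = (1 - \<rho> ^ Suc n) / real (Suc n)" for n
    define f where "f n = \<psi> n / of_nat n - \<psi> n / of_nat n * of_real (\<rho> ^ n)" for n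
    have "f sums (T - (- (of_nat d / c) * \<Phi> r))"
      unfolding f_def \<rho>_def by (rule sums_diff[OF T ser[OF r]])
    moreover have "f 0 = 0" by (simp add: f_def)
    ultimately have "(\<lambda>n. f (Suc n)) sums (T + of_nat d / c * \<Phi> r)" unfolding sums_Suc_iff by simp
    moreover have "f (Suc n) = \<psi> (Suc n) * of_real (b n)" for n
      by (simp add: f_def b_def algebra_simps diff_divide_distrib)
    ultimately have s: "(\<lambda>n. \<psi> (Suc n) * of_real (b n)) sums (T + of_nat d / c * \<Phi> r)" by simp
    show ?thesis unfolding \<rho>_def[symmetric]
    proof (rule norm_sums_by_parts_le[OF part _ _ s])
      show lim: "b \<longlonglongrightarrow> 0"
      proof (rule Lim_null_comparison[OF always_eventually])
        show "(\<lambda>n. 1 / real (Suc n)) \<longlonglongrightarrow> 0" by (rule LIMSEQ_Suc[OF lim_1_over_n])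
        show "\<forall>n. norm (b n) \<le> 1 / real (Suc n)"
          using \<rho> power_le_one[of \<rho> "Suc n" for n]
          by (simp add: b_def divide_right_mono del: power_Suc of_nat_Suc)
      qed
      have dec: "b (Suc n) \<le> b n" for n
        unfolding b_def using \<rho> by (intro one_minus_power_over_decreasing) auto
      have nn: "b n \<ge> 0" for n
        using \<rho> power_le_one[of \<rho> "Suc n"] by (simp add: b_def del: power_Suc of_nat_Suc)
      fix n
      have "(\<Sum>k<n. \<bar>b k - b (Suc k)\<bar>) = (\<Sum>k<n. b k - b (Suc k))" using dec by (intro sum.cong) auto
      also have "\<dots> = b 0 - b n" by (induction n) auto
      also have "\<dots> \<le> 1 - \<rho>" using nn[of n] by (simp add: b_def)
      finally show "(\<Sum>k<n. \<bar>b k - b (Suc k)\<bar>) \<le> 1 - \<rho>" .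
    qed
  qed
  \<comment> \<open>Where \<open>\<phi> a\<close> is nonzero, the root of unity differs from 1 and
    the logarithm is continuous there.\<close>
  have lim: "(\<Phi> \<longlongrightarrow> \<Phi> 1) (at_left 1)"
    unfolding \<Phi>_def
  proof (intro tendsto_sum)
    fix a assume a: "a \<in> {0..<int N}"
    show "((\<lambda>r. \<phi> a * of_real (ln (norm (1 - of_real r * unity_root N a)))) \<longlongrightarrow>
        \<phi> a * of_real (ln (norm (1 - of_real 1 * unity_root N a)))) (at_left 1)"
    proof (cases "\<phi> a = 0")
      case False
      then have "coprime a (int N)" using \<phi>D(4) by blast
      then have "\<not> int N dvd a" using N by (auto simp: coprime_absorb_right)
      then have "unity_root N a \<noteq> 1" using unity_root_eq_1_iff[OF N0] by simp
      then show ?thesis by (intro tendsto_intros) auto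
    qed simp
  qed
  have "\<Phi> 1 = 0" using rel by (simp add: \<Phi>_def)
  then have "((\<lambda>r. norm (T + of_nat d / c * \<Phi> r)) \<longlongrightarrow> norm (T + of_nat d / c * 0)) (at_left 1)"
    using lim by (intro tendsto_intros) auto
  moreover have "((\<lambda>r::real. real N * (1 - r ^ d)) \<longlongrightarrow> real N * (1 - 1 ^ d)) (at_left 1)"
    by (intro tendsto_intros)
  moreover have "\<forall>\<^sub>F r in at_left (1::real). norm (T + of_nat d / c * \<Phi> r) \<le> real N * (1 - r ^ d)"
    using eventually_at_left_real[OF zero_less_one] by (rule eventually_mono) (rule close, auto)
  ultimately have "norm (T + of_nat d / c * 0) \<le> real N * (1 - 1 ^ d)"
    by (intro tendsto_le[OF trivial_limit_at_left_real])
  then have "T = 0" by simp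
  then show False
    using T periodic_multiplicative_L1_nonzero[OF N0 \<psi>m \<psi>0 \<psi>1 \<psi>n \<psi>p z1 z2] by simp
qed

section \<open>The space of multiplicative relations\<close>

text \<open>This is the logarithm of \<open>|tan (\<pi> x / 4n)|\<close>, because shifting \<open>x\<close> by \<open>2n\<close> negates the root of unity.\<close>

definition log_tan :: "nat \<Rightarrow> int \<Rightarrow> real" where
  "log_tan n x = ln (norm (1 - unity_root (4 * n) x)) - ln (norm (1 - unity_root (4 * n) (x + 2 * int n)))"

text \<open>The last condition makes a character in this space nontrivial on the units congruent to \<open>1\<close> modulo
  each \<open>K \<in> Ks\<close>.\<close>

definition tan_relations :: "nat \<Rightarrow> int set \<Rightarrow> (int \<Rightarrow> complex) set" where
  "tan_relations n Ks = {D.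
     (\<forall>a. D (a + int (4 * n)) = D a) \<and> (\<forall>a. D a \<noteq> 0 \<longrightarrow> coprime a (int (4 * n))) \<and>
     (\<forall>a. D (- a) = D a) \<and> (\<forall>a. D (a + 2 * int n) = - D a) \<and>
     (\<forall>k. coprime k (int (4 * n)) \<longrightarrow> (\<Sum>a\<in>{0..<int (4 * n)}. D a * of_real (log_tan n (k * a))) = 0) \<and>
     (\<forall>K\<in>Ks. \<forall>a. (\<Sum>u\<in>{0..<int (4 * n)}. if [u = 1] (mod K) \<and> coprime u (int (4 * n)) then D (a * u) else 0) = 0)}"

lemma tan_relationsD:
  assumes "D \<in> tan_relations n Ks"
  shows "D (a + int (4 * n)) = D a" "D a \<noteq> 0 \<Longrightarrow> coprime a (int (4 * n))"
    "D (- a) = D a" "D (a + 2 * int n) = - D a"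
    "coprime k (int (4 * n)) \<Longrightarrow> (\<Sum>a\<in>{0..<int (4 * n)}. D a * of_real (log_tan n (k * a))) = 0"
    "K \<in> Ks \<Longrightarrow> (\<Sum>u\<in>{0..<int (4 * n)}. if [u = 1] (mod K) \<and> coprime u (int (4 * n)) then D (a * u) else 0) = 0"
  using assms unfolding tan_relations_def by blast+

lemma log_tan_cong:
  assumes "n > 0" "[a = b] (mod int (4 * n))"
  shows "log_tan n a = log_tan n b"
proof -
  have "unity_root (4 * n) (x + int (4 * n)) = unity_root (4 * n) x" for x
    using unity_root_periodic[of "4 * n" x 1] assms(1) by simp
  note * = this
  have "unity_root (4 * n) (x + int (4 * n) + 2 * int n) = unity_root (4 * n) (x + 2 * int n)" for x
    using *[of "x + 2 * int n"] by (simp only: add_ac)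
  then have "log_tan n (x + int (4 * n)) = log_tan n x" for x by (simp only: log_tan_def *)
  then show ?thesis by (rule periodic_int_cong[of "log_tan n" "4 * n", OF _ assms(2)])
qed

lemma log_tan_minus:
  assumes "n > 0"
  shows "log_tan n (- a) = log_tan n a"
proof -
  have eq: "norm (1 - unity_root N (- x)) = norm (1 - unity_root N x)" for N x
    using complex_mod_cnj[of "1 - unity_root N x"] by (simp add: cnj_unity_root)
  have "unity_root (4 * n) (- a + 2 * int n) = unity_root (4 * n) (- (a + 2 * int n))"
    using unity_root_periodic[of "4 * n" "- (a + 2 * int n)" 1] assms by (simp add: algebra_simps)
  then show ?thesis by (simp only: log_tan_def eq)
qed

lemma log_tan_shift:
  assumes "n > 0"
  shows "log_tan n (a + 2 * int n) = - log_tan n a"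
proof -
  have "unity_root (4 * n) (a + 2 * int n + 2 * int n) = unity_root (4 * n) a"
    using unity_root_periodic[of "4 * n" a 1] assms by (simp add: algebra_simps)
  then show ?thesis by (simp add: log_tan_def)
qed

text \<open>For odd \<open>u\<close>, \<open>(u - 1) * 2n\<close> is a multiple of
  \<open>4n\<close>; so multiplication by units commutes with the half-period shift.\<close>

lemma odd_mult_shift:
  assumes "odd (u :: int)"
  shows "[u * (a + 2 * int n) = u * a + 2 * int n] (mod int (4 * n))"
proof -
  obtain w where "u = 2 * w + 1" using assms by (elim oddE)
  then have "u * (a + 2 * int n) - (u * a + 2 * int n) = int (4 * n) * w" by (simp add: algebra_simps)
  then show ?thesis by (simp add: cong_iff_dvd_diff)
qed

lemma coprime_4n_odd: "coprime u (int (4 * n)) \<Longrightarrow> odd u"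
  using coprime_common_divisor[of u "int (4 * n)" 2] by auto

section \<open>Closure properties of the space of relations\<close>

text \<open>Substituting \<open>u * a\<close> moves the translation onto the argument of
  \<open>log_tan\<close>, where \<open>k\<close> becomes the unit \<open>k * v\<close> with
  \<open>v\<close> inverse to \<open>u\<close>.\<close>

lemma tan_relations_transl:
  assumes n: "n > 0" and D: "D \<in> tan_relations n Ks" and u: "coprime u (int (4 * n))"
  shows "(\<lambda>a. D (u * a)) \<in> tan_relations n Ks"
proof -
  note DD = tan_relationsD[OF D]
  have cg: "D a = D b" if "[a = b] (mod int (4 * n))" for a b
    by (rule periodic_int_cong[of D "4 * n", OF DD(1) that])
  obtain v where v: "[u * v = 1] (mod int (4 * n))" using u cong_solve_coprime_int by blast
  then have cv: "coprime v (int (4 * n))" by (metis coprime_iff_invertible_int mult.commute)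
  have rel: "(\<Sum>a\<in>{0..<int (4 * n)}. D (u * a) * of_real (log_tan n (k * a))) = 0"
    if k: "coprime k (int (4 * n))" for k
  proof -
    have "log_tan n (k * a) = log_tan n (k * v * (u * a))" for a
    proof (rule log_tan_cong[OF n])
      show "[k * a = k * v * (u * a)] (mod int (4 * n))"
        using cong_scalar_right[OF v, of "k * a"] by (simp add: mult_ac cong_sym)
    qed
    then have "(\<Sum>a\<in>{0..<int (4 * n)}. D (u * a) * of_real (log_tan n (k * a)))
       = (\<Sum>a\<in>{0..<int (4 * n)}. D (u * a) * of_real (log_tan n (k * v * (u * a))))" by simp
    also have "\<dots> = (\<Sum>a\<in>{0..<int (4 * n)}. D a * of_real (log_tan n (k * v * a)))"
    proof (rule sum_periodic_scale[of "4 * n" "\<lambda>a. D a * of_real (log_tan n (k * v * a))", OF _ _ u])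
      fix a
      have "log_tan n (k * v * (a + int (4 * n))) = log_tan n (k * v * a)"
        by (rule log_tan_cong[OF n]) (simp add: cong_iff_dvd_diff algebra_simps)
      then show "D (a + int (4 * n)) * of_real (log_tan n (k * v * (a + int (4 * n)))) = D a * of_real (log_tan n (k * v * a))"
        using DD(1) by simp
    qed (use n in simp)
    also have "\<dots> = 0" by (rule DD(5)) (use k cv in simp)
    finally show ?thesis .
  qed
  have "D (u * (a + int (4 * n))) = D (u * a)" for a
    by (rule cg) (simp add: cong_iff_dvd_diff algebra_simps)
  moreover have "D (u * a) \<noteq> 0 \<longrightarrow> coprime a (int (4 * n))" for a using DD(2)[of "u * a"] by simp
  moreover have "D (u * - a) = D (u * a)" for a using DD(3)[of "u * a"] by simp
  moreover have "D (u * (a + 2 * int n)) = - D (u * a)" for a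
    using cg[OF odd_mult_shift[OF coprime_4n_odd[OF u]]] DD(4) by metis
  moreover have "(\<Sum>w\<in>{0..<int (4 * n)}. if [w = 1] (mod K) \<and> coprime w (int (4 * n)) then D (u * (a * w)) else 0) = 0"
    if "K \<in> Ks" for K a using DD(6)[OF that, of "u * a"] by (simp only: mult.assoc)
  ultimately show ?thesis using rel unfolding tan_relations_def by blast
qed

lemma tan_relations_add:
  assumes D: "D \<in> tan_relations n Ks" and D': "D' \<in> tan_relations n Ks"
  shows "(\<lambda>a. D a + D' a) \<in> tan_relations n Ks"
proof -
  note DD = tan_relationsD[OF D] and DD' = tan_relationsD[OF D']
  have "(\<Sum>u\<in>{0..<int (4 * n)}. if [u = 1] (mod K) \<and> coprime u (int (4 * n)) then D (a * u) + D' (a * u) else 0) = 0"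
    if K: "K \<in> Ks" for K a
  proof -
    have "(\<Sum>u\<in>{0..<int (4 * n)}. if [u = 1] (mod K) \<and> coprime u (int (4 * n)) then D (a * u) + D' (a * u) else 0)
      = (\<Sum>u\<in>{0..<int (4 * n)}. (if [u = 1] (mod K) \<and> coprime u (int (4 * n)) then D (a * u) else 0)
         + (if [u = 1] (mod K) \<and> coprime u (int (4 * n)) then D' (a * u) else 0))"
      by (intro sum.cong refl) simp
    then show ?thesis unfolding sum.distrib DD(6)[OF K] DD'(6)[OF K] by simp
  qed
  moreover have "(\<Sum>a\<in>{0..<int (4 * n)}. (D a + D' a) * of_real (log_tan n (k * a))) = 0"
    if "coprime k (int (4 * n))" for k
    unfolding distrib_right sum.distrib DD(5)[OF that] DD'(5)[OF that] by simp
  moreover have "D a + D' a \<noteq> 0 \<longrightarrow> coprime a (int (4 * n))" for a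
    using DD(2)[of a] DD'(2)[of a] by fastforce
  ultimately show ?thesis using DD(1,3,4) DD'(1,3,4) by (simp add: tan_relations_def)
qed

lemma tan_relations_scale:
  assumes D: "D \<in> tan_relations n Ks"
  shows "(\<lambda>a. c * D a) \<in> tan_relations n Ks"
proof -
  note DD = tan_relationsD[OF D]
  have "(\<Sum>u\<in>{0..<int (4 * n)}. if [u = 1] (mod K) \<and> coprime u (int (4 * n)) then c * D (a * u) else 0) = 0"
    if K: "K \<in> Ks" for K a
  proof -
    have "(\<Sum>u\<in>{0..<int (4 * n)}. if [u = 1] (mod K) \<and> coprime u (int (4 * n)) then c * D (a * u) else 0)
      = (\<Sum>u\<in>{0..<int (4 * n)}. c * (if [u = 1] (mod K) \<and> coprime u (int (4 * n)) then D (a * u) else 0))"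
      by (intro sum.cong refl) simp
    then show ?thesis unfolding sum_distrib_left[symmetric] DD(6)[OF K] by simp
  qed
  moreover have "(\<Sum>a\<in>{0..<int (4 * n)}. (c * D a) * of_real (log_tan n (k * a))) = 0"
    if "coprime k (int (4 * n))" for k
    unfolding mult.assoc sum_distrib_left[symmetric] DD(5)[OF that] by simp
  moreover have "c * D a \<noteq> 0 \<longrightarrow> coprime a (int (4 * n))" for a using DD(2)[of a] by auto
  ultimately show ?thesis using DD(1,3,4) by (simp add: tan_relations_def)
qed

text \<open>Multiplication by \<open>h\<close> permutes the units congruent to 1 modulo
  \<open>K\<close>, so the two coset sums cancel. The earlier conditions \<open>Ks\<close> survive
  by translation invariance.\<close>

lemma tan_relations_difference:
  assumes n: "n > 0" and D: "D \<in> tan_relations n Ks" and h: "coprime h (int (4 * n))" "[h = 1] (mod K)"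
    and K: "K dvd int (4 * n)"
  shows "(\<lambda>a. D a - D (a * h)) \<in> tan_relations n (insert K Ks)"
proof -
  have "(\<lambda>a. D a + -1 * D (h * a)) \<in> tan_relations n Ks"
    by (intro tan_relations_add tan_relations_scale tan_relations_transl D n h)
  then have E: "(\<lambda>a. D a - D (a * h)) \<in> tan_relations n Ks" by (simp add: mult.commute)
  note DD = tan_relationsD[OF D]
  have "(\<Sum>u\<in>{0..<int (4 * n)}. if [u = 1] (mod K) \<and> coprime u (int (4 * n)) then D (a * u) - D (a * u * h) else 0) = 0"
    for a
  proof -
    define F where "F u = (if [u = 1] (mod K) \<and> coprime u (int (4 * n)) then D (a * u) else 0)" for u
    have Fper: "F (u + int (4 * n)) = F u" for u
    proof -
      have "[u + int (4 * n) = u + 0] (mod K)" using K by (intro cong_add) (simp_all add: cong_0_iff)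
      then have 1: "[u + int (4 * n) = 1] (mod K) \<longleftrightarrow> [u = 1] (mod K)" by (metis add_0_right cong_sym cong_trans)
      have 2: "coprime (u + int (4 * n)) (int (4 * n)) \<longleftrightarrow> coprime u (int (4 * n))"
        by (metis add.commute coprime_iff_gcd_eq_1 gcd_add1)
      have 3: "D (a * (u + int (4 * n))) = D (a * u)"
        by (rule periodic_int_cong[of D "4 * n", OF DD(1)]) (simp add: cong_iff_dvd_diff algebra_simps)
      show ?thesis unfolding F_def 1 2 3 ..
    qed
    have Fh: "F (h * u) = (if [u = 1] (mod K) \<and> coprime u (int (4 * n)) then D (a * u * h) else 0)" for u
    proof -
      have "[h * u = 1 * u] (mod K)" using h(2) by (rule cong_scalar_right)
      then have "[h * u = 1] (mod K) \<longleftrightarrow> [u = 1] (mod K)" by (metis cong_sym cong_trans mult_1)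
      then show ?thesis using h(1) by (simp add: F_def mult_ac)
    qed
    have "(\<Sum>u\<in>{0..<int (4 * n)}. if [u = 1] (mod K) \<and> coprime u (int (4 * n)) then D (a * u) - D (a * u * h) else 0)
      = (\<Sum>u\<in>{0..<int (4 * n)}. F u - F (h * u))"
      unfolding Fh by (intro sum.cong refl) (simp add: F_def)
    also have "\<dots> = 0"
      unfolding sum_subtractf using sum_periodic_scale[of "4 * n" F h, OF _ Fper h(1)] n by simp
    finally show ?thesis .
  qed
  then show ?thesis using E unfolding tan_relations_def by (auto simp: mult.assoc)
qed

section \<open>Characters in the space of relations\<close>

text \<open>Otherwise the vanishing sum through 1 would count the units congruent to 1 modulo
  \<open>K\<close>, and 1 is one of them.\<close>

lemma tan_relations_char_nontrivial:
  assumes n: "n > 0" and \<phi>: "dirichlet_char (4 * n) \<phi>" "\<phi> \<in> tan_relations n Ks" and K: "K \<in> Ks"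
  obtains u where "coprime u (int (4 * n))" "[u = 1] (mod K)" "\<phi> u \<noteq> 1"
proof -
  have "\<exists>u. coprime u (int (4 * n)) \<and> [u = 1] (mod K) \<and> \<phi> u \<noteq> 1"
  proof (rule ccontr)
    assume "\<nexists>u. coprime u (int (4 * n)) \<and> [u = 1] (mod K) \<and> \<phi> u \<noteq> 1"
    then have *: "\<phi> u = 1" if "coprime u (int (4 * n))" "[u = 1] (mod K)" for u using that by blast
    define S where "S = {u \<in> {0..<int (4 * n)}. [u = 1] (mod K) \<and> coprime u (int (4 * n))}"
    have "0 = (\<Sum>u\<in>{0..<int (4 * n)}. if [u = 1] (mod K) \<and> coprime u (int (4 * n)) then \<phi> (1 * u) else 0)"
      by (rule tan_relationsD(6)[OF \<phi>(2) K, symmetric])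
    also have "\<dots> = (\<Sum>u\<in>{0..<int (4 * n)}. if [u = 1] (mod K) \<and> coprime u (int (4 * n)) then 1 else 0)"
      using * by (intro sum.cong refl) auto
    also have "\<dots> = (\<Sum>u\<in>S. 1)" unfolding S_def by (rule sum.inter_filter[symmetric]) simp
    also have "\<dots> = of_nat (card S)" by simp
    finally have "card S = 0" by simp
    moreover have "1 \<in> S" using n by (simp add: S_def)
    moreover have "finite S" by (rule finite_subset[of _ "{0..<int (4 * n)}"]) (auto simp: S_def)
    ultimately show False by auto
  qed
  then show ?thesis using that by blast
qed

text \<open>A nonzero member yields a character \<open>\<phi>\<close> in the space. The sums modulo
  \<open>N / p\<close> give a unit on which \<open>\<phi>\<close> has odd order \<open>p\<close>;
  the other sums, with the sign under the half-period shift, put every prime into the conductor. No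
  such character exists by \<open>char_log_relation_contradiction\<close>.\<close>

lemma tan_relations_trivial:
  assumes n: "odd n" and p: "prime p" "p\<^sup>2 dvd n"
    and D: "D \<in> tan_relations n (insert (int (4 * n div p)) {int (4 * n div q ^ multiplicity q (4 * n)) | q. prime q \<and> q dvd n \<and> q \<noteq> p})"
  shows "D b = 0"
proof (rule ccontr)
  assume nz: "D b \<noteq> 0"
  define N where "N = 4 * n"
  have n0: "n > 0" using n by (cases n) auto
  have N0: "N > 1" "N > 0" using n0 by (simp_all add: N_def)
  define Ks where "Ks = insert (int (4 * n div p)) {int (4 * n div q ^ multiplicity q (4 * n)) | q. prime q \<and> q dvd n \<and> q \<noteq> p}"
  obtain \<phi> where \<phi>E: "\<phi> \<in> tan_relations n Ks" and \<phi>: "dirichlet_char N \<phi>"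
  proof (rule translation_invariant_contains_char[of N "tan_relations n Ks" D b])
    show "D \<in> tan_relations n Ks" using D by (simp add: Ks_def)
  qed (use N0 nz tan_relationsD tan_relations_transl[OF n0] tan_relations_add tan_relations_scale in \<open>auto simp: N_def\<close>)
  note \<phi>D = dirichlet_charD[OF \<phi>] and ED = tan_relationsD[OF \<phi>E, folded N_def]
  have podd: "odd p" using p n by (metis dvd_trans dvd_triv_left power2_eq_square)
  have pN: "N = p * (N div p)" "p dvd N div p"
  proof -
    have "p\<^sup>2 dvd N" using p(2) by (simp add: N_def)
    then obtain c where "N = p\<^sup>2 * c" by (rule dvdE)
    then have "N = p * (p * c)" by (simp add: power2_eq_square)
    then show "N = p * (N div p)" "p dvd N div p" using prime_gt_0_nat[OF p(1)] by auto
  qed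
  obtain u where u: "coprime u (int N)" "[u = 1] (mod int (N div p))" "\<phi> u \<noteq> 1"
    using tan_relations_char_nontrivial[OF n0 \<phi>[unfolded N_def] \<phi>E, of "int (4 * n div p)"] by (auto simp: Ks_def N_def)
  \<comment> \<open>With \<open>u = 1 + x\<close>, \<open>p\<close> dividing \<open>N / p\<close>
    makes \<open>x^2\<close> vanish modulo \<open>N\<close>, leaving \<open>1 + p x\<close>.\<close>
  have up: "[u ^ p = 1] (mod int N)"
  proof -
    obtain y where y: "u = 1 + int (N div p) * y" using u(2) by (metis cong_iff_lin cong_sym)
    define x where "x = int (N div p) * y"
    have "int N = int p * int (N div p)" using pN(1) by (metis of_nat_mult)
    then have px: "int N dvd int p * x" by (simp add: x_def)
    have "int p dvd int (N div p)" using pN(2) by simp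
    then have "int p * int (N div p) dvd x * x" unfolding x_def by (intro mult_dvd_mono) auto
    then have xx: "int N dvd x * x" using \<open>int N = int p * int (N div p)\<close> by simp
    have "[(1 + x) ^ k = 1 + int k * x] (mod int N)" for k
    proof (induction k)
      case (Suc k)
      have "[(1 + x) * (1 + x) ^ k = (1 + x) * (1 + int k * x)] (mod int N)"
        using Suc by (rule cong_scalar_left)
      moreover have "[(1 + x) * (1 + int k * x) = 1 + int (Suc k) * x] (mod int N)"
      proof -
        have "(1 + x) * (1 + int k * x) - (1 + int (Suc k) * x) = int k * (x * x)" by (simp add: algebra_simps)
        then show ?thesis using xx by (simp add: cong_iff_dvd_diff)
      qed
      ultimately show ?case using cong_trans by simp
    qed simp
    from this[of p] have "[u ^ p = 1 + int p * x] (mod int N)" by (simp add: y x_def)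
    moreover have "[1 + int p * x = 1] (mod int N)" using px by (simp add: cong_iff_dvd_diff)
    ultimately show ?thesis by (rule cong_trans)
  qed
  have u2: "(\<phi> u)\<^sup>2 \<noteq> 1"
  proof
    assume 2: "(\<phi> u)\<^sup>2 = 1"
    have "\<phi> u ^ p = 1"
      using periodic_int_cong[of \<phi> N, OF \<phi>D(1) up] \<phi>D(3) dirichlet_char_power[OF \<phi>] by simp
    moreover obtain m where "p = 2 * m + 1" using podd by (elim oddE)
    ultimately have "((\<phi> u)\<^sup>2) ^ m * \<phi> u = 1" by (simp only: power_add power_one_right power_mult)
    then show False using 2 u(3) by simp
  qed
  \<comment> \<open>An \<open>M\<close> prime to \<open>q\<close> divides a member of
    \<open>Ks\<close>, where \<open>\<phi>\<close> is known to be nontrivial; the prime 2 is treated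
    by the half-period shift.\<close>
  have rad: "q dvd M" if M: "M dvd int N" and triv: "\<And>u. coprime u (int N) \<Longrightarrow> [u = 1] (mod M) \<Longrightarrow> \<phi> u = 1"
    and q: "prime q" "q dvd int N" for M q
  proof (rule ccontr)
    assume qM: "\<not> q dvd M"
    then have cop: "coprime M q" using q(1) prime_imp_coprime coprime_commute by blast
    define q' where "q' = nat q"
    have q': "q = int q'" "prime q'" using q(1) prime_gt_0_int[OF q(1)] by (auto simp: q'_def)
    have Kno: False if K: "K \<in> Ks" "M dvd K" for K
    proof -
      obtain u where "coprime u (int N)" "[u = 1] (mod K)" "\<phi> u \<noteq> 1"
        using tan_relations_char_nontrivial[OF n0 \<phi>[unfolded N_def] \<phi>E K(1)] by (auto simp: N_def)
      then show False using triv[of u] K(2) cong_dvd_modulus by blast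
    qed
    show False
    proof (cases "q' = 2")
      \<comment> \<open>An odd \<open>M\<close> divides \<open>n\<close>, so \<open>1 + 2n\<close>
        is congruent to 1 modulo \<open>M\<close>, yet \<open>\<phi>\<close> takes the value -1
        there. That nonzero value also shows \<open>1 + 2n\<close> to be a unit.\<close>
      case True
      then have "coprime M 4" using cop q'(1) by (metis coprime_power_right_iff numeral_Bit0 numeral_code(2) of_nat_numeral pos2 power2_eq_square mult_2_right power2_eq_square mult_numeral_1 numeral_times_numeral semiring_norm(12) semiring_norm(13))
      then have "M dvd int n" using M by (simp add: N_def coprime_dvd_mult_right_iff)
      then have "[1 + 2 * int n = 1] (mod M)" by (simp add: cong_iff_dvd_diff)
      moreover have "coprime (1 + 2 * int n) (int N)"
      proof -
        have "\<phi> (1 + 2 * int n) = -1" using ED(4)[of 1] \<phi>D(3) by simp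
        then show ?thesis using \<phi>D(4)[of "1 + 2 * int n"] by simp
      qed
      ultimately have "\<phi> (1 + 2 * int n) = 1" by (intro triv)
      then show False using ED(4)[of 1] \<phi>D(3) by simp
    next
      case False
      have "q' dvd 4 * n" using q(2) unfolding q'(1) N_def by (simp only: int_dvd_int_iff)
      moreover have "\<not> q' dvd 4"
        using False q'(2) by (metis prime_dvd_power primes_dvd_imp_eq two_is_prime_nat power2_eq_square mult_2 numeral_Bit0 numeral_times_numeral semiring_norm(12) semiring_norm(13))
      ultimately have qn: "q' dvd n" using q'(2) by (simp add: prime_dvd_mult_iff)
      show False
      proof (cases "q' = p")
        case True
        have "int N = q * int (N div p)" using pN(1) q'(1) True by (metis of_nat_mult)
        then have "M dvd int (N div p)" using M cop by (simp add: coprime_dvd_mult_right_iff)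
        then show False using Kno[of "int (N div p)"] by (simp add: Ks_def N_def)
      next
        case False
        have "N = q' ^ multiplicity q' N * (N div q' ^ multiplicity q' N)" by (simp add: multiplicity_dvd)
        then have "int N = q ^ multiplicity q' N * int (N div q' ^ multiplicity q' N)"
          unfolding q'(1) by (metis of_nat_mult of_nat_power)
        then have "M dvd q ^ multiplicity q' N * int (N div q' ^ multiplicity q' N)" using M by simp
        then have "M dvd int (N div q' ^ multiplicity q' N)" using cop by (simp add: coprime_dvd_mult_right_iff)
        moreover have "int (N div q' ^ multiplicity q' N) \<in> Ks"
          unfolding Ks_def N_def using q'(2) qn False by blast
        ultimately show False using Kno by blast
      qed
    qed
  qed
  define g where "g a = complex_of_real (ln (norm (1 - unity_root N a)))" for a
  have gper: "g (a + int N) = g a" for a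
    using unity_root_periodic[OF N0(2), of a 1] by (simp add: g_def)
  have "0 = (\<Sum>a\<in>{0..<int N}. \<phi> a * of_real (log_tan n (1 * a)))"
    by (rule ED(5)[symmetric]) simp
  also have "\<dots> = (\<Sum>a\<in>{0..<int N}. \<phi> a * g a) - (\<Sum>a\<in>{0..<int N}. \<phi> a * g (a + 2 * int n))"
    unfolding sum_subtractf[symmetric] by (intro sum.cong refl) (simp add: log_tan_def g_def N_def algebra_simps)
  also have "(\<Sum>a\<in>{0..<int N}. \<phi> a * g (a + 2 * int n)) = (\<Sum>a\<in>{0..<int N}. - (\<phi> (a + 2 * int n) * g (a + 2 * int n)))"
    by (simp add: ED(4))
  \<comment> \<open>As \<open>\<phi>\<close> changes sign under the half-period shift, both halves
    of \<open>log_tan\<close> contribute equally, and the relation is one for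
    \<open>ln |1 - \<zeta>^a|\<close> alone.\<close>
  also have "\<dots> = - (\<Sum>a\<in>{0..<int N}. \<phi> a * g a)"
    unfolding sum_negf by (subst sum_periodic_shift[OF N0(2), of "\<lambda>a. \<phi> a * g a"]) (simp_all add: \<phi>D(1) gper)
  finally have rel: "(\<Sum>a\<in>{0..<int N}. \<phi> a * of_real (ln (norm (1 - unity_root N a)))) = 0"
    by (simp add: g_def)
  show False
    by (rule char_log_relation_contradiction[OF N0(1) \<phi> ED(3) rad u(1,3) u2 rel])
qed

section \<open>Relations with small support\<close>

text \<open>Produces the multipliers that act only at the prime \<open>q\<close>; the second
  assumption on \<open>N\<close> makes its primes visible in \<open>K\<close> or equal to
  \<open>q\<close>.\<close>

lemma cong_crt_coprime:
  fixes K :: int and q N :: nat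
  assumes q: "prime q" "\<not> int q dvd K" and N: "N > 0" "\<And>r. prime r \<Longrightarrow> r dvd int N \<Longrightarrow> r dvd K \<or> r = int q"
    and t: "\<not> int q dvd t"
  obtains h where "[h = 1] (mod K)" "[h = t] (mod int q)" "coprime h (int N)"
proof -
  have "prime (int q)" using q(1) by simp
  then have "coprime K (int q)" using q(2) prime_imp_coprime coprime_commute by blast
  then obtain h where h: "[h = 1] (mod K)" "[h = t] (mod int q)"
    using binary_chinese_remainder_int by blast
  have "\<not> r dvd h" if r: "prime r" "r dvd int N" for r
  proof
    assume "r dvd h"
    consider "r dvd K" | "r = int q" using N(2)[OF r] by blast
    then show False
    proof cases
      case 1
      then have "[h = 1] (mod r)" using h(1) cong_dvd_modulus by blast
      then have "r dvd 1" using \<open>r dvd h\<close> by (simp add: cong_dvd_iff)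
      then show False using r(1) not_prime_unit by blast
    next
      case 2
      then show False using h(2) \<open>r dvd h\<close> t by (simp add: cong_dvd_iff)
    qed
  qed
  then have "coprime h (int N)" using N(1) by (simp add: coprime_int_iff_primes)
  then show ?thesis using that h by blast
qed

text \<open>Four times the projection of the point mass at \<open>s\<close> to the functions that
  are even and change sign under the half-period shift.\<close>

definition symmetrised_delta :: "nat \<Rightarrow> int \<Rightarrow> int \<Rightarrow> complex" where
  "symmetrised_delta n s b = of_bool [b = s] (mod int (4 * n)) + of_bool [b = - s] (mod int (4 * n))
     - of_bool [b = s + 2 * int n] (mod int (4 * n)) - of_bool [b = - s + 2 * int n] (mod int (4 * n))"

lemma sum_of_bool_cong:
  fixes g :: "int \<Rightarrow> complex"
  assumes "N > 0" "\<And>a. g (a + int N) = g a"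
  shows "(\<Sum>b\<in>{0..<int N}. of_bool [b = s] (mod int N) * g b) = g s"
proof -
  have "(\<Sum>b\<in>{0..<int N}. of_bool [b = s] (mod int N) * g b) = (\<Sum>b\<in>{0..<int N}. if b = s mod int N then g b else 0)"
    by (intro sum.cong refl) (auto simp: cong_def)
  also have "\<dots> = g (s mod int N)" using assms(1) by simp
  also have "\<dots> = g s" by (rule periodic_int_mod[of g N, OF assms(2)])
  finally show ?thesis .
qed

text \<open>\<open>log_tan\<close> has the same two symmetries, so its pairing with a symmetrised
  point mass is four times its value at that point.\<close>

lemma symmetrised_delta_sum_mem:
  assumes n: "n > 0" "odd n" and a: "\<And>j. j \<in> J \<Longrightarrow> coprime (a j) (int (4 * n))"
    and rel: "\<And>k. coprime k (int (4 * n)) \<Longrightarrow> (\<Sum>j\<in>J. c j * log_tan n (k * a j)) = 0"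
  shows "(\<lambda>b. \<Sum>j\<in>J. of_real (c j) * symmetrised_delta n (a j) b) \<in> tan_relations n {}"
proof -
  define N where "N = 4 * n"
  have N: "N > 0" using n by (simp add: N_def)
  have per: "symmetrised_delta n s (b + int (4 * n)) = symmetrised_delta n s b" for s b
    by (simp add: symmetrised_delta_def cong_def)
  have ev: "symmetrised_delta n s (- b) = symmetrised_delta n s b" for s b
  proof -
    have 1: "[- b = x] (mod int (4 * n)) \<longleftrightarrow> [b = - x] (mod int (4 * n))" for x
      by (metis cong_minus_minus_iff minus_minus)
    have 2: "[b = - (x + 2 * int n)] (mod int (4 * n)) \<longleftrightarrow> [b = - x + 2 * int n] (mod int (4 * n))" for x
    proof -
      have "[- (x + 2 * int n) = - x + 2 * int n] (mod int (4 * n))"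
        unfolding cong_iff_dvd_diff by (rule dvdI[where k = "-1"]) simp
      then show ?thesis by (meson cong_sym cong_trans)
    qed
    show ?thesis unfolding symmetrised_delta_def 1 2 by simp
  qed
  have sh: "symmetrised_delta n s (b + 2 * int n) = - symmetrised_delta n s b" for s b
  proof -
    have 1: "[b + 2 * int n = x + 2 * int n] (mod int (4 * n)) \<longleftrightarrow> [b = x] (mod int (4 * n))" for x
      by (simp add: cong_iff_dvd_diff)
    have 2: "[b + 2 * int n = x] (mod int (4 * n)) \<longleftrightarrow> [b = x + 2 * int n] (mod int (4 * n))" for x
    proof -
      have "[b + 2 * int n = x] (mod int (4 * n)) \<longleftrightarrow> [b + 2 * int n = x + 2 * int n + 2 * int n] (mod int (4 * n))"
        by (simp add: cong_def)
      then show ?thesis using 1[of "x + 2 * int n"] by simp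
    qed
    show ?thesis unfolding symmetrised_delta_def 1 by (simp only: 2) simp
  qed
  have cop: "coprime b (int (4 * n))" if nz: "symmetrised_delta n s b \<noteq> 0" and s: "coprime s (int (4 * n))" for s b
  proof -
    have cg: "coprime b (int (4 * n))" if "[b = x] (mod int (4 * n))" "coprime x (int (4 * n))" for x
      using that by (metis cong_imp_coprime cong_sym)
    have sh: "coprime (x + 2 * int n) (int (4 * n))" if x: "coprime x (int (4 * n))" for x
    proof -
      have "coprime (x + 2 * int n) (int n)" 
      proof -
        have "coprime x (int n)" using x by simp
        then show ?thesis using gcd_add_mult[of "int n" 2 x]
          by (simp add: coprime_iff_gcd_eq_1 gcd.commute add.commute)
      qed
      moreover have "odd (x + 2 * int n)" using coprime_4n_odd[OF x] by simp
      then have "coprime (x + 2 * int n) (2 ^ 2)" by (simp only: coprime_power_right_iff) simp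
      ultimately show ?thesis by simp
    qed
    consider "[b = s] (mod int (4 * n))" | "[b = - s] (mod int (4 * n))"
      | "[b = s + 2 * int n] (mod int (4 * n))" | "[b = - s + 2 * int n] (mod int (4 * n))"
      using nz unfolding symmetrised_delta_def by fastforce
    then show ?thesis
      by cases (use cg s sh[of s] sh[of "-s"] in auto)
  qed
  have sumd: "(\<Sum>b\<in>{0..<int (4 * n)}. symmetrised_delta n s b * of_real (log_tan n (k * b))) = 4 * of_real (log_tan n (k * s))"
    if k: "coprime k (int (4 * n))" for s k
  proof -
    define g where "g b = complex_of_real (log_tan n (k * b))" for b
    have gp: "g (b + int N) = g b" for b
      unfolding g_def N_def by (rule arg_cong[where f = complex_of_real], rule log_tan_cong[OF n(1)]) (simp add: cong_iff_dvd_diff algebra_simps)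
    have gs: "g (b + 2 * int n) = - g b" for b
    proof -
      have "log_tan n (k * (b + 2 * int n)) = log_tan n (k * b + 2 * int n)"
        by (rule log_tan_cong[OF n(1) odd_mult_shift[OF coprime_4n_odd[OF k]]])
      then show ?thesis using log_tan_shift[OF n(1), of "k * b"] by (simp add: g_def)
    qed
    have gm: "g (- b) = g b" for b using log_tan_minus[OF n(1), of "k * b"] by (simp add: g_def)
    have "(\<Sum>b\<in>{0..<int N}. symmetrised_delta n s b * g b) =
       (\<Sum>b\<in>{0..<int N}. of_bool [b = s] (mod int N) * g b) + (\<Sum>b\<in>{0..<int N}. of_bool [b = - s] (mod int N) * g b)
       - (\<Sum>b\<in>{0..<int N}. of_bool [b = s + 2 * int n] (mod int N) * g b) - (\<Sum>b\<in>{0..<int N}. of_bool [b = - s + 2 * int n] (mod int N) * g b)"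
      by (simp only: symmetrised_delta_def N_def distrib_right left_diff_distrib sum.distrib sum_subtractf)
    also have "\<dots> = 4 * g s"
      unfolding sum_of_bool_cong[of N g, OF N gp] gs gm by simp
    finally show ?thesis by (simp only: g_def N_def)
  qed
  have "(\<Sum>b\<in>{0..<int (4 * n)}. (\<Sum>j\<in>J. of_real (c j) * symmetrised_delta n (a j) b) * of_real (log_tan n (k * b))) = 0"
    if k: "coprime k (int (4 * n))" for k
  proof -
    have "(\<Sum>b\<in>{0..<int (4 * n)}. (\<Sum>j\<in>J. of_real (c j) * symmetrised_delta n (a j) b) * of_real (log_tan n (k * b)))
      = (\<Sum>j\<in>J. of_real (c j) * (\<Sum>b\<in>{0..<int (4 * n)}. symmetrised_delta n (a j) b * of_real (log_tan n (k * b))))"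
      unfolding sum_distrib_right sum_distrib_left mult.assoc by (rule sum.swap)
    also have "\<dots> = 4 * of_real (\<Sum>j\<in>J. c j * log_tan n (k * a j))"
      unfolding sumd[OF k] by (simp add: sum_distrib_left mult_ac)
    finally show ?thesis using rel[OF k] by simp
  qed
  moreover have "(\<Sum>j\<in>J. of_real (c j) * symmetrised_delta n (a j) b) \<noteq> 0 \<longrightarrow> coprime b (int (4 * n))" for b
  proof
    assume "(\<Sum>j\<in>J. of_real (c j) * symmetrised_delta n (a j) b) \<noteq> 0"
    then obtain j where "j \<in> J" "of_real (c j) * symmetrised_delta n (a j) b \<noteq> 0" by (meson sum.neutral)
    then show "coprime b (int (4 * n))" using cop[of "a j" b] a by simp
  qed
  ultimately show ?thesis by (simp add: tan_relations_def per ev sh sum_negf del: int_ops of_nat_mult)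
qed

text \<open>Translating by suitable units one prime at a time separates the point \<open>b\<close> from the rest of
  the support. The sign ambiguity is resolved by working in the residue class of \<open>b\<close> modulo the
  full power of \<open>p\<close>: there at most one of \<open>a j\<close> and \<open>- a j\<close> can occur.\<close>

lemma sparse_tan_relation_trivial:
  fixes a :: "'i \<Rightarrow> int"
  assumes n: "odd n" and p: "prime p" "p\<^sup>2 dvd n"
    and J: "finite J" "\<And>q. prime q \<Longrightarrow> q dvd n \<Longrightarrow> card J + 1 < q"
    and a: "\<And>j. j \<in> J \<Longrightarrow> coprime (a j) (int (4 * n))"
    and rel: "\<And>k. coprime k (int (4 * n)) \<Longrightarrow> (\<Sum>j\<in>J. c j * log_tan n (k * a j)) = 0"
  shows "(\<Sum>j\<in>J. of_real (c j) * symmetrised_delta n (a j) b) = 0"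
proof (rule ccontr)
  define D where "D b = (\<Sum>j\<in>J. of_real (c j) * symmetrised_delta n (a j) b)" for b
  assume "(\<Sum>j\<in>J. of_real (c j) * symmetrised_delta n (a j) b) \<noteq> 0"
  then have Db: "D b \<noteq> 0" by (simp add: D_def)
  define N where "N = 4 * n"
  have n0: "n > 0" using n by (cases n) auto
  have N0: "N > 0" using n0 by (simp add: N_def)
  have pn: "p dvd n" using p(2) by (metis dvd_trans dvd_triv_left power2_eq_square)
  have podd: "odd p" using pn n dvd_trans by blast
  have pp: "prime (int p)" using p(1) by simp
  have D0: "D \<in> tan_relations n {}"
    unfolding D_def by (rule symmetrised_delta_sum_mem[OF n0 n a rel])
  have cb: "coprime b (int N)" using tan_relationsD(2)[OF D0 Db] by (simp add: N_def)
  \<comment> \<open>Modulo \<open>n\<close> the half-period shift disappears and only the sign of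
    \<open>a j\<close> is left open.\<close>
  have supp: "\<exists>j\<in>J. [x = a j] (mod int n) \<or> [x = - a j] (mod int n)" if nz: "D x \<noteq> 0" for x
  proof -
    obtain j where j: "j \<in> J" "symmetrised_delta n (a j) x \<noteq> 0"
      using nz unfolding D_def by (metis (no_types, lifting) mult_zero_right sum.neutral)
    have "[x = a j] (mod int (4 * n)) \<or> [x = - a j] (mod int (4 * n))
        \<or> [x = a j + 2 * int n] (mod int (4 * n)) \<or> [x = - a j + 2 * int n] (mod int (4 * n))"
      using j(2) unfolding symmetrised_delta_def by fastforce
    moreover have "[x = y] (mod int n)" if "[x = y] (mod int (4 * n))" for y
      using that by (rule cong_dvd_modulus) simp
    moreover have "[x = y] (mod int n)" if "[x = y + 2 * int n] (mod int n)" for y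
      using that by (simp add: cong_def)
    ultimately show ?thesis using j(1) by blast
  qed
  define P where "P = p ^ multiplicity p N"
  define K where "K q = N div q ^ multiplicity q N" for q
  have NK: "N = q ^ multiplicity q N * K q" for q by (simp add: K_def multiplicity_dvd)
  have Kq: "\<not> q dvd K q" if "prime q" for q
    unfolding K_def using that N0 by (intro multiplicity_decompose) auto
  have N2: "p\<^sup>2 dvd N" using p(2) by (simp add: N_def)
  then have mult2: "multiplicity p N \<ge> 2" using p(1) N0 by (intro multiplicity_geI) auto
  then have pP: "p dvd P" unfolding P_def by (intro dvd_power) simp
  have PN: "P dvd N" unfolding P_def by (rule multiplicity_dvd)
  have Pn: "P dvd n"
  proof -
    have "coprime P 4"
    proof -
      have "coprime p 2" using podd by simp
      then have "coprime (p ^ multiplicity p N) (2 ^ 2)" by (simp only: coprime_power_left_iff coprime_power_right_iff) simp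
      then show ?thesis by (simp add: P_def)
    qed
    then show ?thesis using PN by (simp add: N_def coprime_dvd_mult_right_iff)
  qed
  have ap: "\<not> int p dvd a j" if "j \<in> J" for j
  proof
    assume "int p dvd a j"
    moreover have "int p dvd int (4 * n)" using pn by simp
    ultimately show False using a[OF that] pp coprime_common_divisor not_prime_unit by blast
  qed
  have bp: "\<not> int q dvd b" if "prime q" "q dvd n" for q
  proof
    assume "int q dvd b"
    moreover have "int q dvd int N" using that(2) by (simp add: N_def)
    moreover have "prime (int q)" using that(1) by simp
    ultimately show False using cb coprime_common_divisor not_prime_unit by blast
  qed
  define s where "s j = (if [b = a j] (mod int P) then a j else - a j)" for j
  have sgn: "[x = s j] (mod int n)"
    if j: "j \<in> J" and x: "[x = a j] (mod int n) \<or> [x = - a j] (mod int n)" and xb: "[x = b] (mod int P)" for x j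
  proof -
    show ?thesis
    proof (cases "[b = a j] (mod int P)")
      case True
      have "\<not> [x = - a j] (mod int n)"
      proof
        assume "[x = - a j] (mod int n)"
        then have "[x = - a j] (mod int P)" using Pn cong_dvd_modulus by (metis int_dvd_int_iff)
        then have "[a j = - a j] (mod int P)" using True xb by (meson cong_sym cong_trans)
        then have "[a j = - a j] (mod int p)" using pP cong_dvd_modulus by (metis int_dvd_int_iff)
        then have "int p dvd 2 * a j" by (simp add: cong_iff_dvd_diff)
        then have "int p dvd 2 \<or> int p dvd a j" using pp by (simp add: prime_dvd_mult_iff)
        moreover have "\<not> p dvd 2" using podd p(1) by (metis primes_dvd_imp_eq two_is_prime_nat dvd_refl)
        then have "\<not> int p dvd 2" by (metis int_dvd_int_iff of_nat_numeral)
        ultimately show False using ap[OF j] by blast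
      qed
      then show ?thesis using x True by (simp add: s_def)
    next
      case False
      then have "\<not> [x = a j] (mod int P)" using xb by (meson cong_sym cong_trans)
      then have "\<not> [x = a j] (mod int n)" using Pn cong_dvd_modulus by (metis int_dvd_int_iff)
      then show ?thesis using x False by (simp add: s_def)
    qed
  qed
  have supp': "\<exists>j\<in>J. [x = s j] (mod int n)" if "D x \<noteq> 0" "[x = b] (mod int P)" for x
    using supp[OF that(1)] sgn that(2) by blast

  have Np: "N = p * (N div p)" using pn by (simp add: N_def)
  have pNp: "p dvd N div p"
  proof -
    obtain e where "N = p\<^sup>2 * e" using N2 by (rule dvdE)
    then have "N = p * (p * e)" by (simp add: power2_eq_square)
    then show ?thesis using prime_gt_0_nat[OF p(1)] by auto
  qed
  \<comment> \<open>The \<open>p\<close> numbers \<open>b * (1 + i N / p)\<close> are distinct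
    modulo \<open>P\<close> but all congruent to \<open>b\<close> modulo \<open>p\<close>. If the
    support met each of their classes, each would be some \<open>a j\<close> or \<open>- a j\<close>
    modulo \<open>P\<close>; \<open>b\<close> fixes the sign modulo \<open>p\<close>, so different
    classes need different \<open>j\<close>, against \<open>p > card J\<close>.\<close>
  obtain i where i: "i < p" "\<And>x. [x = b * (1 + int (i * (N div p)))] (mod int P) \<Longrightarrow> D x = 0"
  proof -
    define B where "B i = b * (1 + int (i * (N div p)))" for i
    have "\<exists>i<p. \<forall>x. [x = B i] (mod int P) \<longrightarrow> D x = 0"
    proof (rule ccontr)
      assume "\<not> (\<exists>i<p. \<forall>x. [x = B i] (mod int P) \<longrightarrow> D x = 0)"
      then have ex: "\<exists>j\<in>J. [B i = a j] (mod int P) \<or> [B i = - a j] (mod int P)" if ip: "i < p" for i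
      proof -
        obtain x where x: "[x = B i] (mod int P)" "D x \<noteq> 0"
          using \<open>\<not> (\<exists>i<p. \<forall>x. [x = B i] (mod int P) \<longrightarrow> D x = 0)\<close> ip by blast
        obtain j where j: "j \<in> J" "[x = a j] (mod int n) \<or> [x = - a j] (mod int n)" using supp[OF x(2)] by blast
        then have "[x = a j] (mod int P) \<or> [x = - a j] (mod int P)"
          using Pn cong_dvd_modulus by (metis int_dvd_int_iff)
        then show ?thesis using x(1) j(1) by (meson cong_sym cong_trans)
      qed
      define f where "f i = (SOME j. j \<in> J \<and> ([B i = a j] (mod int P) \<or> [B i = - a j] (mod int P)))" for i
      have f: "f i \<in> J" "[B i = a (f i)] (mod int P) \<or> [B i = - a (f i)] (mod int P)" if "i < p" for i
        using someI_ex[of "\<lambda>j. j \<in> J \<and> ([B i = a j] (mod int P) \<or> [B i = - a j] (mod int P))"] ex[OF that]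
        unfolding f_def by blast+
      have Bp: "[B i = b] (mod int p)" for i
        using pNp by (simp add: B_def cong_iff_dvd_diff algebra_simps)
      have "inj_on f {..<p}"
      proof (rule inj_onI)
        fix i i' assume i: "i \<in> {..<p}" "i' \<in> {..<p}" "f i = f i'"
        define y where "y = a (f i)"
        have y: "\<not> int p dvd y" using ap f(1) i(1) by (simp add: y_def)
        have 1: "[B i = y] (mod int P) \<or> [B i = - y] (mod int P)" using f(2) i(1) by (simp add: y_def)
        have 2: "[B i' = y] (mod int P) \<or> [B i' = - y] (mod int P)" using f(2)[of i'] i by (simp add: y_def)
        have ny: "\<not> ([b = y] (mod int p) \<and> [b = - y] (mod int p))"
        proof
          assume "[b = y] (mod int p) \<and> [b = - y] (mod int p)"
          then have "[y = - y] (mod int p)" by (meson cong_sym cong_trans)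
          then have "int p dvd 2 * y" by (simp add: cong_iff_dvd_diff)
          then have "int p dvd 2 \<or> int p dvd y" using pp by (simp add: prime_dvd_mult_iff)
          moreover have "\<not> p dvd 2" using podd p(1) by (metis primes_dvd_imp_eq two_is_prime_nat dvd_refl)
          then have "\<not> int p dvd 2" by (metis int_dvd_int_iff of_nat_numeral)
          ultimately show False using y by blast
        qed
        have toB: "[b = z] (mod int p)" if "[B i = z] (mod int P)" for i z
          using that Bp[of i] pP cong_dvd_modulus by (metis cong_sym cong_trans int_dvd_int_iff)
        have "[B i = B i'] (mod int P)"
          using 1 2 ny toB by (meson cong_sym cong_trans)
        \<comment> \<open>\<open>N / p\<close> contains exactly one factor \<open>p\<close> less
          than \<open>P\<close>, so the difference of the indices is divisible by
          \<open>p\<close>.\<close>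
        then have "int P dvd b * (int (N div p) * (int i - int i'))"
          by (simp add: cong_iff_dvd_diff B_def algebra_simps)
        moreover have "coprime (int P) b"
          using bp[OF p(1) pn] pp by (simp add: P_def prime_imp_coprime coprime_power_left_iff)
        ultimately have "int P dvd int (N div p) * (int i - int i')"
          by (simp add: coprime_dvd_mult_right_iff)
        moreover have "N div p = p ^ (multiplicity p N - 1) * K p"
        proof -
          have "N = p * (p ^ (multiplicity p N - 1) * K p)"
            using NK[of p] mult2 by (metis Suc_diff_1 Suc_le_lessD mult.assoc numeral_2_eq_2 power_Suc Suc_leD)
          then show ?thesis using prime_gt_0_nat[OF p(1)] by (metis nonzero_mult_div_cancel_left neq0_conv)
        qed
        moreover have "P = p ^ (multiplicity p N - 1) * p"
          unfolding P_def using mult2 by (metis Suc_diff_1 Suc_le_lessD mult.commute numeral_2_eq_2 power_Suc Suc_leD)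
        ultimately have "int p ^ (multiplicity p N - 1) * int p dvd int p ^ (multiplicity p N - 1) * (int (K p) * (int i - int i'))"
          by (simp add: mult.assoc)
        then have "int p dvd int (K p) * (int i - int i')"
          using prime_gt_0_nat[OF p(1)] by (simp add: dvd_mult_cancel_left)
        moreover have "\<not> int p dvd int (K p)" using Kq[OF p(1)] by (simp add: int_dvd_int_iff)
        ultimately have "int p dvd int i - int i'" using pp by (simp add: prime_dvd_mult_iff)
        then have "[i = i'] (mod p)" by (simp add: cong_iff_dvd_diff flip: cong_int_iff)
        then show "i = i'" using i(1,2) by (simp add: cong_def)
      qed
      moreover have "f ` {..<p} \<subseteq> J" using f(1) by auto
      ultimately have "p \<le> card J" using card_inj_on_le[of f "{..<p}" J] J(1) by simp
      then show False using J(2)[OF p(1) pn] by simp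
    qed
    then show ?thesis using that unfolding B_def by blast
  qed
  define h where "h = 1 + int (i * (N div p))"
  have h1: "[h = 1] (mod int (N div p))" by (simp add: h_def cong_iff_dvd_diff)
  have hc: "coprime h (int N)"
  proof -
    have "\<not> r dvd h" if r: "prime r" "r dvd int N" for r
    proof
      assume "r dvd h"
      have "int N = int p * int (N div p)" using Np by (metis of_nat_mult)
      then have "r dvd int p \<or> r dvd int (N div p)" using r by (simp add: prime_dvd_mult_iff)
      moreover have "int p dvd int (N div p)" using pNp by simp
      ultimately have "r dvd int (N div p)" using dvd_trans by blast
      then have "[h = 1] (mod r)" using h1 cong_dvd_modulus by blast
      then have "r dvd 1" using \<open>r dvd h\<close> by (simp add: cong_dvd_iff)
      then show False using r(1) not_prime_unit by blast
    qed
    then show ?thesis using N0 by (simp add: coprime_int_iff_primes)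
  qed
  \<comment> \<open>The invariant: inside the class of \<open>b\<close> modulo \<open>P\<close>, the
    support stays within the residues \<open>s j\<close> modulo every prime not yet treated, so
    their number does not grow with the differences.\<close>
  have step: "\<exists>E\<in>tan_relations n (insert (int (N div p)) ((\<lambda>q. int (K q)) ` Q)). E b \<noteq> 0 \<and>
      (\<forall>x. [x = b] (mod int P) \<longrightarrow> E x \<noteq> 0 \<longrightarrow>
        (\<forall>q. prime q \<longrightarrow> q dvd n \<longrightarrow> q \<noteq> p \<longrightarrow> q \<notin> Q \<longrightarrow> (\<exists>j\<in>J. [x = s j] (mod int q))))"
    if "finite Q" "\<And>q. q \<in> Q \<Longrightarrow> prime q \<and> q dvd n \<and> q \<noteq> p" for Q
    using that
  proof (induction Q rule: finite_induct)
    case empty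
    \<comment> \<open>By the choice of \<open>i\<close>, the translated term vanishes on the class
      of \<open>b\<close> modulo \<open>P\<close>, where \<open>E\<close> agrees with
      \<open>D\<close>.\<close>
    define E where "E x = D x - D (x * h)" for x
    have EE: "E \<in> tan_relations n (insert (int (N div p)) ((\<lambda>q. int (K q)) ` {}))"
      unfolding E_def image_empty
      by (rule tan_relations_difference[OF n0 D0 hc[unfolded N_def] h1])
        (use Np in \<open>metis N_def dvd_triv_right of_nat_dvd_iff\<close>)
    have hb: "D (x * h) = 0" if "[x = b] (mod int P)" for x
    proof (rule i(2))
      show "[x * h = b * (1 + int (i * (N div p)))] (mod int P)"
        unfolding h_def[symmetric] using that by (rule cong_scalar_right)
    qed
    have "\<exists>j\<in>J. [x = s j] (mod int q)" if x: "[x = b] (mod int P)" "E x \<noteq> 0" and q: "q dvd n" for x q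
    proof -
      have "D x \<noteq> 0" using x hb[OF x(1)] by (simp add: E_def)
      then obtain j where "j \<in> J" "[x = s j] (mod int n)" using supp' x(1) by blast
      then show ?thesis using q cong_dvd_modulus by (metis int_dvd_int_iff)
    qed
    moreover have "E b \<noteq> 0" using hb[of b] Db by (simp add: E_def)
    ultimately show ?case using EE by blast
  next
    case (insert q Q)
    then have q: "prime q" "q dvd n" "q \<noteq> p" and qQ: "q \<notin> Q" by auto
    obtain E where E: "E \<in> tan_relations n (insert (int (N div p)) ((\<lambda>q. int (K q)) ` Q))" "E b \<noteq> 0"
      and Es: "\<And>x r. [x = b] (mod int P) \<Longrightarrow> E x \<noteq> 0 \<Longrightarrow> prime r \<Longrightarrow> r dvd n \<Longrightarrow> r \<noteq> p \<Longrightarrow> r \<notin> Q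
         \<Longrightarrow> \<exists>j\<in>J. [x = s j] (mod int r)"
      using insert.IH insert.prems by (metis (no_types, lifting) insertCI)
    \<comment> \<open>There are \<open>q - 1 > card J\<close> nonzero residues, so one of them is
      avoided by all \<open>s j\<close>.\<close>
    have "\<exists>t\<in>{1..<int q}. t \<notin> (\<lambda>j. s j mod int q) ` J"
    proof (rule ccontr)
      assume "\<not> ?thesis"
      then have "{1..<int q} \<subseteq> (\<lambda>j. s j mod int q) ` J" by blast
      then have "card {1..<int q} \<le> card J"
        using J(1) by (meson card_image_le card_mono finite_imageI le_trans)
      then show False using J(2)[OF q(1,2)] by simp
    qed
    then obtain t where t: "t \<in> {1..<int q}" "t \<notin> (\<lambda>j. s j mod int q) ` J" by blast
    have tq: "\<not> int q dvd t" using t(1) zdvd_not_zless by auto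
    have "coprime b (int q)" using bp[OF q(1,2)] q(1) by (metis coprime_commute prime_imp_coprime prime_nat_int_transfer)
    then obtain b' where b': "[b * b' = 1] (mod int q)" using cong_solve_coprime_int by blast
    have tb: "[b * (t * b') = t] (mod int q)" using cong_scalar_left[OF b', of t] by (simp add: mult_ac)
    have "\<not> int q dvd t * b'" using tb tq by (metis cong_dvd_iff dvd_mult)
    moreover have "r dvd int (K q) \<or> r = int q" if r: "prime r" "r dvd int N" for r
    proof -
      have "int N = int q ^ multiplicity q N * int (K q)" using NK[of q] by (metis of_nat_mult of_nat_power)
      then have "r dvd int q ^ multiplicity q N \<or> r dvd int (K q)" using r by (simp add: prime_dvd_mult_iff)
      moreover have "r = int q" if "r dvd int q ^ multiplicity q N"
        using that r(1) q(1) by (metis prime_dvd_power primes_dvd_imp_eq prime_nat_int_transfer)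
      ultimately show ?thesis by blast
    qed
    moreover have "\<not> int q dvd int (K q)" using Kq[OF q(1)] by (simp add: int_dvd_int_iff)
    ultimately obtain g where g: "[g = 1] (mod int (K q))" "[g = t * b'] (mod int q)" "coprime g (int N)"
      using cong_crt_coprime[OF q(1) _ N0, of "int (K q)" "t * b'"] by blast
    \<comment> \<open>The multiplier \<open>g\<close> sends \<open>b\<close> to the avoided residue
      \<open>t\<close> modulo \<open>q\<close>, so \<open>E (b * g) = 0\<close> and
      \<open>F b = E b\<close>. It is 1 modulo \<open>K q\<close>, hence disturbs neither the class
      modulo \<open>P\<close> nor residues modulo other primes.\<close>
    define F where "F x = E x - E (x * g)" for x
    have "F \<in> tan_relations n (insert (int (K q)) (insert (int (N div p)) ((\<lambda>q. int (K q)) ` Q)))"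
      unfolding F_def
      by (rule tan_relations_difference[OF n0 E(1) g(3)[unfolded N_def] g(1)])
        (use NK[of q] in \<open>metis N_def dvd_triv_right of_nat_dvd_iff\<close>)
    then have FE: "F \<in> tan_relations n (insert (int (N div p)) ((\<lambda>q. int (K q)) ` insert q Q))"
      by (simp add: insert_commute)
    have other: "[x * g = x] (mod m)" if "m dvd int (K q)" for x m
      using cong_scalar_left[OF cong_dvd_modulus[OF g(1) that], of x] by simp
    have copow: "int (r ^ e) dvd int (K q)" if "prime r" "r \<noteq> q" "r ^ e dvd N" for r e
    proof -
      have "coprime (r ^ e) (q ^ multiplicity q N)" using that(1,2) q(1) by (simp add: primes_coprime)
      then have "r ^ e dvd K q" using that(3) NK[of q] by (metis coprime_dvd_mult_right_iff)
      then show ?thesis by (simp only: int_dvd_int_iff)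
    qed
    have gP: "[x * g = x] (mod int P)" for x
      unfolding P_def by (rule other, rule copow) (use p(1) q(3) PN in \<open>auto simp: P_def\<close>)
    have "E (b * g) = 0"
    proof (rule ccontr)
      assume "E (b * g) \<noteq> 0"
      then obtain j where j: "j \<in> J" "[b * g = s j] (mod int q)"
        using Es[OF gP[of b] _ q qQ] by blast
      have "[b * g = b * (t * b')] (mod int q)" using g(2) by (rule cong_scalar_left)
      then have "[t = s j] (mod int q)" using tb j(2) by (meson cong_sym cong_trans)
      then have "t = s j mod int q" using t(1) by (simp add: cong_def)
      then show False using t(2) j(1) by blast
    qed
    then have "F b \<noteq> 0" using E(2) by (simp add: F_def)
    moreover have "\<exists>j\<in>J. [x = s j] (mod int r)"
      if x: "[x = b] (mod int P)" "F x \<noteq> 0" and r: "prime r" "r dvd n" "r \<noteq> p" "r \<notin> insert q Q" for x r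
    proof -
      have rK: "[x * g = x] (mod int r)"
      proof (rule other)
        have "r ^ 1 dvd N" using r(2) by (simp add: N_def)
        then show "int r dvd int (K q)" using copow[of r 1] r by simp
      qed
      have "E x \<noteq> 0 \<or> E (x * g) \<noteq> 0" using x(2) by (auto simp: F_def)
      then show ?thesis
      proof
        assume "E x \<noteq> 0"
        then show ?thesis using Es[OF x(1)] r by blast
      next
        assume "E (x * g) \<noteq> 0"
        moreover have "[x * g = b] (mod int P)" using gP[of x] x(1) by (rule cong_trans)
        ultimately obtain j where "j \<in> J" "[x * g = s j] (mod int r)" using Es r by blast
        then show ?thesis using rK by (meson cong_sym cong_trans)
      qed
    qed
    ultimately show ?case using FE by blast
  qed
  define Q where "Q = {q. prime q \<and> q dvd n \<and> q \<noteq> p}"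
  have "finite Q" by (rule finite_subset[of _ "{..n}"]) (use n0 in \<open>auto simp: Q_def dest: dvd_imp_le\<close>)
  then obtain E where E: "E \<in> tan_relations n (insert (int (N div p)) ((\<lambda>q. int (K q)) ` Q))" "E b \<noteq> 0"
    using step[of Q] unfolding Q_def by blast
  have "(\<lambda>q. int (K q)) ` Q = {int (4 * n div q ^ multiplicity q (4 * n)) | q. prime q \<and> q dvd n \<and> q \<noteq> p}"
    by (auto simp: Q_def K_def N_def)
  then have "E b = 0" using tan_relations_trivial[OF n p, of E b] E(1) by (simp add: N_def)
  then show False using E(2) by simp
qed

section \<open>From the tangent equation to logarithmic relations\<close>

lemma G_with_denominator:
  assumes "x \<in> G" "den x = N" "N > 0"
  obtains a :: int where "coprime a (int N)" "x = of_int a * pi / real N"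
proof -
  obtain q where q: "x = of_rat q * pi" using assms(1) by (auto simp: G_def)
  obtain a d where ad: "quotient_of q = (a, d)" by fastforce
  have "d > 0" "coprime a d" using quotient_of_denom_pos[OF ad] quotient_of_coprime[OF ad] by auto
  moreover have "nat d = N" using assms(2) q ad by (simp add: den_of_rat_pi)
  ultimately have d: "d = int N" "coprime a (int N)" by auto
  have "q = of_int a / of_int d" using ad by (rule quotient_of_div)
  then have "x = of_int a * pi / real N" by (simp add: q d(1) of_rat_divide)
  then show ?thesis using that d(2) by blast
qed

text \<open>Substitute \<open>\<i> tan y = (w - 1) / (w + 1)\<close> with
  \<open>w = cis (2 * y)\<close> and clear denominators. The plus sign comes from the square of
  \<open>\<i>\<close> on the left against its fourth power on the right.\<close>

lemma tan_relation_cis_identity: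
  fixes x :: "nat \<Rightarrow> real"
  assumes "(tan (x 0))\<^sup>2 = tan (x 1) * tan (x 2) * tan (x 3) * tan (x 4)"
    and "\<And>i. i \<in> {0..4} \<Longrightarrow> cos (x i) \<noteq> 0"
  shows "(cis (2 * x 0) - 1)\<^sup>2 * (\<Prod>i\<in>{1..4}. cis (2 * x i) + 1)
     + (cis (2 * x 0) + 1)\<^sup>2 * (\<Prod>i\<in>{1..4}. cis (2 * x i) - 1) = 0"
proof -
  have m: "cis (2 * y) - 1 = 2 * \<i> * of_real (sin y) * cis y" for y
    by (simp add: complex_eq_iff cos_double_sin sin_double power2_eq_square)
  have p: "cis (2 * y) + 1 = 2 * of_real (cos y) * cis y" for y
    by (simp add: complex_eq_iff cos_double_cos sin_double power2_eq_square)
  have S: "{1..4::nat} = {1, 2, 3, 4}" by auto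
  have c: "cos (x 0) \<noteq> 0" "cos (x 1) \<noteq> 0" "cos (x 2) \<noteq> 0" "cos (x 3) \<noteq> 0" "cos (x 4) \<noteq> 0"
    using assms(2) by auto
  have "(sin (x 0))\<^sup>2 * (cos (x 1) * cos (x 2) * cos (x 3) * cos (x 4))
      = (cos (x 0))\<^sup>2 * (sin (x 1) * sin (x 2) * sin (x 3) * sin (x 4))"
    using assms(1) c by (simp add: tan_def power_divide field_simps)
  then have r: "(of_real (sin (x 0)))\<^sup>2 * (of_real (cos (x 1)) * of_real (cos (x 2)) * of_real (cos (x 3)) * of_real (cos (x 4)))
      = ((of_real (cos (x 0)))\<^sup>2 * (of_real (sin (x 1)) * of_real (sin (x 2)) * of_real (sin (x 3)) * of_real (sin (x 4))) :: complex)"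
    by (simp only: of_real_mult[symmetric] of_real_power[symmetric])
  have "(2 * \<i> * s0 * e0)\<^sup>2 * ((2 * c1 * e1) * (2 * c2 * e2) * (2 * c3 * e3) * (2 * c4 * e4))
     + (2 * c0 * e0)\<^sup>2 * ((2 * \<i> * s1 * e1) * (2 * \<i> * s2 * e2) * (2 * \<i> * s3 * e3) * (2 * \<i> * s4 * e4))
     = 64 * e0\<^sup>2 * e1 * e2 * e3 * e4 * (c0\<^sup>2 * (s1 * s2 * s3 * s4) - s0\<^sup>2 * (c1 * c2 * c3 * c4))"
    for s0 s1 s2 s3 s4 c0 c1 c2 c3 c4 e0 e1 e2 e3 e4 :: complex
  proof -
    have ii: "\<i> * (\<i> * z) = - z" for z by (simp add: mult.assoc[symmetric])
    show ?thesis by (simp add: power2_eq_square algebra_simps ii)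
  qed
  then show ?thesis unfolding S m p using r by (simp add: mult.assoc[symmetric])
qed

text \<open>The cleared equation is an integer polynomial vanishing at a root of unity, so it also
  vanishes at its \<open>k\<close>-th power. Norms remove the sign and logarithms make the relation
  linear.\<close>

lemma log_tan_relation:
  fixes x :: "nat \<Rightarrow> real" and a :: "nat \<Rightarrow> int"
  assumes n: "n > 1" and a: "\<And>i. i \<in> {0..4} \<Longrightarrow> coprime (a i) (int (4 * n))"
    and a0: "\<And>i. i \<in> {0..4} \<Longrightarrow> a i > 0"
    and x: "\<And>i. i \<in> {0..4} \<Longrightarrow> x i = of_int (a i) * pi / real (4 * n)"
    and cos: "\<And>i. i \<in> {0..4} \<Longrightarrow> cos (x i) \<noteq> 0"
    and tan: "(tan (x 0))\<^sup>2 = tan (x 1) * tan (x 2) * tan (x 3) * tan (x 4)"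
    and k: "coprime k (int (4 * n))"
  shows "2 * log_tan n (k * a 0) = (\<Sum>i\<in>{1..4}. log_tan n (k * a i))"
proof -
  define N where "N = 4 * n"
  define z where "z = unity_root N 1"
  \<comment> \<open>Natural representatives of \<open>k\<close> and of the \<open>a i\<close> are
    needed as exponents of polynomials.\<close>
  define k' where "k' = nat (k mod int N)"
  have N0: "N > 0" using n by (simp add: N_def)
  have k': "int k' = k mod int N" using N0 by (simp add: k'_def)
  have kcong: "[int k' = k] (mod int N)" by (simp add: k' cong_def)
  have k'c: "coprime k' N"
    using k unfolding N_def[symmetric] by (metis kcong cong_imp_coprime cong_sym coprime_int_iff)
  define b where "b i = nat (a i)" for i
  have b: "int (b i) = a i" if "i \<in> {0..4}" for i using a0[OF that] by (simp add: b_def)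
  have zb: "z ^ b i = cis (2 * x i)" if "i \<in> {0..4}" for i
  proof -
    have "z ^ b i = unity_root N (a i)" using b[OF that] by (simp add: z_def unity_root_power)
    then show ?thesis using x[OF that] by (simp add: unity_root_def N_def algebra_simps)
  qed
  define P :: "int poly" where "P = (monom 1 (b 0) - 1)\<^sup>2 * (\<Prod>i\<in>{1..4}. monom 1 (b i) + 1)
     + (monom 1 (b 0) + 1)\<^sup>2 * (\<Prod>i\<in>{1..4}. monom 1 (b i) - 1)"
  have P: "ipoly P w = (w ^ b 0 - 1)\<^sup>2 * (\<Prod>i\<in>{1..4}. w ^ b i + 1) + (w ^ b 0 + 1)\<^sup>2 * (\<Prod>i\<in>{1..4}. w ^ b i - 1)" for w
    by (simp add: P_def ipoly_prod)
  have "(\<Prod>i\<in>{1..4}. z ^ b i + 1) = (\<Prod>i\<in>{1..4}. cis (2 * x i) + 1)"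
    "(\<Prod>i\<in>{1..4}. z ^ b i - 1) = (\<Prod>i\<in>{1..4}. cis (2 * x i) - 1)"
    by (auto intro!: prod.cong simp: zb)
  then have "ipoly P z = 0"
    unfolding P using tan_relation_cis_identity[OF tan cos] by (simp add: zb)
  moreover have "z ^ N = 1"
    unfolding z_def unity_root_power using unity_root_eq_1_iff[OF N0] by simp
  ultimately have Pk: "ipoly P (z ^ k') = 0" using ipoly_root_power_coprime[OF N0 _ k'c] by blast
  define w where "w i = unity_root N (k * a i)" for i
  have zk: "(z ^ k') ^ b i = w i" if "i \<in> {0..4}" for i
  proof -
    have "(z ^ k') ^ b i = unity_root N (int k' * a i)"
      using b[OF that] by (simp add: z_def unity_root_power mult.commute flip: power_mult)
    also have "\<dots> = w i"
      unfolding w_def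
      by (rule periodic_int_cong[of "unity_root N" N]) (use unity_root_periodic[OF N0, of _ 1] kcong in \<open>auto intro: cong_scalar_right\<close>)
    finally show ?thesis .
  qed
  have "(\<Prod>i\<in>{1..4}. (z ^ k') ^ b i + 1) = (\<Prod>i\<in>{1..4}. w i + 1)"
    "(\<Prod>i\<in>{1..4}. (z ^ k') ^ b i - 1) = (\<Prod>i\<in>{1..4}. w i - 1)"
    by (auto intro!: prod.cong simp: zk)
  then have "(w 0 - 1)\<^sup>2 * (\<Prod>i\<in>{1..4}. w i + 1) + (w 0 + 1)\<^sup>2 * (\<Prod>i\<in>{1..4}. w i - 1) = 0"
    using Pk unfolding P by (simp add: zk)
  then have "(w 0 - 1)\<^sup>2 * (\<Prod>i\<in>{1..4}. w i + 1) = - ((w 0 + 1)\<^sup>2 * (\<Prod>i\<in>{1..4}. w i - 1))"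
    by (simp add: eq_neg_iff_add_eq_0)
  then have "norm ((w 0 - 1)\<^sup>2 * (\<Prod>i\<in>{1..4}. w i + 1)) = norm ((w 0 + 1)\<^sup>2 * (\<Prod>i\<in>{1..4}. w i - 1))"
    by simp
  then have nrm: "(norm (w 0 - 1))\<^sup>2 * (\<Prod>i\<in>{1..4}. norm (w i + 1)) = (norm (w 0 + 1))\<^sup>2 * (\<Prod>i\<in>{1..4}. norm (w i - 1))"
    by (simp add: norm_mult norm_power prod_norm)
  have wp: "w i + 1 = 1 - unity_root N (k * a i + 2 * int n)" for i
  proof -
    have "unity_root N (2 * int n) = -1"
      using n by (simp add: unity_root_def N_def)
    then show ?thesis by (simp add: w_def unity_root_add)
  qed
  \<comment> \<open>Needed for the logarithms of the products: either equality would make the unit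
    \<open>k * a i\<close> divisible by \<open>n > 1\<close>.\<close>
  have nz: "w i \<noteq> 1" "w i + 1 \<noteq> 0" if i: "i \<in> {0..4}" for i
  proof -
    have c: "coprime (k * a i) (int N)" using k a[OF i] by (simp add: N_def)
    have "\<not> int N dvd k * a i"
      using c n zdvd1_eq[of "int N"] coprime_absorb_right[of "int N" "k * a i"] by (auto simp only: N_def)
    then show "w i \<noteq> 1" using unity_root_eq_1_iff[OF N0] by (simp add: w_def)
    have "\<not> int N dvd k * a i + 2 * int n"
    proof
      assume "int N dvd k * a i + 2 * int n"
      then have "int n dvd k * a i + 2 * int n" by (rule dvd_trans[rotated]) (simp add: N_def)
      then have "int n dvd k * a i" by (simp add: dvd_add_left_iff)
      moreover have "coprime (k * a i) (int n)" using c by (simp add: N_def)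
      ultimately show False
        using n zdvd1_eq[of "int n"] coprime_absorb_right[of "int n" "k * a i"] by auto
    qed
    then show "w i + 1 \<noteq> 0" unfolding wp using unity_root_eq_1_iff[OF N0] by auto
  qed
  have L: "log_tan n (k * a i) = ln (norm (w i - 1)) - ln (norm (w i + 1))" for i
    unfolding log_tan_def wp by (simp add: w_def N_def norm_minus_commute)
  have "ln ((norm (w 0 - 1))\<^sup>2 * (\<Prod>i\<in>{1..4}. norm (w i + 1))) = 2 * ln (norm (w 0 - 1)) + (\<Sum>i\<in>{1..4}. ln (norm (w i + 1)))"
  proof -
    have "ln (\<Prod>i\<in>{1..4}. norm (w i + 1)) = (\<Sum>i\<in>{1..4}. ln (norm (w i + 1)))"
      by (rule ln_prod) (use nz in auto)
    moreover have "(\<Prod>i\<in>{1..4}. norm (w i + 1)) > 0" by (rule prod_pos) (use nz in auto)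
    moreover have "norm (w 0 - 1) > 0" using nz(1)[of 0] by simp
    ultimately show ?thesis by (simp add: ln_mult_pos ln_realpow)
  qed
  moreover have "ln ((norm (w 0 + 1))\<^sup>2 * (\<Prod>i\<in>{1..4}. norm (w i - 1))) = 2 * ln (norm (w 0 + 1)) + (\<Sum>i\<in>{1..4}. ln (norm (w i - 1)))"
  proof -
    have "ln (\<Prod>i\<in>{1..4}. norm (w i - 1)) = (\<Sum>i\<in>{1..4}. ln (norm (w i - 1)))"
      by (rule ln_prod) (use nz in auto)
    moreover have "(\<Prod>i\<in>{1..4}. norm (w i - 1)) > 0" by (rule prod_pos) (use nz in auto)
    moreover have "norm (w 0 + 1) > 0" using nz(2)[of 0] by simp
    ultimately show ?thesis by (simp add: ln_mult_pos ln_realpow)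
  qed
  ultimately show ?thesis unfolding L using nrm by (simp add: sum_subtractf)
qed

section \<open>Solving the formal relation\<close>

text \<open>All differences are smaller than \<open>4n\<close> in absolute value, so congruences
  become equalities, and two of the four are impossible by sign.\<close>

lemma symmetrised_delta_eval:
  assumes "0 < s" "s < 2 * int n" "0 < b" "b < 2 * int n"
  shows "symmetrised_delta n s b = of_bool (b = s) - of_bool (b + s = 2 * int n)"
proof -
  have dv: "int (4 * n) dvd d \<longleftrightarrow> d = 0" if "\<bar>d\<bar> < int (4 * n)" for d
    using that zdvd_not_zless[of "\<bar>d\<bar>" "int (4 * n)"] by auto
  have "[b = s] (mod int (4 * n)) \<longleftrightarrow> b = s"
    unfolding cong_iff_dvd_diff by (subst dv) (use assms in auto)
  moreover have "\<not> [b = - s] (mod int (4 * n))"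
    unfolding cong_iff_dvd_diff by (subst dv) (use assms in auto)
  moreover have "\<not> [b = s + 2 * int n] (mod int (4 * n))"
    unfolding cong_iff_dvd_diff by (subst dv) (use assms in auto)
  moreover have "[b = - s + 2 * int n] (mod int (4 * n)) \<longleftrightarrow> b + s = 2 * int n"
    unfolding cong_iff_dvd_diff by (subst dv) (use assms in auto)
  ultimately show ?thesis by (simp add: symmetrised_delta_def)
qed

lemma permutes_of_enumeration:
  assumes "{j1, j2, j3, j4} = {1..4::nat}"
  obtains \<sigma> where "\<sigma> permutes {1..4::nat}" "\<sigma> 1 = j1" "\<sigma> 2 = j2" "\<sigma> 3 = j3" "\<sigma> 4 = j4"
proof -
  define \<sigma> where "\<sigma> i = (if i = 1 then j1 else if i = 2 then j2 else if i = 3 then j3 else if i = 4 then j4 else i)" for i :: nat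
  have S: "{1..4::nat} = {1, 2, 3, 4}" by auto
  have "\<sigma> ` {1..4} = {j1, j2, j3, j4}" unfolding S by (auto simp: \<sigma>_def)
  then have im: "\<sigma> ` {1..4} = {1..4}" using assms by simp
  then have "inj_on \<sigma> {1..4}" by (intro eq_card_imp_inj_on) auto
  then have "\<sigma> permutes {1..4}"
    using im by (intro bij_imp_permutes) (auto simp: bij_betw_def \<sigma>_def)
  then show ?thesis using that by (simp add: \<sigma>_def)
qed

lemma prime_square_dvd_if_not_squarefree:
  fixes n :: nat
  assumes "\<not> squarefree n" "n > 0"
  obtains p where "prime p" "p\<^sup>2 dvd n"
  using assms squarefree_factorial_semiring[of n] by auto

theorem theorem11p1:
  fixes n :: nat and x :: "nat \<Rightarrow> real"
  assumes "n \<ge> 9" and "odd n" and "\<not> squarefree n"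
    and "\<And>p. prime p \<Longrightarrow> p dvd n \<Longrightarrow> p > 5"
    and "\<And>i. i \<in> {0..4} \<Longrightarrow> x i \<in> G"
    and "(tan (x 0))\<^sup>2 = tan (x 1) * tan (x 2) * tan (x 3) * tan (x 4)"
    and "\<And>i. i \<in> {0..4} \<Longrightarrow> 0 < x i \<and> x i < pi / 2"
    and "\<And>i. i \<in> {0..4} \<Longrightarrow> den (x i) = 4 * n"
  shows "\<exists>\<sigma> (s :: rat) (t :: rat).
      \<sigma> permutes {1..4::nat} \<and>
      0 < s \<and> s < 1 / 2 \<and> 0 < t \<and> t \<le> 1 / 4 \<and>
      x 0 = of_rat s * pi \<and> x (\<sigma> 1) = of_rat s * pi \<and> x (\<sigma> 2) = of_rat s * pi \<and>
      x (\<sigma> 3) = of_rat t * pi \<and> x (\<sigma> 4) = of_rat (1 / 2 - t) * pi"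
proof -
  have n0: "n > 0" "n > 1" using assms(1) by auto
  obtain p where p: "prime p" "p\<^sup>2 dvd n" using prime_square_dvd_if_not_squarefree assms(3) n0(1) by blast
  have "\<exists>a :: int. coprime a (int (4 * n)) \<and> x i = of_int a * pi / real (4 * n)" if "i \<in> {0..4}" for i
    using G_with_denominator[OF assms(5,8)[OF that]] n0 by (metis mult_pos_pos zero_less_numeral)
  then obtain a :: "nat \<Rightarrow> int" where ac: "\<And>i. i \<in> {0..4} \<Longrightarrow> coprime (a i) (int (4 * n))"
    and ax: "\<And>i. i \<in> {0..4} \<Longrightarrow> x i = of_int (a i) * pi / real (4 * n)"
    by metis
  have ab: "0 < a i" "a i < 2 * int n" if i: "i \<in> {0..4}" for i
  proof -
    have "0 < real_of_int (a i) * pi / real (4 * n)" using assms(7)[OF i] ax[OF i] by simp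
    then show "0 < a i" using n0 by (simp add: zero_less_divide_iff zero_less_mult_iff)
    have "real_of_int (a i) * pi / real (4 * n) < pi / 2" using assms(7)[OF i] ax[OF i] by simp
    then have "real_of_int (a i) * pi < 2 * real n * pi" using n0 by (simp add: field_simps)
    then have "real_of_int (a i) < real_of_int (2 * int n)" by simp
    then show "a i < 2 * int n" by (simp only: of_int_less_iff)
  qed
  have cos: "cos (x i) \<noteq> 0" if "i \<in> {0..4}" for i
    using cos_gt_zero_pi[of "x i"] assms(7)[OF that] by auto
  define c :: "nat \<Rightarrow> real" where "c j = (if j = 0 then 2 else -1)" for j
  have S: "{0..4} = insert 0 {1..4::nat}" by auto
  have csum: "(\<Sum>j\<in>{0..4}. c j * f j) = 2 * f 0 - (\<Sum>j\<in>{1..4}. f j)" for f :: "nat \<Rightarrow> real"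
    unfolding S by (simp add: c_def sum_negf)
  have dsum: "2 * symmetrised_delta n (a 0) b = (\<Sum>j\<in>{1..4}. symmetrised_delta n (a j) b)" for b
  proof -
    have "(\<Sum>j\<in>{0..4}. of_real (c j) * symmetrised_delta n (a j) b) = 0"
    proof (rule sparse_tan_relation_trivial[OF assms(2) p _ _ ac])
      show "card {0..4::nat} + 1 < q" if q: "prime q" "q dvd n" for q
      proof -
        \<comment> \<open>Five points require \<open>q > 6\<close>; a prime factor exceeding 5 is
          odd, hence at least 7.\<close>
        have "q > 5" "odd q" using assms(2,4) q dvd_trans by blast+
        then have "q \<noteq> 6" by auto
        then show ?thesis using \<open>q > 5\<close> by simp
      qed
      fix k assume "coprime k (int (4 * n))"
      then show "(\<Sum>j\<in>{0..4}. c j * log_tan n (k * a j)) = 0"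
        unfolding csum using log_tan_relation[of n a x k] n0 ac ab(1) ax cos assms(6) by simp
    qed auto
    then show ?thesis unfolding S by (simp add: c_def sum_negf)
  qed
  define \<delta> :: "nat \<Rightarrow> nat \<Rightarrow> int" where "\<delta> j i = of_bool (a i = a j) - of_bool (a i + a j = 2 * int n)" for j i
  have \<delta>: "2 * \<delta> 0 i = (\<Sum>j\<in>{1..4}. \<delta> j i)" if i: "i \<in> {0..4}" for i
  proof -
    have e: "symmetrised_delta n (a j) (a i) = of_int (\<delta> j i)" if "j \<in> {0..4}" for j
      using symmetrised_delta_eval[of "a j" n "a i"] ab[OF i] ab[OF that] by (simp add: \<delta>_def)
    have "(\<Sum>j\<in>{1..4}. symmetrised_delta n (a j) (a i)) = (\<Sum>j\<in>{1..4}. of_int (\<delta> j i))"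
      by (intro sum.cong refl) (simp add: e)
    then have "of_int (2 * \<delta> 0 i) = (of_int (\<Sum>j\<in>{1..4}. \<delta> j i) :: complex)"
      using dsum[of "a i"] e[of 0] by simp
    then show ?thesis by (simp only: of_int_eq_iff)
  qed
  \<comment> \<open>The two terms would cancel only for \<open>a i = n\<close>, which is not prime
    to \<open>4n\<close>.\<close>
  have self: "\<delta> i i = 1" if i: "i \<in> {0..4}" for i
  proof -
    have "a i \<noteq> int n"
    proof
      assume "a i = int n"
      then show False using ac[OF i] n0 by simp
    qed
    then show ?thesis by (simp add: \<delta>_def)
  qed
  define B where "B = {j \<in> {1..4::nat}. a j = a 0}"
  \<comment> \<open>Evaluation at \<open>a 0\<close>: each summand is at most 1, and positive only
    for \<open>a j = a 0\<close>, so at least two indices coincide with 0.\<close>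
  have "2 = (\<Sum>j\<in>{1..4}. \<delta> j 0)" using \<delta>[of 0] self[of 0] by simp
  also have "\<dots> \<le> (\<Sum>j\<in>{1..4}. if a j = a 0 then 1 else 0)" by (rule sum_mono) (auto simp: \<delta>_def)
  also have "\<dots> = (\<Sum>j\<in>B. 1)" unfolding B_def by (rule sum.inter_filter[symmetric]) simp
  finally have "2 \<le> card B" by simp
  then obtain j1 j2 where j: "j1 \<in> B" "j2 \<in> B" "j1 \<noteq> j2"
    by (metis One_nat_def Suc_1 card_le_Suc0_iff_eq card.infinite not_less_eq_eq zero_le)
  have "card ({1..4} - {j1, j2}) = 2" using j by (simp add: B_def card_Diff_subset)
  then obtain k l where kl: "{1..4} - {j1, j2} = {k, l}" "k \<noteq> l" by (meson card_2_iff)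
  have "k \<in> {1..4} - {j1, j2}" "l \<in> {1..4} - {j1, j2}" unfolding kl(1) by simp_all
  then have k: "k \<in> {1..4}" "l \<in> {1..4}" and dist: "j1 \<notin> {j2, k, l}" "j2 \<notin> {k, l}"
    using j(3) by auto
  have "{1..4} = {j1, j2} \<union> ({1..4} - {j1, j2})" using j by (auto simp: B_def)
  then have en: "{1..4} = {j1, j2, k, l}" unfolding kl(1) by (simp only: Un_insert_left Un_empty_left)
  have aj: "a j1 = a 0" "a j2 = a 0" using j by (simp_all add: B_def)
  \<comment> \<open>Evaluation at \<open>a k\<close>: the terms of \<open>j1\<close> and
    \<open>j2\<close> cancel the left side, so the term of \<open>l\<close> must cancel
    \<open>\<delta> k k = 1\<close>.\<close>
  have "\<delta> j1 k = \<delta> 0 k" "\<delta> j2 k = \<delta> 0 k" unfolding \<delta>_def aj by auto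
  moreover have "(\<Sum>j\<in>{1..4}. \<delta> j k) = \<delta> j1 k + (\<delta> j2 k + (\<delta> k k + \<delta> l k))"
    unfolding en using dist kl(2) by simp
  ultimately have "\<delta> l k = -1" using \<delta>[of k] self[of k] k by simp
  then have akl: "a k + a l = 2 * int n" by (simp add: \<delta>_def of_bool_def split: if_splits)
  \<comment> \<open>Of the two remaining indices the one with the smaller value provides
    \<open>t\<close>; being at most half of \<open>2n\<close>, it gives
    \<open>t \<le> 1 / 4\<close>.\<close>
  have main: ?thesis if kl: "{j1, j2, k, l} = {1..4}" "a k + a l = 2 * int n" "a k \<le> a l" for k l
  proof -
    obtain \<sigma> where \<sigma>: "\<sigma> permutes {1..4::nat}" "\<sigma> 1 = j1" "\<sigma> 2 = j2" "\<sigma> 3 = k" "\<sigma> 4 = l"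
      using permutes_of_enumeration[OF kl(1)] .
    have mem: "j1 \<in> {0..4}" "j2 \<in> {0..4}" "k \<in> {0..4}" "l \<in> {0..4}" using kl(1) by auto
    define s :: rat where "s = of_int (a 0) / of_nat (4 * n)"
    define t :: rat where "t = of_int (a k) / of_nat (4 * n)"
    have rs: "of_rat s = real_of_int (a 0) / real (4 * n)" by (simp add: s_def of_rat_divide of_rat_mult)
    have rt: "of_rat t = real_of_int (a k) / real (4 * n)" by (simp add: t_def of_rat_divide of_rat_mult)
    have "real_of_int (a l) = 2 * real n - real_of_int (a k)" using kl(2) by linarith
    moreover have "of_rat (1 / 2 - t) = 1 / 2 - real_of_int (a k) / real (4 * n)"
      unfolding of_rat_diff rt by (simp add: of_rat_divide)
    ultimately have rt': "of_rat (1 / 2 - t) = real_of_int (a l) / real (4 * n)"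
      using n0 by (simp add: field_simps)
    have "rat_of_int (a 0) < rat_of_int (2 * int n)" "rat_of_int (a k) \<le> rat_of_int (int n)"
      unfolding of_int_less_iff of_int_le_iff using ab(2)[of 0] kl(2,3) by simp_all
    then have ineq: "0 < rat_of_int (a 0)" "rat_of_int (a 0) < 2 * of_nat n" "0 < rat_of_int (a k)" "rat_of_int (a k) \<le> of_nat n"
      using ab(1)[of 0] ab(1)[OF mem(3)] by simp_all
    have "0 < s" "s < 1 / 2" "0 < t" "t \<le> 1 / 4"
      using ineq n0 by (simp_all add: s_def t_def field_simps)
    moreover have "x 0 = of_rat s * pi" "x j1 = of_rat s * pi" "x j2 = of_rat s * pi"
      using ax[of 0] ax[OF mem(1)] ax[OF mem(2)] by (simp_all add: rs aj)
    moreover have "x k = of_rat t * pi" "x l = of_rat (1 / 2 - t) * pi"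
      unfolding rt rt' using ax[OF mem(3)] ax[OF mem(4)] by simp_all
    ultimately show ?thesis using \<sigma> by blast
  qed
  show ?thesis
  proof (cases "a k \<le> a l")
    case True
    then show ?thesis using main[of k l] en akl by simp
  next
    case False
    then show ?thesis using main[of l k] en akl by (simp add: insert_commute add.commute)
  qed
qed

end
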